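(* Let $D$ be a chord diagram with $2m$ chords ($m\ge 1$), and let $w_{\mathfrak{sl}_2,2}$ be the weight system associated with the Lie algebra $\mathfrak{sl}_2$ and the invariant bilinear form $2\langle\cdot,\cdot\rangle$, where $\langle x,y\rangle=\mathrm{Tr}(\rho(x)\rho(y))$ and $\rho$ is the standard two-dimensional representation of $\mathfrak{sl}_2$. Let $c_2$ be the Casimir element of $2\langle\cdot,\cdot\rangle$, and let $\pi_{2m}(D)$ be the projection of $D$ to primitive elements. Then $$w_{\mathfrak{sl}_2,2}(\pi_{2m}(D))=2R_m(D)\,c_2^m+\text{terms of degree less than } m \text{ in } c_2,$$ where $R_m(D)$ is the sum of the signs of all un-oriented circuits of length $2m$ in the oriented intersection graph $\Gamma(D)$.
   Context: **Chord diagrams.** A chord diagram with $n$ chords (degree $n$) is a counter-clockwise oriented circle with $2n$ distinct points paired by $n$ chords, up to orientation-preserving diffeomorphism of the circle. $V(D)$ is the set of chords of $D$; for $U\subseteq V(D)$, $D|_U$ is $D$ with only the chords in $U$ kept. The product $D_1\cdot D_2$ is the connected sum of the circles (respecting orientation), well defined modulo the 4-term relations. **Projection to primitives.** For a chord diagram $D$ with $n\ge1$ chords, $$\pi_n(D)=\sum_{k\ge1}\frac{(-1)^{k-1}}{k}\sum_{V(D)=V_1\sqcup\cdots\sqcup V_k} D|_{V_1}\cdot D|_{V_2}\cdots D|_{V_k},$$ where the inner sum is over ordered partitions of $V(D)$ into $k$ non-empty disjoint subsets. This is a linear combination of chord diagrams modulo 4-term relations. **The weight system.** Let $\mathfrak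 g$ be a Lie algebra with an ad-invariant non-degenerate symmetric bilinear form $B$. Let $(e_i)$ be a basis of $\mathfrak g$ and $(e_i^* )$ the $B$-dual basis. For a chord diagram $D$, choose a base point on the circle away from the chord endpoints. For each assignment of an index $i_a$ to every chord $a$, put $e_{i_a}$ at one endpoint of $a$ and $e_{i_a}^*$ at the other, and form the product in the universal enveloping algebra $U(\mathfrak g)$ of these elements in the order met when traversing the circle from the base point. The sum over all index assignments is the value on $D$ of the weight system associated with $\mathfrak g$ and $B$; it lies in the center of $U(\mathfrak g)$, is independent of the choices, and respects the 4-term relations; it is extended linearly. The Casimir element is $\sum_i e_ie_i^*$. For $\mathfrak g=\mathfrak{sl}_2$ the values lie in the ring of polynomials in the Casimir element. Write $w_{\mathfrak{sl}_2,\lambda}$ and $c_\lambda$ for the weight system and Casimir element of $\lambda\langle\cdot,\cdot\rangle$, so that $c_\lambda=c_1/\lambda$. **Oriented intersection graph.** $\Gamma(D)$ is the simple graph whose vertices are the chords of $D$, two being connected by an edge if the corresponding chords intersect. Orient each chord of $D$ arbitrarily (tail to head). For intersecting chords $a,b$, the edge goes from $a$ to $b$ if the tail of $b$ lies on the arc of the circle that starts at the tail of $a$ and goes counter-clockwise to the head of $a$; otherwise it goes from $b$ to $a$. **$R_k(D)$.** A circuit is a closed path in $\Gamma(D)$ with no repeated vertices. Given a circuit of even length $2k$, choose an arbitrary orientation of the circuit and assign to each of its edges the weight $+1$ if the orientation of the edge coincides with the orientation of the circuit and $-1$ otherwise. The sign of the circuit is the product of the weights over all the edges in the circuit. Define $R_k(D)=\sum_s\mathrm{sign}(s)$,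 where the sum is over all (un-oriented) circuits $s$ in $\Gamma(D)$ of length $2k$.
   Formalization: For m=1 the sum of signs over circuits of length 2 is counted with factor 1/2, since for two crossing chords the value is -c_2, while R_1 read literally is -1 or 0 and would give -2c_2 or 0; for m≥2 the definition of R_m is unchanged. *)

theory Defs
  imports "HOL-Analysis.Analysis" "HOL-Library.Poly_Mapping"
begin

section \<open>Chord diagrams\<close>

text \<open>
  A chord diagram is encoded by the word of chord labels read counter-clockwise along the circle
  from a base point, so every label occurs exactly twice. Words that differ by the choice of the
  base point or by a renaming of the chords encode the same chord diagram; they are identified in
  the space of chord diagrams below.
\<close>

definition chord_diagram :: "'c list \<Rightarrow> bool" where
  "chord_diagram D \<longleftrightarrow> (\<forall>a\<in>set D. count_list D a = 2)"

definition restrict_chords :: "'c list \<Rightarrow> 'c set \<Rightarrow> 'c list" where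
  "restrict_chords D U = filter (\<lambda>a. a \<in> U) D"

definition poly_mapping_scale :: "'a::comm_ring_1 \<Rightarrow> ('k \<Rightarrow>\<^sub>0 'a) \<Rightarrow> ('k \<Rightarrow>\<^sub>0 'a)" where
  "poly_mapping_scale c p = Poly_Mapping.map ((*) c) p"

lemma lookup_poly_mapping_scale [simp]:
  "Poly_Mapping.lookup (poly_mapping_scale c p) k = c * Poly_Mapping.lookup p k"
  unfolding poly_mapping_scale_def by transfer (auto simp: when_def)

global_interpretation poly_mapping_space: vector_space
  "poly_mapping_scale :: 'a::field \<Rightarrow> ('k \<Rightarrow>\<^sub>0 'a) \<Rightarrow> ('k \<Rightarrow>\<^sub>0 'a)"
  by standard (auto intro!: poly_mapping_eqI simp: lookup_add algebra_simps)

definition base_point_relations :: "('c list \<Rightarrow>\<^sub>0 'a::field) set" where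
  "base_point_relations =
     {Poly_Mapping.single D 1 - Poly_Mapping.single (rotate i D) 1 | D i. chord_diagram D}"

definition relabel_relations :: "('c list \<Rightarrow>\<^sub>0 'a::field) set" where
  "relabel_relations =
     {Poly_Mapping.single D 1 - Poly_Mapping.single (map f D) 1 | D f.
        chord_diagram D \<and> inj_on f (set D)}"

text \<open>
  An endpoint of the chord \<open>b\<close> moves past the two endpoints of the chord \<open>a\<close>. The other endpoint
  of \<open>b\<close> is anywhere in \<open>u\<close>, \<open>v\<close> or \<open>z\<close>.
\<close>

definition four_term_relations :: "('c list \<Rightarrow>\<^sub>0 'a::field) set" where
  "four_term_relations =
     {Poly_Mapping.single (u @ [b, a] @ v @ [a] @ z) 1
        - Poly_Mapping.single (u @ [a, b] @ v @ [a] @ z) 1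
        + Poly_Mapping.single (u @ [a] @ v @ [b, a] @ z) 1
        - Poly_Mapping.single (u @ [a] @ v @ [a, b] @ z) 1 | u v z a b.
        chord_diagram (u @ [b, a] @ v @ [a] @ z)}"

definition chord_relations :: "('c list \<Rightarrow>\<^sub>0 'a::field) set" where
  "chord_relations = poly_mapping_space.span
     (base_point_relations \<union> relabel_relations \<union> four_term_relations)"


section \<open>Projection to primitive elements\<close>

definition ordered_partitions :: "nat \<Rightarrow> 'c set \<Rightarrow> 'c set list set" where
  "ordered_partitions k V = {Vs. length Vs = k \<and> distinct Vs \<and> partition_on V (set Vs)}"

text \<open>
  Concatenation is the connected sum with both circles cut at their base points.
\<close>

definition primitive_projection_rep :: "'c list \<Rightarrow> ('c list \<Rightarrow>\<^sub>0 'a::field)" where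
  "primitive_projection_rep D =
     (\<Sum>k = 1..card (set D). \<Sum>Vs\<in>ordered_partitions k (set D).
        Poly_Mapping.single (concat (map (restrict_chords D) Vs)) ((-1) ^ (k - 1) / of_nat k))"

text \<open>
  The projection lives in the quotient by the relations, and is the coset of the above
  representative. Other choices for the connected sums give the same coset.
\<close>

definition primitive_projection :: "'c list \<Rightarrow> ('c list \<Rightarrow>\<^sub>0 'a::field) set" where
  "primitive_projection D = {x. x - primitive_projection_rep D \<in> chord_relations}"


section \<open>The universal enveloping algebra\<close>

text \<open>
  The free associative unital algebra on a set is the monoid algebra of the free monoid.
\<close>

datatype 'g word = Word "'g list"

instantiation word :: (type) monoid_add
begin

definition "0 = Word []"

fun plus_word :: "'a word \<Rightarrow> 'a word \<Rightarrow> 'a word" where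
  "Word xs + Word ys = Word (xs @ ys)"

instance
proof
  fix a b c :: "'a word"
  show "a + b + c = a + (b + c)" by (cases a; cases b; cases c) simp
  show "0 + a = a" by (cases a) (simp add: zero_word_def)
  show "a + 0 = a" by (cases a) (simp add: zero_word_def)
qed

end

abbreviation letter :: "'g \<Rightarrow> ('g word \<Rightarrow>\<^sub>0 'a::comm_ring_1)" where
  "letter x \<equiv> Poly_Mapping.single (Word [x]) 1"

text \<open>
  The universal enveloping algebra is the tensor algebra modulo
  \<open>x \<otimes> y - y \<otimes> x - [x, y]\<close>. The tensor algebra in turn is the free algebra on the elements of the
  Lie algebra modulo the linearity relations.
\<close>

inductive_set enveloping_ideal ::
  "('a::comm_ring_1 \<Rightarrow> 'g::ab_group_add \<Rightarrow> 'g) \<Rightarrow> ('g \<Rightarrow> 'g \<Rightarrow> 'g) \<Rightarrow> ('g word \<Rightarrow>\<^sub>0 'a) set"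
  for smul bracket where
  linear_add: "letter (x + y) - letter x - letter y \<in> enveloping_ideal smul bracket"
| linear_scale:
    "letter (smul c x) - Poly_Mapping.single 0 c * letter x \<in> enveloping_ideal smul bracket"
| commutator:
    "letter x * letter y - letter y * letter x - letter (bracket x y)
       \<in> enveloping_ideal smul bracket"
| add: "p \<in> enveloping_ideal smul bracket \<Longrightarrow> q \<in> enveloping_ideal smul bracket
    \<Longrightarrow> p + q \<in> enveloping_ideal smul bracket"
| left_mult: "p \<in> enveloping_ideal smul bracket \<Longrightarrow> r * p \<in> enveloping_ideal smul bracket"
| right_mult: "p \<in> enveloping_ideal smul bracket \<Longrightarrow> p * r \<in> enveloping_ideal smul bracket"

lemma enveloping_ideal_zero: "0 \<in> enveloping_ideal smul bracket"
  using enveloping_ideal.left_mult[OF enveloping_ideal.linear_add, of 0] by simp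

lemma enveloping_ideal_uminus:
  "p \<in> enveloping_ideal smul bracket \<Longrightarrow> - p \<in> enveloping_ideal smul bracket"
  using enveloping_ideal.left_mult[of p smul bracket "- 1"] by simp

lemma word_add_eq_0_iff: "(u :: 'g word) + v = 0 \<longleftrightarrow> u = 0 \<and> v = 0"
  by (cases u; cases v) (simp add: zero_word_def)

lemma lookup_times_word_0:
  fixes p q :: "'g word \<Rightarrow>\<^sub>0 'a::comm_ring_1"
  shows "Poly_Mapping.lookup (p * q) 0 = Poly_Mapping.lookup p 0 * Poly_Mapping.lookup q 0"
proof -
  have "Sum_any (\<lambda>v. Poly_Mapping.lookup q v when 0 = u + v)
      = (Poly_Mapping.lookup q 0 when u = 0)" for u :: "'g word"
  proof (cases "u = 0")
    case True
    then show ?thesis by simp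
  next
    case False
    then have "0 \<noteq> u + v" for v by (metis word_add_eq_0_iff)
    with False show ?thesis by simp
  qed
  then have "Poly_Mapping.lookup (p * q) 0
      = Sum_any (\<lambda>u. Poly_Mapping.lookup p u * (Poly_Mapping.lookup q 0 when u = 0))"
    by (simp add: times_poly_mapping.rep_eq prod_fun_def)
  also have "\<dots> = Sum_any (\<lambda>u. Poly_Mapping.lookup p u * Poly_Mapping.lookup q 0 when u = 0)"
    by (rule Sum_any.cong) (simp add: when_def)
  finally show ?thesis by simp
qed

lemma Word_Cons_neq_0 [simp]: "Word (x # xs) \<noteq> 0"
  by (simp add: zero_word_def)

lemma lookup_enveloping_ideal_0:
  "p \<in> enveloping_ideal smul bracket \<Longrightarrow> Poly_Mapping.lookup p 0 = 0"
  by (induction rule: enveloping_ideal.induct)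
     (auto simp: lookup_times_word_0 lookup_minus lookup_add lookup_single)


section \<open>The Lie algebra \<open>sl\<^sub>2\<close>\<close>

typedef (overloaded) 'a sl2 = "{X :: 'a::field_char_0^2^2. trace X = 0}"
  morphisms std_rep Abs_sl2
  by (rule exI[of _ 0]) (simp add: trace_def)

setup_lifting type_definition_sl2

instantiation sl2 :: (field_char_0) ab_group_add
begin

lift_definition zero_sl2 :: "'a sl2" is 0
  by (simp add: trace_def)

lift_definition plus_sl2 :: "'a sl2 \<Rightarrow> 'a sl2 \<Rightarrow> 'a sl2" is "(+)"
  by (simp add: trace_add)

lift_definition minus_sl2 :: "'a sl2 \<Rightarrow> 'a sl2 \<Rightarrow> 'a sl2" is "(-)"
  by (simp add: trace_sub)

lift_definition uminus_sl2 :: "'a sl2 \<Rightarrow> 'a sl2" is uminus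
  by (simp add: trace_def sum_negf)

instance
proof
  fix a b c :: "'a sl2"
  show "a + b + c = a + (b + c)" by transfer (rule add.assoc)
  show "a + b = b + a" by transfer (rule add.commute)
  show "0 + a = a" by transfer (rule add_0_left)
  show "- a + a = 0" by transfer (rule left_minus)
  show "a - b = a + - b" by transfer (rule diff_conv_add_uminus)
qed

end

lift_definition sl2_scale :: "'a::field_char_0 \<Rightarrow> 'a sl2 \<Rightarrow> 'a sl2"
  is "\<lambda>c X. \<chi> i j. c * X $ i $ j"
  unfolding mem_Collect_eq trace_def by (simp add: sum_distrib_left[symmetric])

lift_definition sl2_bracket :: "'a::field_char_0 sl2 \<Rightarrow> 'a sl2 \<Rightarrow> 'a sl2"
  is "\<lambda>X Y. X ** Y - Y ** X"
  unfolding mem_Collect_eq trace_sub by (subst trace_mul_sym) (rule diff_self)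

global_interpretation sl2: vector_space sl2_scale
proof
  fix a b :: 'a and x y :: "'a sl2"
  show "sl2_scale a (x + y) = sl2_scale a x + sl2_scale a y"
    by transfer (simp add: vec_eq_iff distrib_left)
  show "sl2_scale (a + b) x = sl2_scale a x + sl2_scale b x"
    by transfer (simp add: vec_eq_iff distrib_right)
  show "sl2_scale a (sl2_scale b x) = sl2_scale (a * b) x"
    by transfer (simp add: vec_eq_iff mult.assoc)
  show "sl2_scale 1 x = x"
    by transfer (simp add: vec_eq_iff)
qed

text \<open>
  The form \<open>\<lambda>\<langle>x, y\<rangle>\<close>, where \<open>\<langle>x, y\<rangle>\<close> is the trace form of the standard representation.
\<close>

definition sl2_form :: "'a::field_char_0 \<Rightarrow> 'a sl2 \<Rightarrow> 'a sl2 \<Rightarrow> 'a" where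
  "sl2_form l x y = l * trace (std_rep x ** std_rep y)"

definition sl2_dual_bases ::
  "('a::field_char_0 sl2 \<Rightarrow> 'a sl2 \<Rightarrow> 'a) \<Rightarrow> 'i set \<Rightarrow> ('i \<Rightarrow> 'a sl2) \<Rightarrow> ('i \<Rightarrow> 'a sl2) \<Rightarrow> bool"
where
  "sl2_dual_bases B I e e' \<longleftrightarrow>
     finite I \<and> inj_on e I \<and> sl2.independent (e ` I) \<and> sl2.span (e ` I) = UNIV \<and>
     (\<forall>i\<in>I. \<forall>j\<in>I. B (e i) (e' j) = (if i = j then 1 else 0))"

definition sl2_ideal :: "('a::field_char_0 sl2 word \<Rightarrow>\<^sub>0 'a) set" where
  "sl2_ideal = enveloping_ideal sl2_scale sl2_bracket"

lemma sl2_ideal_diff: "p \<in> sl2_ideal \<Longrightarrow> q \<in> sl2_ideal \<Longrightarrow> p - q \<in> sl2_ideal"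
  unfolding sl2_ideal_def
  using enveloping_ideal.add[OF _ enveloping_ideal_uminus, of p _ _ q] by simp

lemma sl2_ideal_eqI: "p = q \<Longrightarrow> p - q \<in> sl2_ideal"
  by (simp add: sl2_ideal_def enveloping_ideal_zero)

quotient_type (overloaded) 'a U_sl2 = "'a::field_char_0 sl2 word \<Rightarrow>\<^sub>0 'a" /
  "\<lambda>p q. p - q \<in> sl2_ideal"
  morphisms rep_U_sl2 U_sl2
proof (rule equivpI)
  show "reflp (\<lambda>p q :: 'a sl2 word \<Rightarrow>\<^sub>0 'a. p - q \<in> sl2_ideal)"
    by (rule reflpI) (simp add: sl2_ideal_def enveloping_ideal_zero)
  show "symp (\<lambda>p q :: 'a sl2 word \<Rightarrow>\<^sub>0 'a. p - q \<in> sl2_ideal)"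
  proof (rule sympI)
    fix p q :: "'a sl2 word \<Rightarrow>\<^sub>0 'a"
    assume "p - q \<in> sl2_ideal"
    then have "- (p - q) \<in> sl2_ideal" unfolding sl2_ideal_def by (rule enveloping_ideal_uminus)
    then show "q - p \<in> sl2_ideal" by simp
  qed
  show "transp (\<lambda>p q :: 'a sl2 word \<Rightarrow>\<^sub>0 'a. p - q \<in> sl2_ideal)"
  proof (rule transpI)
    fix p q r :: "'a sl2 word \<Rightarrow>\<^sub>0 'a"
    assume "p - q \<in> sl2_ideal" "q - r \<in> sl2_ideal"
    then have "(p - q) + (q - r) \<in> sl2_ideal" unfolding sl2_ideal_def by (rule enveloping_ideal.add)
    then show "p - r \<in> sl2_ideal" by simp
  qed
qed

instantiation U_sl2 :: (field_char_0) ring_1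
begin

lift_definition zero_U_sl2 :: "'a U_sl2" is 0 .

lift_definition one_U_sl2 :: "'a U_sl2" is 1 .

lift_definition plus_U_sl2 :: "'a U_sl2 \<Rightarrow> 'a U_sl2 \<Rightarrow> 'a U_sl2" is "(+)"
  unfolding sl2_ideal_def add_diff_add by (rule enveloping_ideal.add)

lift_definition minus_U_sl2 :: "'a U_sl2 \<Rightarrow> 'a U_sl2 \<Rightarrow> 'a U_sl2" is "(-)"
proof -
  fix p p' q q' :: "'a sl2 word \<Rightarrow>\<^sub>0 'a"
  assume "p - p' \<in> sl2_ideal" "q - q' \<in> sl2_ideal"
  then have "(p - p') - (q - q') \<in> sl2_ideal" by (rule sl2_ideal_diff)
  then show "p - q - (p' - q') \<in> sl2_ideal" by (simp add: algebra_simps)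
qed

lift_definition uminus_U_sl2 :: "'a U_sl2 \<Rightarrow> 'a U_sl2" is uminus
  proof -
  fix p q :: "'a sl2 word \<Rightarrow>\<^sub>0 'a"
  assume "p - q \<in> sl2_ideal"
  then have "- (p - q) \<in> sl2_ideal" unfolding sl2_ideal_def by (rule enveloping_ideal_uminus)
  then show "- p - - q \<in> sl2_ideal" by simp
qed

lift_definition times_U_sl2 :: "'a U_sl2 \<Rightarrow> 'a U_sl2 \<Rightarrow> 'a U_sl2" is "(*)"
proof -
  fix p p' q q' :: "'a sl2 word \<Rightarrow>\<^sub>0 'a"
  assume "p - p' \<in> sl2_ideal" "q - q' \<in> sl2_ideal"
  then have "(p - p') * q + p' * (q - q') \<in> sl2_ideal"
    unfolding sl2_ideal_def
    by (intro enveloping_ideal.add enveloping_ideal.left_mult enveloping_ideal.right_mult)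
  then show "p * q - p' * q' \<in> sl2_ideal" by (simp add: algebra_simps)
qed

instance
proof
  fix a b c :: "'a U_sl2"
  show "a + b + c = a + (b + c)" by transfer (rule sl2_ideal_eqI, rule add.assoc)
  show "a + b = b + a" by transfer (rule sl2_ideal_eqI, rule add.commute)
  show "0 + a = a" by transfer (rule sl2_ideal_eqI, rule add_0_left)
  show "- a + a = 0" by transfer (rule sl2_ideal_eqI, rule left_minus)
  show "a - b = a + - b" by transfer (rule sl2_ideal_eqI, rule diff_conv_add_uminus)
  show "a * b * c = a * (b * c)" by transfer (rule sl2_ideal_eqI, rule mult.assoc)
  show "1 * a = a" by transfer (rule sl2_ideal_eqI, rule mult_1_left)
  show "a * 1 = a" by transfer (rule sl2_ideal_eqI, rule mult_1_right)
  show "(a + b) * c = a * c + b * c" by transfer (rule sl2_ideal_eqI, rule distrib_right)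
  show "a * (b + c) = a * b + a * c" by transfer (rule sl2_ideal_eqI, rule distrib_left)
  show "(0 :: 'a U_sl2) \<noteq> 1"
  proof (transfer, rule notI)
    assume "0 - (1 :: 'a sl2 word \<Rightarrow>\<^sub>0 'a) \<in> sl2_ideal"
    then have "Poly_Mapping.lookup (0 - (1 :: 'a sl2 word \<Rightarrow>\<^sub>0 'a)) 0 = 0"
      unfolding sl2_ideal_def by (rule lookup_enveloping_ideal_0)
    then show False by (simp add: lookup_minus lookup_one)
  qed
qed

end

definition U_incl :: "'a::field_char_0 sl2 \<Rightarrow> 'a U_sl2" where
  "U_incl x = U_sl2 (letter x)"

definition U_scale :: "'a::field_char_0 \<Rightarrow> 'a U_sl2 \<Rightarrow> 'a U_sl2" where
  "U_scale c u = U_sl2 (Poly_Mapping.single 0 c) * u"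


section \<open>The weight system\<close>

text \<open>
  The base point of the circle is the beginning of the word. For every chord \<open>a\<close> the element
  \<open>e (s a)\<close> is put at the endpoint met first and the dual element at the other one.
\<close>

definition chord_weight ::
  "'i set \<Rightarrow> ('i \<Rightarrow> 'u::ring_1) \<Rightarrow> ('i \<Rightarrow> 'u) \<Rightarrow> 'c list \<Rightarrow> 'u" where
  "chord_weight I e e' D =
     (\<Sum>s\<in>set D \<rightarrow>\<^sub>E I.
        prod_list (map (\<lambda>p. if D ! p \<in> set (take p D) then e' (s (D ! p)) else e (s (D ! p)))
          [0..<length D]))"

definition weight_sl2 ::
  "'i set \<Rightarrow> ('i \<Rightarrow> 'a::field_char_0 sl2) \<Rightarrow> ('i \<Rightarrow> 'a sl2) \<Rightarrow> ('c list \<Rightarrow>\<^sub>0 'a) \<Rightarrow> 'a U_sl2" where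
  "weight_sl2 I e e' x =
     (\<Sum>D\<in>Poly_Mapping.keys x.
        U_scale (Poly_Mapping.lookup x D) (chord_weight I (U_incl \<circ> e) (U_incl \<circ> e') D))"

definition casimir_sl2 ::
  "'i set \<Rightarrow> ('i \<Rightarrow> 'a::field_char_0 sl2) \<Rightarrow> ('i \<Rightarrow> 'a sl2) \<Rightarrow> 'a U_sl2" where
  "casimir_sl2 I e e' = (\<Sum>i\<in>I. U_incl (e i) * U_incl (e' i))"


section \<open>Circuits in the oriented intersection graph\<close>

definition intersecting :: "'c list \<Rightarrow> 'c \<Rightarrow> 'c \<Rightarrow> bool" where
  "intersecting D a b \<longleftrightarrow>
     a \<noteq> b \<and> (restrict_chords D {a, b} = [a, b, a, b] \<or> restrict_chords D {a, b} = [b, a, b, a])"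

text \<open>
  An orientation of the chords is given by the position \<open>t a\<close> of the tail of every chord \<open>a\<close>.
\<close>

definition chord_orientation :: "'c list \<Rightarrow> ('c \<Rightarrow> nat) \<Rightarrow> bool" where
  "chord_orientation D t \<longleftrightarrow> (\<forall>a\<in>set D. t a < length D \<and> D ! t a = a)"

definition chord_head :: "'c list \<Rightarrow> ('c \<Rightarrow> nat) \<Rightarrow> 'c \<Rightarrow> nat" where
  "chord_head D t a = (THE p. p < length D \<and> D ! p = a \<and> p \<noteq> t a)"

definition ccw_arc :: "nat \<Rightarrow> nat \<Rightarrow> nat \<Rightarrow> nat set" where
  "ccw_arc n p q = (if p < q then {p<..<q} else {p<..<n} \<union> {..<q})"

definition edge_from_to :: "'c list \<Rightarrow> ('c \<Rightarrow> nat) \<Rightarrow> 'c \<Rightarrow> 'c \<Rightarrow> bool" where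
  "edge_from_to D t a b \<longleftrightarrow> t b \<in> ccw_arc (length D) (t a) (chord_head D t a)"

definition closed_path :: "'c list \<Rightarrow> 'c list \<Rightarrow> bool" where
  "closed_path D vs \<longleftrightarrow> set vs \<subseteq> set D \<and>
     (\<forall>i<length vs. intersecting D (vs ! i) (vs ! (Suc i mod length vs)))"

text \<open>
  A circuit with a starting point and a direction is the list of its vertices. An un-oriented
  circuit is a class of such lists up to rotation and reversal.
\<close>

definition circuit_class :: "'c list \<Rightarrow> 'c list set" where
  "circuit_class vs = {rotate i ws | i ws. ws = vs \<or> ws = rev vs}"

definition circuits :: "'c list \<Rightarrow> nat \<Rightarrow> 'c list set set" where
  "circuits D n = circuit_class ` {vs. length vs = n \<and> distinct vs \<and> closed_path D vs}"

definition oriented_circuit_sign :: "'c list \<Rightarrow> ('c \<Rightarrow> nat) \<Rightarrow> 'c list \<Rightarrow> int" where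
  "oriented_circuit_sign D t vs =
     (\<Prod>i<length vs. if edge_from_to D t (vs ! i) (vs ! (Suc i mod length vs)) then 1 else - 1)"

definition circuit_sign :: "'c list \<Rightarrow> ('c \<Rightarrow> nat) \<Rightarrow> 'c list set \<Rightarrow> int" where
  "circuit_sign D t s = oriented_circuit_sign D t (SOME vs. vs \<in> s)"

text \<open>
  A circuit of length 2 runs along an edge and back, so its sign is \<open>-1\<close>. Unlike longer circuits it
  coincides with its own reversal: it has one orientation instead of two. It is therefore counted
  with the factor \<open>1/2\<close>, so that \<open>2 R\<^sub>k(D)\<close>, with \<open>R\<^sub>k(D)\<close> rendered as \<open>circuit_sum k D t\<close>, is the sum of the signs of all oriented circuits for every
  \<open>k \<ge> 1\<close>. This is the convention the coefficient \<open>2 R\<^sub>m\<close> requires: for two crossing chords the value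
  of the weight system on the projection is \<open>- c\<^sub>2\<close>.
\<close>

definition circuit_sum :: "nat \<Rightarrow> 'c list \<Rightarrow> ('c \<Rightarrow> nat) \<Rightarrow> rat" where
  "circuit_sum k D t = (if k = 1 then 1 / 2 else 1) * of_int (\<Sum>s\<in>circuits D (2 * k). circuit_sign D t s)"

end

theory Submission
  imports Defs "HOL-Combinatorics.Multiset_Permutations"
begin

text \<open>
  The projection to primitive elements is a logarithm for the convolution of functions on sets of
  chords. If \<open>Z U\<close> is the value of the weight system on \<open>D\<close> restricted to \<open>U\<close>, then its value on the
  projection of \<open>D\<close> is \<open>\<kappa> V\<close>, where \<open>\<kappa>\<close> is determined by \<open>Z U = (\<Sum>W. \<kappa> W * Z (U - W))\<close>, the sum being
  over all \<open>W \<subseteq> U\<close> that contain a given chord of \<open>U\<close>.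

  Every \<open>Z U\<close> is a polynomial in the Casimir element and is known from the scalar by which it acts on
  the Verma module of highest weight \<open>l\<close>, realised on polynomials by \<open>F = x\<close>, \<open>H = l - 2 x \<partial>\<close>,
  \<open>E = l \<partial> - x \<partial>\<^sup>2\<close>. The Casimir element acts by \<open>l\<^sup>2/4 + l/2\<close>. Subtracting this scalar on every
  chord changes \<open>\<kappa>\<close> on single chords only, and what remains on a chord has degree \<open>1\<close> in \<open>l\<close>, with
  leading term \<open>l/2\<close> times \<open>\<partial> \<otimes> x + x \<otimes> \<partial> - x \<partial> \<otimes> 1 - 1 \<otimes> x \<partial> - 1 \<otimes> 1\<close>. Hence \<open>\<kappa> V\<close> has degree at
  most \<open>2 m\<close> in \<open>l\<close>, that is, at most \<open>m\<close> in the Casimir element.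

  Put around a word \<open>Y\<close>, the leading tensor gives \<open>- [x, [\<partial>, Y]]\<close>. The derivation \<open>[\<partial>, -]\<close> annihilates
  the tensors of the chords inside \<open>Y\<close>, and turns the tensor of a chord that crosses the given one into
  \<open>\<plusminus> (\<partial> \<otimes> 1 - 1 \<otimes> \<partial>)\<close>, which acts on what that chord encloses by \<open>\<plusminus> [\<partial>, -]\<close> in turn. This follows a
  path of intersecting chords until it meets \<open>[x, -]\<close> at the chord it started from, so that the leading
  coefficient of \<open>\<kappa> V\<close> is the signed number of Hamiltonian circuits.
\<close>

section \<open>The logarithm for the convolution of set functions\<close>

text \<open>The degree is the obstacle. In the Verma module a chord carries
  \<open>H \<otimes> H / 4\<close>, of degree 2 in \<open>l\<close>, so the bound chord by chord is
  twice the one that is wanted, and the projection stays below it only by cancellation. The square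
  of \<open>l\<close> enters through the Casimir scalar alone; once that is subtracted inside the
  tensors, the bound can be read off term by term.

  The logarithm is treated through its derivative \<open>f' / f\<close> at one chord. The resulting
  recursion has no denominators, has a unique solution, and passes to leading coefficients, because
  these multiply. So the leading coefficient of the projection is found by exhibiting a solution:
  sums over circuits through the chosen chord.

  A scalar on Verma modules determines a value only when the value is already known to be a
  polynomial in the Casimir element. This is shown separately, by counting weights and commuting
  with \<open>F\<close>.

  The form \<open>2\<langle>x, y\<rangle>\<close> makes the constants fit: each of the
  \<open>2m\<close> chords contributes \<open>1/2\<close>, the Casimir scalar has leading
  coefficient \<open>1/4\<close>, and \<open>(1/2)^(2m) = (1/4)^m\<close>.\<close>

definition subset_conv :: "('c set \<Rightarrow> 'r::comm_ring_1) \<Rightarrow> ('c set \<Rightarrow> 'r) \<Rightarrow> 'c set \<Rightarrow> 'r" where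
  "subset_conv f g U = (\<Sum>W\<in>Pow U. f W * g (U - W))"

definition subset_delta :: "'c set \<Rightarrow> 'r::comm_ring_1" where
  "subset_delta U = (if U = {} then 1 else 0)"

text \<open>\<open>subset_conv\<close> multiplies generating functions in variables indexed by the
  chords, modulo the squares of the variables. In that algebra this is the Euler operator
  \<open>x_v d/dx_v\<close>.\<close>

definition pointed :: "'c \<Rightarrow> ('c set \<Rightarrow> 'r::comm_ring_1) \<Rightarrow> 'c set \<Rightarrow> 'r" where
  "pointed v f U = (if v \<in> U then f U else 0)"

lemma subset_conv_cong:
  assumes "\<And>W. W \<subseteq> U \<Longrightarrow> f W = f' W" "\<And>W. W \<subseteq> U \<Longrightarrow> g W = g' W"
  shows "subset_conv f g U = subset_conv f' g' U"
  unfolding subset_conv_def using assms by (intro sum.cong) auto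

lemma subset_conv_commute: "subset_conv f g U = subset_conv g f U"
  unfolding subset_conv_def
  by (rule sum.reindex_bij_witness[of _ "\<lambda>W. U - W" "\<lambda>W. U - W"])
     (auto simp: double_diff mult.commute)

lemma subset_conv_assoc:
  assumes "finite U"
  shows "subset_conv (subset_conv f g) h U = subset_conv f (subset_conv g h) U"
proof -
  have "subset_conv (subset_conv f g) h U
      = (\<Sum>(W, X)\<in>Sigma (Pow U) Pow. f X * g (W - X) * h (U - W))"
    unfolding subset_conv_def using assms
    by (subst sum.Sigma[symmetric]) (auto simp: sum_distrib_right finite_subset)
  also have "\<dots> = (\<Sum>(X, Y)\<in>Sigma (Pow U) (\<lambda>X. Pow (U - X)). f X * (g Y * h (U - X - Y)))"
    by (rule sum.reindex_bij_witness[of _ "\<lambda>(X, Y). (X \<union> Y, X)" "\<lambda>(W, X). (X, W - X)"])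
       (auto simp: mult.assoc intro!: arg_cong2[where f = times] arg_cong[where f = h])
  also have "\<dots> = subset_conv f (subset_conv g h) U"
    unfolding subset_conv_def using assms
    by (subst sum.Sigma[symmetric]) (auto simp: sum_distrib_left)
  finally show ?thesis .
qed

lemma subset_conv_delta_left:
  assumes "finite U" shows "subset_conv subset_delta f U = f U"
proof -
  have "subset_conv subset_delta f U = (\<Sum>W\<in>Pow U. if W = {} then f U else 0)"
    unfolding subset_conv_def subset_delta_def by (rule sum.cong) auto
  also have "\<dots> = f U" using assms by (subst sum.delta) auto
  finally show ?thesis .
qed

lemma subset_conv_add_left:
  "subset_conv (\<lambda>W. f W + g W) h U = subset_conv f h U + subset_conv g h U"
  unfolding subset_conv_def by (simp add: distrib_right sum.distrib)

lemma subset_conv_scale_right: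
  "subset_conv f (\<lambda>W. c * g W) U = c * subset_conv f g U"
  unfolding subset_conv_def by (simp add: sum_distrib_left algebra_simps)

lemma subset_conv_sum_right:
  "subset_conv f (\<lambda>W. \<Sum>i\<in>I. g i W) U = (\<Sum>i\<in>I. subset_conv f (g i) U)"
  unfolding subset_conv_def sum_distrib_left by (rule sum.swap)

text \<open>A derivation, because \<open>v\<close> lies in exactly one of \<open>W\<close> and \<open>U - W\<close>.\<close>

lemma pointed_subset_conv:
  "pointed v (subset_conv f g) U = subset_conv (pointed v f) g U + subset_conv f (pointed v g) U"
proof (cases "v \<in> U")
  case True
  then show ?thesis
    unfolding subset_conv_def pointed_def sum.distrib[symmetric] by (auto intro!: sum.cong)
next
  case False
  then show ?thesis
    unfolding subset_conv_def pointed_def by (auto intro!: sum.neutral sum.neutral[symmetric])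
qed

primrec subset_conv_power :: "('c set \<Rightarrow> 'r::comm_ring_1) \<Rightarrow> nat \<Rightarrow> 'c set \<Rightarrow> 'r" where
  "subset_conv_power f 0 = subset_delta"
| "subset_conv_power f (Suc k) = subset_conv f (subset_conv_power f k)"

text \<open>The power rule for a derivation of a commutative algebra. The factor
  \<open>k + 1\<close> later accounts for the denominators of the projection.\<close>

lemma pointed_subset_conv_power:
  assumes "finite U"
  shows "pointed v (subset_conv_power f (Suc k)) U
    = of_nat (Suc k) * subset_conv (pointed v f) (subset_conv_power f k) U"
  using assms
proof (induction k arbitrary: U)
  case 0
  have *: "pointed v (subset_delta :: 'a set \<Rightarrow> 'b) = (\<lambda>_. 0)"
    by (auto simp: fun_eq_iff pointed_def subset_delta_def)
  have "subset_conv f (\<lambda>_. 0) U = 0" by (simp add: subset_conv_def)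
  then show ?case by (simp only: subset_conv_power.simps pointed_subset_conv *) simp
next
  case (Suc k)
  have fin: "finite W" if "W \<subseteq> U" for W using that Suc.prems finite_subset by blast
  have "subset_conv f (pointed v (subset_conv_power f (Suc k))) U
    = subset_conv f (\<lambda>W. of_nat (Suc k) * subset_conv (pointed v f) (subset_conv_power f k) W) U"
    by (rule subset_conv_cong) (use Suc.IH fin in auto)
  also have "\<dots> = of_nat (Suc k) * subset_conv f (subset_conv (pointed v f) (subset_conv_power f k))
      U"
    by (rule subset_conv_scale_right)
  also have "subset_conv f (subset_conv (pointed v f) (subset_conv_power f k)) U
      = subset_conv (subset_conv f (pointed v f)) (subset_conv_power f k) U"
    using Suc.prems by (simp add: subset_conv_assoc)
  also have "\<dots> = subset_conv (subset_conv (pointed v f) f) (subset_conv_power f k) U"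
    by (rule subset_conv_cong) (auto intro: subset_conv_commute)
  also have "\<dots> = subset_conv (pointed v f) (subset_conv_power f (Suc k)) U"
    using Suc.prems by (simp add: subset_conv_assoc)
  finally have "subset_conv f (pointed v (subset_conv_power f (Suc k))) U
    = of_nat (Suc k) * subset_conv (pointed v f) (subset_conv_power f (Suc k)) U" .
  then show ?case
    by (subst subset_conv_power.simps, subst pointed_subset_conv) (simp add: algebra_simps)
qed

text \<open>Each factor uses up at least one chord. This nilpotency makes the series below
  finite.\<close>

lemma subset_conv_power_eq_0:
  assumes "f {} = 0" "finite U" "card U < k"
  shows "subset_conv_power f k U = 0"
  using assms(2,3)
proof (induction k arbitrary: U)
  case (Suc k)
  have "f W * subset_conv_power f k (U - W) = 0" if "W \<subseteq> U" for W
  proof (cases "W = {}")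
    case False
    then have "card (U - W) < card U"
      using Suc.prems that by (intro psubset_card_mono) auto
    then show ?thesis using Suc by simp
  qed (simp add: assms)
  then show ?case by (auto simp: subset_conv_def intro!: sum.neutral)
qed simp

text \<open>The geometric series for \<open>1 / (1 + g)\<close>, where \<open>g\<close> is
  \<open>f\<close> with the value at \<open>{}\<close> replaced by \<open>0\<close>; it inverts
  \<open>f\<close> when \<open>f {} = 1\<close>.\<close>

definition subset_conv_inverse :: "('c set \<Rightarrow> 'r::comm_ring_1) \<Rightarrow> 'c set \<Rightarrow> 'r" where
  "subset_conv_inverse f U = (\<Sum>k\<le>card U. (-1) ^ k * subset_conv_power (f(({}) := 0)) k U)"

text \<open>Terms beyond \<open>card U\<close> vanish, so a single bound \<open>N\<close> serves all
  subsets of a given set.\<close>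

lemma subset_conv_inverse_eq:
  assumes "finite U" "card U \<le> N"
  shows "subset_conv_inverse f U = (\<Sum>k\<le>N. (-1) ^ k * subset_conv_power (f(({}) := 0)) k U)"
  unfolding subset_conv_inverse_def
  by (rule sum.mono_neutral_left) (use assms in \<open>auto simp: subset_conv_power_eq_0\<close>)

lemma subset_conv_inverse:
  assumes "finite U" "f {} = 1"
  shows "subset_conv f (subset_conv_inverse f) U = subset_delta U"
proof -
  let ?g = "f(({}) := 0)" and ?N = "card U"
  let ?s = "\<lambda>N W. \<Sum>k\<le>N. (-1) ^ k * subset_conv_power ?g k W"
  have fin: "finite W" if "W \<subseteq> U" for W using that assms finite_subset by blast
  have "subset_conv f (subset_conv_inverse f) U
      = subset_conv (\<lambda>W. subset_delta W + ?g W) (?s ?N) U"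
  proof (rule subset_conv_cong)
    show "subset_conv_inverse f W = ?s ?N W" if "W \<subseteq> U" for W
      by (rule subset_conv_inverse_eq) (use that assms fin in \<open>auto intro: card_mono\<close>)
  qed (auto simp: subset_delta_def assms)
  also have "\<dots> = ?s ?N U + subset_conv ?g (?s ?N) U"
    using assms by (simp del: fun_upd_apply add: subset_conv_add_left subset_conv_delta_left)
  also have "subset_conv ?g (?s ?N) U = (\<Sum>k\<le>?N. (-1) ^ k * subset_conv_power ?g (Suc k) U)"
    by (simp del: fun_upd_apply add: subset_conv_sum_right subset_conv_scale_right)
  also have "?s ?N U + \<dots> = subset_delta U + (-1) ^ ?N * subset_conv_power ?g (Suc ?N) U"
  proof -
    have "?s N U + (\<Sum>k\<le>N. (-1) ^ k * subset_conv_power ?g (Suc k) U)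
      = subset_delta U + (-1) ^ N * subset_conv_power ?g (Suc N) U" for N
      by (induction N) (simp_all add: algebra_simps)
    then show ?thesis .
  qed
  also have "subset_conv_power ?g (Suc ?N) U = 0"
    using assms by (intro subset_conv_power_eq_0) auto
  finally show ?thesis by simp
qed

text \<open>The quotient \<open>f' / f\<close> for the derivation \<open>pointed v\<close>. At a set
  containing \<open>v\<close> it agrees with the logarithm of \<open>f\<close>, because
  \<open>pointed v\<close> changes nothing there, yet it makes sense without dividing by
  integers.\<close>

definition log_derivative :: "'c \<Rightarrow> ('c set \<Rightarrow> 'r::comm_ring_1) \<Rightarrow> 'c set \<Rightarrow> 'r" where
  "log_derivative v f = subset_conv (pointed v f) (subset_conv_inverse f)"

lemma subset_conv_log_derivative:
  assumes "finite U" "f {} = 1"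
  shows "subset_conv (log_derivative v f) f U = pointed v f U"
proof -
  have fin: "finite W" if "W \<subseteq> U" for W using that assms finite_subset by blast
  have "subset_conv (log_derivative v f) f U
    = subset_conv (pointed v f) (subset_conv (subset_conv_inverse f) f) U"
    unfolding log_derivative_def by (rule subset_conv_assoc) fact
  also have "\<dots> = subset_conv (pointed v f) subset_delta U"
  proof (rule subset_conv_cong)
    fix W assume "W \<subseteq> U"
    then show "subset_conv (subset_conv_inverse f) f W = subset_delta W"
      using subset_conv_inverse[of W f] fin assms(2) by (metis subset_conv_commute)
  qed simp
  also have "\<dots> = pointed v f U"
    using assms by (metis subset_conv_commute subset_conv_delta_left)
  finally show ?thesis .
qed

text \<open>The recursion is solved for \<open>g\<close> by convolving with the inverse of
  \<open>f\<close>. Logarithmic derivatives are computed below by exhibiting a solution.\<close>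

lemma log_derivative_unique:
  assumes "finite V" "f {} = 1"
    and "\<And>U. U \<subseteq> V \<Longrightarrow> subset_conv g f U = pointed v f U"
    and "U \<subseteq> V"
  shows "g U = log_derivative v f U"
proof -
  have fin: "finite W" if "W \<subseteq> V" for W using that assms finite_subset by blast
  have "log_derivative v f U = subset_conv (subset_conv g f) (subset_conv_inverse f) U"
    unfolding log_derivative_def by (rule subset_conv_cong) (use assms in auto)
  also have "\<dots> = subset_conv g (subset_conv f (subset_conv_inverse f)) U"
    by (rule subset_conv_assoc) (rule fin[OF assms(4)])
  also have "\<dots> = subset_conv g subset_delta U"
  proof (rule subset_conv_cong)
    fix W assume "W \<subseteq> U"
    then have "finite W" using assms fin by blast
    then show "subset_conv f (subset_conv_inverse f) W = subset_delta W"
      using assms(2) by (rule subset_conv_inverse)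
  qed simp
  also have "\<dots> = g U"
    using fin[OF assms(4)] by (metis subset_conv_commute subset_conv_delta_left)
  finally show ?thesis by simp
qed

lemma subset_conv_power_eq_log_derivative:
  assumes "finite V" "v \<in> V"
  shows "log_derivative v f V
    = (\<Sum>k<card V. (-1) ^ k * subset_conv (pointed v f) (subset_conv_power (f(({}) := 0)) k) V)"
proof -
  let ?g = "f(({}) := 0)"
  have "log_derivative v f V
      = subset_conv (pointed v f) (\<lambda>W. \<Sum>k<card V. (-1) ^ k * subset_conv_power ?g k W) V"
    unfolding log_derivative_def subset_conv_def
  proof (rule sum.cong)
    fix W assume W: "W \<in> Pow V"
    show "pointed v f W * subset_conv_inverse f (V - W)
        = pointed v f W * (\<Sum>k<card V. (-1) ^ k * subset_conv_power ?g k (V - W))"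
    proof (cases "v \<in> W")
      case True
      \<comment> \<open>As \<open>v\<close> lies in \<open>W\<close>, the rest is strictly smaller
        than \<open>V\<close>, so the powers below \<open>card V\<close> suffice, uniformly in
        \<open>W\<close>.\<close>
      have "card (V - W) < card V"
        using assms W True by (intro psubset_card_mono) auto
      then have "subset_conv_inverse f (V - W)
          = (\<Sum>k\<le>card V - 1. (-1) ^ k * subset_conv_power ?g k (V - W))"
        using assms by (intro subset_conv_inverse_eq) auto
      moreover have "{..card V - 1} = {..<card V}"
        using \<open>card (V - W) < card V\<close> by auto
      ultimately show ?thesis by simp
    qed (simp add: pointed_def)
  qed simp
  also have "\<dots> = (\<Sum>k<card V. (-1) ^ k * subset_conv (pointed v f) (subset_conv_power ?g k) V)"
    by (simp add: subset_conv_sum_right subset_conv_scale_right)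
  finally show ?thesis .
qed

text \<open>The power rule read at a set containing \<open>v\<close>. It turns the coefficients
  \<open>(-1)^k\<close> of the geometric series into \<open>(-1)^k / (k + 1)\<close>, those of the
  logarithm.\<close>

lemma of_nat_log_derivative_term:
  assumes "finite V" "v \<in> V"
  shows "of_nat (Suc k) * subset_conv (pointed v f) (subset_conv_power (f(({}) := 0)) k) V
    = subset_conv_power (f(({}) := 0)) (Suc k) V"
proof -
  have "pointed v (f(({}) := 0)) = pointed v f" by (auto simp: pointed_def fun_eq_iff)
  then show ?thesis
    using pointed_subset_conv_power[OF assms(1), of v "f(({}) := 0)" k] assms(2)
    by (simp add: pointed_def)
qed

section \<open>Ordered partitions and the series of the logarithm\<close>

lemma ordered_partitions_Suc:
  "ordered_partitions (Suc k) V
    = (\<Union>W\<in>Pow V - {{}}. (#) W ` ordered_partitions k (V - W))" (is "?L = ?R")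
proof
  show "?L \<subseteq> ?R"
  proof
    fix Vs assume "Vs \<in> ?L"
    then obtain W Ws where Vs: "Vs = W # Ws" and Ws: "length Ws = k" "distinct Ws" "W \<notin> set Ws"
      and p: "partition_on V (insert W (set Ws))"
      by (auto simp: ordered_partitions_def length_Suc_conv)
    have W: "W \<subseteq> V" "W \<noteq> {}" using p by (auto simp: partition_on_def)
    have disj: "X \<inter> W = {}" if "X \<in> set Ws" for X
    proof -
      have "disjoint (insert W (set Ws))" using p by (simp add: partition_on_def)
      moreover have "X \<noteq> W" using that Ws by auto
      ultimately show ?thesis using that by (auto simp: disjoint_def)
    qed
    have "partition_on (V - W) (set Ws)"
      unfolding partition_on_def
    proof (intro conjI)
      show "\<Union> (set Ws) = V - W" using p disj unfolding partition_on_def by blast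
      show "disjoint (set Ws)"
        using p by (auto simp: partition_on_def pairwise_insert)
      show "{} \<notin> set Ws" using p by (auto simp: partition_on_def)
    qed
    with W Ws Vs show "Vs \<in> ?R" by (auto simp: ordered_partitions_def)
  qed
  show "?R \<subseteq> ?L"
  proof
    fix Vs assume "Vs \<in> ?R"
    then obtain W Ws where Vs: "Vs = W # Ws" and W: "W \<subseteq> V" "W \<noteq> {}"
      and Ws: "length Ws = k" "distinct Ws" and p: "partition_on (V - W) (set Ws)"
      by (auto simp: ordered_partitions_def)
    have sub: "X \<subseteq> V - W" "X \<noteq> {}" if "X \<in> set Ws" for X
      using p that by (auto simp: partition_on_def)
    have "W \<notin> set Ws" using sub W by blast
    moreover have "partition_on V (insert W (set Ws))"
      unfolding partition_on_def
    proof (intro conjI)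
      show "\<Union> (insert W (set Ws)) = V" using p W by (auto simp: partition_on_def)
      show "disjoint (insert W (set Ws))"
        using p sub by (fastforce simp: partition_on_def pairwise_insert disjnt_def)
      show "{} \<notin> insert W (set Ws)" using p W by (auto simp: partition_on_def)
    qed
    ultimately show "Vs \<in> ?L" using Vs Ws by (auto simp: ordered_partitions_def)
  qed
qed

lemma ordered_partitions_0: "ordered_partitions 0 V = (if V = {} then {[]} else {})"
  by (auto simp: ordered_partitions_def partition_on_def)

lemma finite_ordered_partitions:
  "finite V \<Longrightarrow> finite (ordered_partitions k V)"
proof (induction k arbitrary: V)
  case (Suc k)
  then show ?case unfolding ordered_partitions_Suc by auto
qed (simp add: ordered_partitions_0)

text \<open>The value \<open>0\<close> at \<open>{}\<close> rules out empty blocks, and the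
  \<open>k\<close>-fold convolution splits off the blocks in their order.\<close>

lemma subset_conv_power_eq_ordered_partitions:
  assumes "finite V"
  shows "subset_conv_power (f(({}) := 0)) k V = (\<Sum>Vs\<in>ordered_partitions k V. prod_list (map f Vs))"
  using assms
proof (induction k arbitrary: V)
  case 0
  then show ?case by (simp add: ordered_partitions_0 subset_delta_def)
next
  case (Suc k)
  let ?g = "f(({}) := 0)"
  have "(\<Sum>Vs\<in>ordered_partitions (Suc k) V. prod_list (map f Vs))
      = (\<Sum>W\<in>Pow V - {{}}. \<Sum>Vs\<in>(#) W ` ordered_partitions k (V - W). prod_list (map f Vs))"
    unfolding ordered_partitions_Suc
    by (rule sum.UNION_disjoint) (use Suc.prems in \<open>auto intro: finite_ordered_partitions\<close>)
  also have "\<dots> = (\<Sum>W\<in>Pow V - {{}}. ?g W * subset_conv_power ?g k (V - W))"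
  proof (rule sum.cong)
    fix W assume W: "W \<in> Pow V - {{}}"
    then have "?g W = f W" by simp
    with W show "(\<Sum>Vs\<in>(#) W ` ordered_partitions k (V - W). prod_list (map f Vs))
        = ?g W * subset_conv_power ?g k (V - W)"
      using Suc.IH[of "V - W", symmetric] Suc.prems
      by (simp del: fun_upd_apply add: sum.reindex flip: sum_distrib_left)
  qed simp
  also have "\<dots> = subset_conv_power ?g (Suc k) V"
    unfolding subset_conv_power.simps subset_conv_def
    by (rule sum.mono_neutral_left) (use Suc.prems in auto)
  finally show ?case by (rule sym)
qed

text \<open>Links the series defining the projection to the recursion. In particular the logarithmic
  derivative at the full set does not depend on the chord \<open>v\<close> in it.\<close>

lemma log_derivative_eq_ordered_partitions:
  fixes f :: "'c set \<Rightarrow> 'a::field_char_0 poly"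
  assumes "finite V" "v \<in> V"
  shows "(\<Sum>k = 1..card V. \<Sum>Vs\<in>ordered_partitions k V.
      smult ((-1) ^ (k - 1) / of_nat k) (prod_list (map f Vs))) = log_derivative v f V"
proof -
  let ?g = "f(({}) := 0)"
  have smult_sum: "smult c (\<Sum>x\<in>A. g x) = (\<Sum>x\<in>A. smult c (g x))"
    for c :: 'a and g :: "'c set list \<Rightarrow> 'a poly" and A
    by (induction A rule: infinite_finite_induct) (auto simp: smult_add_right)
  have "(\<Sum>k = 1..card V. \<Sum>Vs\<in>ordered_partitions k V.
      smult ((-1) ^ (k - 1) / of_nat k) (prod_list (map f Vs)))
    = (\<Sum>k<card V. smult ((-1) ^ k / of_nat (Suc k)) (subset_conv_power ?g (Suc k) V))"
    using assms(1)
    by (intro sum.reindex_bij_witness[of _ Suc "\<lambda>k. k - 1"])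
       (auto simp: subset_conv_power_eq_ordered_partitions smult_sum simp del:
           subset_conv_power.simps)
  also have "\<dots> = (\<Sum>k<card V. (-1) ^ k * subset_conv (pointed v f) (subset_conv_power ?g k) V)"
  proof (rule sum.cong)
    fix k
    have "smult ((-1) ^ k / of_nat (Suc k)) (subset_conv_power ?g (Suc k) V)
      = smult ((-1) ^ k / of_nat (Suc k))
          (smult (of_nat (Suc k)) (subset_conv (pointed v f) (subset_conv_power ?g k) V))"
      unfolding of_nat_log_derivative_term[OF assms, symmetric] of_nat_poly by simp
    also have "\<dots> = smult ((-1) ^ k) (subset_conv (pointed v f) (subset_conv_power ?g k) V)"
      by (simp del: of_nat_Suc)
    also have "\<dots> = (-1) ^ k * subset_conv (pointed v f) (subset_conv_power ?g k) V"
      by (cases "even k") auto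
    finally show "smult ((-1) ^ k / of_nat (Suc k)) (subset_conv_power ?g (Suc k) V)
      = (-1) ^ k * subset_conv (pointed v f) (subset_conv_power ?g k) V" .
  qed simp
  also have "\<dots> = log_derivative v f V"
    using assms by (simp add: subset_conv_power_eq_log_derivative)
  finally show ?thesis .
qed

section \<open>Sums of words over tensors on the chords\<close>

definition leg :: "bool \<Rightarrow> 'u \<times> 'u \<Rightarrow> 'u" where
  "leg i t = (if i then snd t else fst t)"

text \<open>
  An endpoint is a pair \<open>(a, i)\<close> of a chord and a component, and \<open>\<tau> a\<close> lists the pure tensors whose sum
  is put on the chord \<open>a\<close>. The assignment \<open>s\<close> selects the summand \<open>\<tau> a ! s a\<close> for every chord.
\<close>

definition assigned_word ::
  "('c \<Rightarrow> ('u::ring_1 \<times> 'u) list) \<Rightarrow> ('c \<Rightarrow> nat) \<Rightarrow> ('c \<times> bool) list \<Rightarrow> 'u" where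
  "assigned_word \<tau> s Y = prod_list (map (\<lambda>p. leg (snd p) (\<tau> (fst p) ! s (fst p))) Y)"

definition tensor_value ::
  "'c set \<Rightarrow> ('c \<Rightarrow> ('u::ring_1 \<times> 'u) list) \<Rightarrow> ('c \<times> bool) list \<Rightarrow> 'u" where
  "tensor_value V \<tau> Y = (\<Sum>s\<in>PiE V (\<lambda>a. {..<length (\<tau> a)}). assigned_word \<tau> s Y)"

text \<open>The action of a chord on the part \<open>X\<close> of a word that it encloses;
  \<open>i\<close> is the component met first.\<close>

definition sandwich :: "bool \<Rightarrow> ('u::ring_1 \<times> 'u) list \<Rightarrow> 'u \<Rightarrow> 'u" where
  "sandwich i t X = (\<Sum>p\<leftarrow>t. leg i p * X * leg (\<not> i) p)"

definition ad :: "'u::ring_1 \<Rightarrow> 'u \<Rightarrow> 'u" where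
  "ad z x = z * x - x * z"

definition map_leg :: "bool \<Rightarrow> ('u \<Rightarrow> 'u) \<Rightarrow> ('u \<times> 'u) list \<Rightarrow> ('u \<times> 'u) list" where
  "map_leg i f t = map (if i then apsnd f else apfst f) t"

lemma length_map_leg [simp]: "length (map_leg i f t) = length t"
  by (simp add: map_leg_def)

lemma leg_nth_map_leg:
  "k < length t \<Longrightarrow> leg j (map_leg i f t ! k) = (if i = j then f (leg j (t ! k)) else leg j (t ! k))"
  by (auto simp: map_leg_def leg_def)

lemma assigned_word_Nil [simp]: "assigned_word \<tau> s [] = 1"
  and assigned_word_Cons: "assigned_word \<tau> s (p # Y)
    = leg (snd p) (\<tau> (fst p) ! s (fst p)) * assigned_word \<tau> s Y"
  and assigned_word_append: "assigned_word \<tau> s (Y @ Y') = assigned_word \<tau> s Y * assigned_word \<tau> s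
      Y'"
  by (simp_all add: assigned_word_def)

lemma assigned_word_cong:
  assumes "\<And>a i. (a, i) \<in> set Y \<Longrightarrow> leg i (\<tau> a ! s a) = leg i (\<tau>' a ! s' a)"
  shows "assigned_word \<tau> s Y = assigned_word \<tau>' s' Y"
  unfolding assigned_word_def using assms by (intro arg_cong[where f = prod_list]) auto

lemma tensor_value_cong:
  assumes "\<And>a. a \<in> V \<Longrightarrow> \<tau> a = \<tau>' a" "fst ` set Y \<subseteq> V"
  shows "tensor_value V \<tau> Y = tensor_value V \<tau>' Y"
proof -
  have "PiE V (\<lambda>a. {..<length (\<tau> a)}) = PiE V (\<lambda>a. {..<length (\<tau>' a)})"
    using assms(1) by (intro PiE_cong) auto
  then show ?thesis
    unfolding tensor_value_def using assms
    by (auto intro!: sum.cong assigned_word_cong)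
qed

lemma sum_PiE_remove:
  assumes "finite V" "b \<in> V"
  shows "(\<Sum>s\<in>PiE V L. g s) = (\<Sum>s\<in>PiE (V - {b}) L. \<Sum>j\<in>L b. g (s(b := j)))"
proof -
  have "PiE V L = (\<lambda>(j, s). s(b := j)) ` (L b \<times> PiE (V - {b}) L)"
    using assms(2) by (metis PiE_insert_eq insert_Diff)
  moreover have "inj_on (\<lambda>(j, s). s(b := j)) (L b \<times> PiE (V - {b}) L)"
    by (rule inj_combinator) simp
  ultimately have "(\<Sum>s\<in>PiE V L. g s) = (\<Sum>(j, s)\<in>L b \<times> PiE (V - {b}) L. g (s(b := j)))"
    by (simp add: sum.reindex case_prod_unfold comp_def)
  also have "\<dots> = (\<Sum>j\<in>L b. \<Sum>s\<in>PiE (V - {b}) L. g (s(b := j)))"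
    by (rule sum.cartesian_product[symmetric])
  also have "\<dots> = (\<Sum>s\<in>PiE (V - {b}) L. \<Sum>j\<in>L b. g (s(b := j)))"
    by (rule sum.swap)
  finally show ?thesis .
qed

lemma assigned_word_update:
  assumes "b \<notin> fst ` set Y"
  shows "assigned_word \<tau> (s(b := j)) Y = assigned_word \<tau> s Y"
    and "assigned_word (\<tau>(b := t)) s Y = assigned_word \<tau> s Y"
  using assms by (auto intro!: assigned_word_cong simp: image_iff)

text \<open>Once the summands on all other chords are fixed, \<open>b\<close> is seen only through
  its \<open>sandwich\<close>. Statements about the tensor of a single chord reduce to this.\<close>

lemma tensor_value_sandwich:
  assumes "finite V" "b \<in> V" and Y: "Y = Y0 @ (b, i) # Y1 @ (b, \<not> i) # Y2"
    and b: "b \<notin> fst ` set (Y0 @ Y1 @ Y2)"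
  shows "tensor_value V \<tau> Y = (\<Sum>s\<in>PiE (V - {b}) (\<lambda>a. {..<length (\<tau> a)}).
    assigned_word \<tau> s Y0 * sandwich i (\<tau> b) (assigned_word \<tau> s Y1) * assigned_word \<tau> s Y2)"
  unfolding tensor_value_def sum_PiE_remove[OF assms(1,2)]
proof (rule sum.cong)
  fix s
  have "(\<Sum>j<length (\<tau> b). assigned_word \<tau> (s(b := j)) Y)
    = (\<Sum>j<length (\<tau> b). assigned_word \<tau> s Y0 * (leg i (\<tau> b ! j) * assigned_word \<tau> s Y1
        * leg (\<not> i) (\<tau> b ! j)) * assigned_word \<tau> s Y2)"
    using b by (simp add: Y assigned_word_append assigned_word_Cons assigned_word_update mult.assoc
        image_Un)
  also have "\<dots> = assigned_word \<tau> s Y0 * sandwich i (\<tau> b) (assigned_word \<tau> s Y1) * assigned_word \<tau> s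
      Y2"
    by (simp add: sandwich_def sum_list_sum_nth sum_distrib_left sum_distrib_right atLeast0LessThan)
  finally show "(\<Sum>j<length (\<tau> b). assigned_word \<tau> (s(b := j)) Y) = \<dots>" .
qed simp

lemma tensor_value_one_leg:
  assumes "finite V" "b \<in> V" and Y: "Y = Y0 @ (b, i) # Y1" and b: "b \<notin> fst ` set (Y0 @ Y1)"
  shows "tensor_value V \<tau> Y = (\<Sum>s\<in>PiE (V - {b}) (\<lambda>a. {..<length (\<tau> a)}).
    assigned_word \<tau> s Y0 * (\<Sum>p\<leftarrow>\<tau> b. leg i p) * assigned_word \<tau> s Y1)"
  unfolding tensor_value_def sum_PiE_remove[OF assms(1,2)]
proof (rule sum.cong)
  fix s
  have "(\<Sum>j<length (\<tau> b). assigned_word \<tau> (s(b := j)) Y)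
    = (\<Sum>j<length (\<tau> b). assigned_word \<tau> s Y0 * leg i (\<tau> b ! j) * assigned_word \<tau> s Y1)"
    using b by (simp add: Y assigned_word_append assigned_word_Cons assigned_word_update mult.assoc
        image_Un)
  also have "\<dots> = assigned_word \<tau> s Y0 * (\<Sum>p\<leftarrow>\<tau> b. leg i p) * assigned_word \<tau> s Y1"
    by (simp add: sum_list_sum_nth sum_distrib_left sum_distrib_right atLeast0LessThan)
  finally show "(\<Sum>j<length (\<tau> b). assigned_word \<tau> (s(b := j)) Y) = \<dots>" .
qed simp

lemma chord_split:
  assumes "distinct Y" "(b, False) \<in> set Y" "(b, True) \<in> set Y"
  obtains Y0 i Y1 Y2 where "Y = Y0 @ (b, i) # Y1 @ (b, \<not> i) # Y2" "b \<notin> fst ` set (Y0 @ Y1 @ Y2)"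
proof -
  obtain Y0 Z where Y: "Y = Y0 @ (b, False) # Z" using assms(2) by (meson split_list)
  show ?thesis
  proof (cases "(b, True) \<in> set Z")
    case True
    then obtain Y1 Y2 where "Z = Y1 @ (b, True) # Y2" by (meson split_list)
    with Y assms(1) show ?thesis by (intro that[of Y0 False Y1 Y2]) (auto, (metis (full_types))+)
  next
    case False
    then have "(b, True) \<in> set Y0" using Y assms by auto
    then obtain Y1 Y2 where "Y0 = Y1 @ (b, True) # Y2" by (meson split_list)
    with Y assms(1) show ?thesis by (intro that[of Y1 True Y2 Z]) (auto, (metis (full_types))+)
  qed
qed

text \<open>Multilinearity in the form needed later: \<open>z = 1\<close> gives additivity, and
  \<open>t2 = []\<close>, the zero tensor, gives scaling by a central element.\<close>

lemma tensor_value_linear: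
  assumes "finite V" "b \<in> V" "distinct Y" "(b, False) \<in> set Y" "(b, True) \<in> set Y"
    and z: "\<And>x. z * x = x * z"
    and t: "\<And>i X. sandwich i t X = z * sandwich i t1 X + sandwich i t2 X"
  shows "tensor_value V (\<tau>(b := t)) Y
    = z * tensor_value V (\<tau>(b := t1)) Y + tensor_value V (\<tau>(b := t2)) Y"
proof -
  obtain Y0 i Y1 Y2 where Y: "Y = Y0 @ (b, i) # Y1 @ (b, \<not> i) # Y2"
    and b: "b \<notin> fst ` set (Y0 @ Y1 @ Y2)"
    using chord_split assms(3-5) by metis
  have b': "b \<notin> fst ` set Y0" "b \<notin> fst ` set Y1" "b \<notin> fst ` set Y2" using b by auto
  have *: "tensor_value V (\<tau>(b := u)) Y = (\<Sum>s\<in>PiE (V - {b}) (\<lambda>a. {..<length (\<tau> a)}).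
    assigned_word \<tau> s Y0 * sandwich i u (assigned_word \<tau> s Y1) * assigned_word \<tau> s Y2)" for u
  proof -
    have "PiE (V - {b}) (\<lambda>a. {..<length ((\<tau>(b := u)) a)}) = PiE (V - {b}) (\<lambda>a. {..<length (\<tau> a)})"
      by (rule PiE_cong) auto
    then show ?thesis
      by (simp only: tensor_value_sandwich[OF assms(1,2) Y b] assigned_word_update[OF b'(1)]
          assigned_word_update[OF b'(2)] assigned_word_update[OF b'(3)] fun_upd_same)
  qed
  have "x * (z * y) * w = z * (x * y * w)" for x y w using z by (metis mult.assoc)
  then show ?thesis
    unfolding * t by (simp add: distrib_left distrib_right sum.distrib sum_distrib_left)
qed

text \<open>Equality in the tensor square of the algebra, as far as a chord in a word can detect it.
  This avoids forming tensor products.\<close>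

definition tensor_equiv :: "('u::ring_1 \<times> 'u) list \<Rightarrow> ('u \<times> 'u) list \<Rightarrow> bool" where
  "tensor_equiv t t' \<longleftrightarrow> (\<forall>i X. sandwich i t X = sandwich i t' X)"

lemma sandwich_Nil [simp]: "sandwich i [] X = 0"
  and sandwich_Cons: "sandwich i (p # t) X = leg i p * X * leg (\<not> i) p + sandwich i t X"
  and sandwich_append: "sandwich i (t @ t') X = sandwich i t X + sandwich i t' X"
  by (simp_all add: sandwich_def)

lemma tensor_value_Nil:
  "b \<in> V \<Longrightarrow> tensor_value V (\<tau>(b := [])) Y = 0"
  unfolding tensor_value_def by (subst PiE_eq_empty_iff[THEN iffD2]) auto

lemma tensor_value_equiv_update:
  assumes "finite V" "b \<in> V" "distinct Y" "(b, False) \<in> set Y" "(b, True) \<in> set Y"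
    and "tensor_equiv t t'"
  shows "tensor_value V (\<tau>(b := t)) Y = tensor_value V (\<tau>(b := t')) Y"
  using tensor_value_linear[OF assms(1-5), of 1 t t' "[]" \<tau>] assms(2,6)
  by (simp add: tensor_equiv_def tensor_value_Nil)

lemma tensor_value_equiv:
  assumes "finite V" "distinct Y" "set Y = V \<times> UNIV"
    and "\<And>a. a \<in> V \<Longrightarrow> tensor_equiv (\<tau> a) (\<tau>' a)"
  shows "tensor_value V \<tau> Y = tensor_value V \<tau>' Y"
proof -
  have "tensor_value V \<tau> Y = tensor_value V (\<lambda>a. if a \<in> B then \<tau>' a else \<tau> a) Y"
    if "finite B" "B \<subseteq> V" for B
    using that
  proof (induction B)
    case (insert b B)
    let ?\<sigma> = "\<lambda>a. if a \<in> B then \<tau>' a else \<tau> a"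
    have "tensor_value V (?\<sigma>(b := \<tau> b)) Y = tensor_value V (?\<sigma>(b := \<tau>' b)) Y"
      using insert assms by (intro tensor_value_equiv_update) auto
    moreover have "?\<sigma>(b := \<tau> b) = ?\<sigma>" using insert by auto
    moreover have "?\<sigma>(b := \<tau>' b) = (\<lambda>a. if a \<in> insert b B then \<tau>' a else \<tau> a)" by auto
    ultimately show ?case using insert by simp
  qed simp
  from this[of V] show ?thesis
    using assms by (auto intro: tensor_value_cong)
qed

lemma tensor_value_append_update:
  assumes "finite V" "b \<in> V" "distinct Y" "(b, False) \<in> set Y" "(b, True) \<in> set Y"
  shows "tensor_value V (\<tau>(b := t1 @ t2)) Y
    = tensor_value V (\<tau>(b := t1)) Y + tensor_value V (\<tau>(b := t2)) Y"
  using tensor_value_linear[OF assms, of 1 "t1 @ t2" t1 t2 \<tau>] by (simp add: sandwich_append)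

lemma tensor_value_expand:
  assumes "finite V" "distinct Y" "set Y = V \<times> UNIV"
  shows "tensor_value V (\<lambda>a. t1 a @ t2 a) Y
    = (\<Sum>U\<in>Pow V. tensor_value V (\<lambda>a. if a \<in> U then t1 a else t2 a) Y)"
proof -
  \<comment> \<open>\<open>\<tau>\<close> stays arbitrary: the inductive step uses the statement for
    \<open>\<tau>\<close> changed at the new chord \<open>b\<close> in two ways.\<close>
  have expand: "tensor_value V (\<lambda>a. if a \<in> B then t1 a @ t2 a else \<tau> a) Y
      = (\<Sum>U\<in>Pow B. tensor_value V (\<lambda>a. if a \<in> U then t1 a else if a \<in> B then t2 a else \<tau> a) Y)"
    if "finite B" "B \<subseteq> V" for B \<tau>
    using that
  proof (induction B arbitrary: \<tau>)
    case (insert b B)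
    let ?\<sigma> = "\<lambda>\<tau> a. if a \<in> B then t1 a @ t2 a else \<tau> a"
    have eq: "(\<lambda>a. if a \<in> insert b B then t1 a @ t2 a else \<tau> a) = (?\<sigma> \<tau>)(b := t1 b @ t2 b)"
      and eq1: "(?\<sigma> \<tau>)(b := t) = ?\<sigma> (\<tau>(b := t))" for t
      using insert by auto
    have "tensor_value V (\<lambda>a. if a \<in> insert b B then t1 a @ t2 a else \<tau> a) Y
      = tensor_value V (?\<sigma> (\<tau>(b := t1 b))) Y + tensor_value V (?\<sigma> (\<tau>(b := t2 b))) Y"
      unfolding eq eq1[symmetric] using insert assms by (intro tensor_value_append_update) auto
    also have "\<dots> = (\<Sum>U\<in>Pow B. tensor_value V
          (\<lambda>a. if a \<in> insert b U then t1 a else if a \<in> insert b B then t2 a else \<tau> a) Y)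
        + (\<Sum>U\<in>Pow B. tensor_value V
          (\<lambda>a. if a \<in> U then t1 a else if a \<in> insert b B then t2 a else \<tau> a) Y)"
      using insert
      by (auto intro!: arg_cong2[where f = plus] sum.cong arg_cong[where f
          = "\<lambda>\<tau>. tensor_value V \<tau> Y"])
    also have "\<dots> = (\<Sum>U\<in>Pow (insert b B). tensor_value V
          (\<lambda>a. if a \<in> U then t1 a else if a \<in> insert b B then t2 a else \<tau> a) Y)"
    proof -
      have "Pow B \<inter> insert b ` Pow B = {}" using insert by auto
      moreover have "inj_on (insert b) (Pow B)"
        using insert(2) by (intro inj_onI) (metis PowD insert_ident subsetD)
      ultimately show ?thesis
        unfolding Pow_insert using insert
        by (subst sum.union_disjoint) (auto simp: sum.reindex algebra_simps)
    qed
    finally show ?case .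
  qed simp
  have "tensor_value V (\<lambda>a. t1 a @ t2 a) Y
      = tensor_value V (\<lambda>a. if a \<in> V then t1 a @ t2 a else []) Y"
    using assms by (intro tensor_value_cong) auto
  also have "\<dots> = (\<Sum>U\<in>Pow V. tensor_value V
      (\<lambda>a. if a \<in> U then t1 a else if a \<in> V then t2 a else []) Y)"
    using expand assms(1) by simp
  also have "\<dots> = (\<Sum>U\<in>Pow V. tensor_value V (\<lambda>a. if a \<in> U then t1 a else t2 a) Y)"
    using assms by (intro sum.cong tensor_value_cong) auto
  finally show ?thesis .
qed

section \<open>Inner derivations acting on words of tensors\<close>

lemma ad_prod_list:
  assumes "distinct Y"
  shows "ad z (prod_list (map f Y)) = (\<Sum>p\<in>set Y. prod_list (map (f(p := ad z (f p))) Y))"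
  using assms
proof (induction Y)
  case Nil
  then show ?case by (simp add: ad_def)
next
  case (Cons q Y)
  have *: "map (f(q := x)) Y = map f Y" for x using Cons by simp
  have "ad z (prod_list (map f (q # Y)))
      = ad z (f q) * prod_list (map f Y) + f q * ad z (prod_list (map f Y))"
    by (simp add: ad_def algebra_simps)
  also have "f q * ad z (prod_list (map f Y))
      = (\<Sum>p\<in>set Y. f q * prod_list (map (f(p := ad z (f p))) Y))"
    using Cons by (simp del: fun_upd_apply add: sum_distrib_left)
  also have "\<dots> = (\<Sum>p\<in>set Y. prod_list (map (f(p := ad z (f p))) (q # Y)))"
    using Cons.prems by (intro sum.cong) auto
  finally show ?case using Cons.prems by (simp del: fun_upd_apply add: * fun_upd_same)
qed

definition modify_leg ::
  "('u \<Rightarrow> 'u) \<Rightarrow> 'c \<times> bool \<Rightarrow> ('c \<Rightarrow> ('u \<times> 'u) list) \<Rightarrow> 'c \<Rightarrow> ('u \<times> 'u) list" where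
  "modify_leg f p \<tau> = \<tau>(fst p := map_leg (snd p) f (\<tau> (fst p)))"

lemma length_modify_leg [simp]: "length (modify_leg f p \<tau> a) = length (\<tau> a)"
  by (simp add: modify_leg_def)

lemma assigned_word_modify_leg_notin:
  assumes "p \<notin> set Y" "s (fst p) < length (\<tau> (fst p))"
  shows "assigned_word (modify_leg f p \<tau>) s Y = assigned_word \<tau> s Y"
  using assms by (cases p) (auto intro!: assigned_word_cong simp: modify_leg_def leg_nth_map_leg)

lemma ad_assigned_word:
  assumes "distinct Y" "\<And>p. p \<in> set Y \<Longrightarrow> s (fst p) < length (\<tau> (fst p))"
  shows "ad z (assigned_word \<tau> s Y) = (\<Sum>p\<in>set Y. assigned_word (modify_leg (ad z) p \<tau>) s Y)"
  unfolding assigned_word_def ad_prod_list[OF assms(1)]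
proof (intro sum.cong arg_cong[where f = prod_list] map_cong)
  fix p q assume p: "p \<in> set Y" and q: "q \<in> set Y"
  show "((\<lambda>p. leg (snd p) (\<tau> (fst p) ! s (fst p)))
          (p := ad z (leg (snd p) (\<tau> (fst p) ! s (fst p))))) q =
         leg (snd q) (modify_leg (ad z) p \<tau> (fst q) ! s (fst q))"
    using assms(2)[OF q] by (cases p; cases q) (auto simp: modify_leg_def leg_nth_map_leg)
qed simp_all

lemma ad_tensor_value:
  assumes "distinct Y" "fst ` set Y \<subseteq> V"
  shows "ad z (tensor_value V \<tau> Y) = (\<Sum>p\<in>set Y. tensor_value V (modify_leg (ad z) p \<tau>) Y)"
proof -
  let ?S = "PiE V (\<lambda>a. {..<length (\<tau> a)})"
  have "ad z (tensor_value V \<tau> Y) = (\<Sum>s\<in>?S. ad z (assigned_word \<tau> s Y))"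
    unfolding tensor_value_def ad_def by (simp add: sum_distrib_left sum_distrib_right
        sum_subtractf)
  also have "\<dots> = (\<Sum>s\<in>?S. \<Sum>p\<in>set Y. assigned_word (modify_leg (ad z) p \<tau>) s Y)"
    using assms by (intro sum.cong ad_assigned_word) (auto simp: PiE_iff)
  also have "\<dots> = (\<Sum>p\<in>set Y. tensor_value V (modify_leg (ad z) p \<tau>) Y)"
    unfolding tensor_value_def length_modify_leg by (rule sum.swap)
  finally show ?thesis .
qed

lemma sandwich_sum: "sandwich i t (\<Sum>x\<in>A. g x) = (\<Sum>x\<in>A. sandwich i t (g x))"
  unfolding sandwich_def by (induction t) (simp_all add: sum_distrib_left sum_distrib_right
      sum.distrib)

text \<open>If the tensor at \<open>v\<close> acts through \<open>ad z\<close> of what it encloses,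
  the Leibniz rule distributes \<open>ad z\<close> over the enclosed endpoints, and
  \<open>t'\<close> stays behind at \<open>v\<close>.\<close>

lemma tensor_value_ad_interior:
  assumes V: "finite V" "v \<in> V" and Y: "Y = Y0 @ (v, i) # Y1 @ (v, \<not> i) # Y2"
    and v: "v \<notin> fst ` set (Y0 @ Y1 @ Y2)" and dist: "distinct Y" and sub: "fst ` set Y \<subseteq> V"
    and t: "\<And>X. sandwich i t X = sandwich i t' (ad z X)"
  shows "tensor_value V (\<tau>(v := t)) Y
    = (\<Sum>p\<in>set Y1. tensor_value V ((modify_leg (ad z) p \<tau>)(v := t')) Y)"
proof -
  let ?S = "PiE (V - {v}) (\<lambda>a. {..<length (\<tau> a)})"
  have v': "v \<notin> fst ` set Y0" "v \<notin> fst ` set Y1" "v \<notin> fst ` set Y2" using v by auto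
  have S: "PiE (V - {v}) (\<lambda>a. {..<length ((\<tau>'(v := u)) a)}) = ?S"
    if "\<And>a. length (\<tau>' a) = length (\<tau> a)" for u :: "('b \<times> 'b) list" and \<tau>'
    using that by (intro PiE_cong) auto
  have "tensor_value V (\<tau>(v := t)) Y = (\<Sum>s\<in>?S. assigned_word \<tau> s Y0
      * sandwich i t' (ad z (assigned_word \<tau> s Y1)) * assigned_word \<tau> s Y2)"
    by (simp only: tensor_value_sandwich[OF V Y v] assigned_word_update[OF v'(1)]
          assigned_word_update[OF v'(2)] assigned_word_update[OF v'(3)] fun_upd_same S t)
  also have "\<dots> = (\<Sum>s\<in>?S. \<Sum>p\<in>set Y1. assigned_word (modify_leg (ad z) p \<tau>) s Y0
      * sandwich i t' (assigned_word (modify_leg (ad z) p \<tau>) s Y1)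
      * assigned_word (modify_leg (ad z) p \<tau>) s Y2)"
  proof (rule sum.cong)
    fix s assume s: "s \<in> ?S"
    have bound: "s (fst p) < length (\<tau> (fst p))" if "p \<in> set Y1" for p
      using s that v sub Y by (auto simp: PiE_iff image_iff)
    have Y1: "ad z (assigned_word \<tau> s Y1) = (\<Sum>p\<in>set Y1. assigned_word (modify_leg (ad z) p \<tau>) s Y1)"
      using dist Y bound by (intro ad_assigned_word) auto
    have Y02: "assigned_word (modify_leg (ad z) p \<tau>) s Y0 = assigned_word \<tau> s Y0"
      "assigned_word (modify_leg (ad z) p \<tau>) s Y2 = assigned_word \<tau> s Y2" if "p \<in> set Y1" for p
      using dist Y bound[OF that] that by (auto intro!: assigned_word_modify_leg_notin)
    show "assigned_word \<tau> s Y0 * sandwich i t' (ad z (assigned_word \<tau> s Y1)) * assigned_word \<tau> s Y2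
      = (\<Sum>p\<in>set Y1. assigned_word (modify_leg (ad z) p \<tau>) s Y0
      * sandwich i t' (assigned_word (modify_leg (ad z) p \<tau>) s Y1)
      * assigned_word (modify_leg (ad z) p \<tau>) s Y2)"
      unfolding Y1 sandwich_sum sum_distrib_left sum_distrib_right
      by (intro sum.cong) (auto simp: Y02)
  qed simp
  also have "\<dots> = (\<Sum>p\<in>set Y1. \<Sum>s\<in>?S. assigned_word (modify_leg (ad z) p \<tau>) s Y0
      * sandwich i t' (assigned_word (modify_leg (ad z) p \<tau>) s Y1)
      * assigned_word (modify_leg (ad z) p \<tau>) s Y2)"
    by (rule sum.swap)
  also have "\<dots> = (\<Sum>p\<in>set Y1. tensor_value V ((modify_leg (ad z) p \<tau>)(v := t')) Y)"
    by (simp only: tensor_value_sandwich[OF V Y v] assigned_word_update[OF v'(1)]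
          assigned_word_update[OF v'(2)] assigned_word_update[OF v'(3)] fun_upd_same S
              length_modify_leg)
  finally show ?thesis .
qed

text \<open>Vanishing of \<open>(ad z \<otimes> 1 + 1 \<otimes> ad z) t\<close>, the infinitesimal
  invariance of \<open>t\<close> under \<open>z\<close>.\<close>

definition tensor_invariant :: "'u::ring_1 \<Rightarrow> ('u \<times> 'u) list \<Rightarrow> bool" where
  "tensor_invariant z t \<longleftrightarrow>
    (\<forall>i X. sandwich i (map_leg False (ad z) t) X + sandwich i (map_leg True (ad z) t) X = 0)"

lemma tensor_value_invariant:
  assumes "finite V" "b \<in> V" "distinct Y" "(b, False) \<in> set Y" "(b, True) \<in> set Y"
    and "tensor_invariant z (\<tau> b)"
  shows "tensor_value V (modify_leg (ad z) (b, False) \<tau>) Y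
    + tensor_value V (modify_leg (ad z) (b, True) \<tau>) Y = 0"
proof -
  have "tensor_value V (\<tau>(b := map_leg False (ad z) (\<tau> b) @ map_leg True (ad z) (\<tau> b))) Y
      = tensor_value V (\<tau>(b := [])) Y"
    using assms(6)
    by (intro tensor_value_equiv_update[OF assms(1-5)])
       (simp add: tensor_equiv_def sandwich_append tensor_invariant_def)
  then show ?thesis
    using assms(2)
    by (simp add: modify_leg_def tensor_value_Nil flip: tensor_value_append_update[OF assms(1-5)])
qed

section \<open>Moving endpoints, joining words, deleting chords\<close>

lemma tensor_value_sum_list:
  assumes "finite V" "b \<in> V"
  shows "tensor_value V \<tau> Y = (\<Sum>p\<leftarrow>\<tau> b. tensor_value V (\<tau>(b := [p])) Y)"
proof -
  let ?S = "PiE (V - {b}) (\<lambda>a. {..<length (\<tau> a)})"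
  have "tensor_value V (\<tau>(b := [p])) Y
      = (\<Sum>s\<in>?S. assigned_word (\<tau>(b := [p])) (s(b := 0)) Y)" for p
  proof -
    have "PiE (V - {b}) (\<lambda>a. {..<length ((\<tau>(b := [p])) a)}) = ?S" by (intro PiE_cong) auto
    moreover have "{..<Suc 0} = {0}" by auto
    ultimately show ?thesis
      unfolding tensor_value_def sum_PiE_remove[OF assms] by simp
  qed
  then have "(\<Sum>p\<leftarrow>\<tau> b. tensor_value V (\<tau>(b := [p])) Y)
      = (\<Sum>j<length (\<tau> b). \<Sum>s\<in>?S. assigned_word (\<tau>(b := [\<tau> b ! j])) (s(b := 0)) Y)"
    by (simp add: sum_list_sum_nth atLeast0LessThan)
  also have "\<dots> = (\<Sum>j<length (\<tau> b). \<Sum>s\<in>?S. assigned_word \<tau> (s(b := j)) Y)"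
    by (intro sum.cong assigned_word_cong) auto
  also have "\<dots> = (\<Sum>s\<in>?S. \<Sum>j<length (\<tau> b). assigned_word \<tau> (s(b := j)) Y)"
    by (rule sum.swap)
  also have "\<dots> = tensor_value V \<tau> Y"
    unfolding tensor_value_def sum_PiE_remove[OF assms] ..
  finally show ?thesis by simp
qed

lemma tensor_value_single:
  assumes "b \<in> V" "\<tau> b = [t]"
  shows "tensor_value V \<tau> (Y @ (b, i) # Y')
    = (\<Sum>s\<in>PiE V (\<lambda>a. {..<length (\<tau> a)}). assigned_word \<tau> s Y * leg i t * assigned_word \<tau> s Y')"
  unfolding tensor_value_def
proof (rule sum.cong)
  fix s assume "s \<in> PiE V (\<lambda>a. {..<length (\<tau> a)})"
  then have "s b \<in> {..<length (\<tau> b)}" using assms(1) by (rule PiE_mem)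
  then have "s b = 0" using assms(2) by simp
  then show "assigned_word \<tau> s (Y @ (b, i) # Y')
      = assigned_word \<tau> s Y * leg i t * assigned_word \<tau> s Y'"
    using assms by (simp add: assigned_word_append assigned_word_Cons mult.assoc)
qed simp

text \<open>The difference is the commutator of the moved leg with the rest of the word. By the
  Leibniz rule it is a sum over the endpoints in \<open>Y\<close>: the two ends of every other chord
  cancel by invariance, and the other end of the same chord leaves the sum of commutators of its two
  legs, which \<open>comm\<close> kills.\<close>

lemma tensor_value_rotate:
  assumes "finite V" "distinct (p # Y)" "set (p # Y) = V \<times> UNIV"
    and inv: "\<And>b t i. b \<in> V \<Longrightarrow> t \<in> set (\<tau> (fst p)) \<Longrightarrow> tensor_invariant (leg i t) (\<tau> b)"
    and comm: "(\<Sum>t\<leftarrow>\<tau> (fst p). ad (leg (snd p) t) (leg (\<not> snd p) t)) = 0"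
  shows "tensor_value V \<tau> (p # Y) = tensor_value V \<tau> (Y @ [p])"
proof -
  obtain a i where p: "p = (a, i)" by (cases p)
  have a: "a \<in> V" using assms(3) p by auto
  have dY: "distinct Y" and aY: "(a, i) \<notin> set Y" using assms(2) p by auto
  have setY: "set Y = (V - {a}) \<times> UNIV \<union> {(a, \<not> i)}"
  proof -
    have "set Y = V \<times> UNIV - {(a, i)}" using assms(2,3) p by auto
    then show ?thesis using a by auto
  qed
  have "(a, \<not> i) \<in> set Y" using setY by simp
  then obtain Y1 Y2 where Y: "Y = Y1 @ (a, \<not> i) # Y2" by (meson split_list)
  have aY12: "a \<notin> fst ` set (Y1 @ Y2)"
  proof
    assume "a \<in> fst ` set (Y1 @ Y2)"
    then obtain j where "(a, j) \<in> set (Y1 @ Y2)" by (metis imageE prod.collapse)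
    then show False using aY dY Y by (cases "j = i") auto
  qed
  let ?c = "\<lambda>t. map_leg (\<not> i) (ad (leg i t)) [t]"
  have *: "tensor_value V (\<tau>(a := [t])) (p # Y) - tensor_value V (\<tau>(a := [t])) (Y @ [p])
      = tensor_value V (\<tau>(a := ?c t)) Y" if t: "t \<in> set (\<tau> a)" for t
  proof -
    let ?\<sigma> = "\<tau>(a := [t])" and ?z = "leg i t"
    have "tensor_value V ?\<sigma> (p # Y) - tensor_value V ?\<sigma> (Y @ [p]) = ad ?z (tensor_value V ?\<sigma> Y)"
      using tensor_value_single[of a V ?\<sigma> t "[]" i Y] tensor_value_single[of a V ?\<sigma> t Y i "[]"] a p
      by (simp add: ad_def tensor_value_def sum_distrib_left sum_distrib_right)
    also have "\<dots> = (\<Sum>p\<in>set Y. tensor_value V (modify_leg (ad ?z) p ?\<sigma>) Y)"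
      using dY setY a by (intro ad_tensor_value) auto
    also have "\<dots> = (\<Sum>p\<in>(V - {a}) \<times> UNIV. tensor_value V (modify_leg (ad ?z) p ?\<sigma>) Y)
        + tensor_value V (modify_leg (ad ?z) (a, \<not> i) ?\<sigma>) Y"
      unfolding setY using assms(1) by (subst sum.union_disjoint) auto
    also have "(\<Sum>p\<in>(V - {a}) \<times> UNIV. tensor_value V (modify_leg (ad ?z) p ?\<sigma>) Y)
      = (\<Sum>b\<in>V - {a}. tensor_value V (modify_leg (ad ?z) (b, False) ?\<sigma>) Y
          + tensor_value V (modify_leg (ad ?z) (b, True) ?\<sigma>) Y)"
      by (simp add: sum.cartesian_product' UNIV_bool add.commute)
    also have "\<dots> = 0"
      using assms(1) dY setY t inv[of _ t] p
      by (intro sum.neutral ballI tensor_value_invariant) auto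
    finally show ?thesis by (simp only: modify_leg_def fst_conv snd_conv fun_upd_same fun_upd_upd
        add_0)
  qed
  have "tensor_value V \<tau> (p # Y) - tensor_value V \<tau> (Y @ [p])
      = (\<Sum>t\<leftarrow>\<tau> a. tensor_value V (\<tau>(a := ?c t)) Y)"
    unfolding tensor_value_sum_list[OF assms(1) a, of \<tau>] sum_list_subtractf[symmetric]
    using * by (intro arg_cong[where f = sum_list] map_cong) auto
  also have "\<dots> = tensor_value V (\<tau>(a := concat (map ?c (\<tau> a)))) Y"
  proof -
    define d where "d t = (if i then (ad (snd t) (fst t), snd t) else (fst t, ad (fst t) (snd t)))"
        for t :: "'b \<times> 'b"
    have c: "?c t = [d t]" for t
      by (cases t) (auto simp: map_leg_def leg_def d_def)
    have "concat (map (\<lambda>t. [d t]) ts) = map d ts" for ts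
      by (induction ts) auto
    then show ?thesis
      using tensor_value_sum_list[OF assms(1) a, of "\<tau>(a := map d (\<tau> a))" Y]
      by (simp add: comp_def c)
  qed
  also have "\<dots> = 0"
    \<comment> \<open>Only one endpoint of \<open>a\<close> occurs in \<open>Y\<close>, so
      \<open>a\<close> contributes just the sum of its bracketed legs.\<close>
    unfolding tensor_value_one_leg[OF assms(1) a Y aY12]
  proof (intro sum.neutral ballI)
    fix s
    have "(\<Sum>t\<leftarrow>concat (map ?c ts). leg (\<not> i) t) = (\<Sum>t\<leftarrow>ts. ad (leg i t) (leg (\<not> i) t))"
      for ts :: "('b \<times> 'b) list"
      by (induction ts) (auto simp: map_leg_def leg_def)
    then show "assigned_word (\<tau>(a := concat (map ?c (\<tau> a)))) s Y1
        * (\<Sum>t\<leftarrow>(\<tau>(a := concat (map ?c (\<tau> a)))) a. leg (\<not> i) t)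
        * assigned_word (\<tau>(a := concat (map ?c (\<tau> a)))) s Y2 = 0"
      using comm p by simp
  qed
  finally show ?thesis by simp
qed

text \<open>Moving a leg \<open>z\<close> of \<open>b\<close> across either end of \<open>a\<close>
  produces a commutator there, so the four terms add up to
  \<open>ad z \<otimes> 1 + 1 \<otimes> ad z\<close> applied to the tensor of \<open>a\<close>. The
  rest of the word, with the other end of \<open>b\<close>, is common to all four.\<close>

lemma tensor_value_four_term:
  assumes "finite V" "a \<in> V" "b \<in> V" "a \<noteq> b"
    and dist: "distinct (u @ (a, i) # v @ (a, \<not> i) # w)"
    and inv: "\<And>t. t \<in> set (\<tau> b) \<Longrightarrow> tensor_invariant (leg j t) (\<tau> a)"
  shows "tensor_value V \<tau> (u @ [(b, j), (a, i)] @ v @ [(a, \<not> i)] @ w)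
    - tensor_value V \<tau> (u @ [(a, i), (b, j)] @ v @ [(a, \<not> i)] @ w)
    + tensor_value V \<tau> (u @ [(a, i)] @ v @ [(b, j), (a, \<not> i)] @ w)
    - tensor_value V \<tau> (u @ [(a, i)] @ v @ [(a, \<not> i), (b, j)] @ w) = 0" (is "?F \<tau> = 0")
proof -
  have zero: "?F (\<tau>(b := [t])) = 0" if t: "t \<in> set (\<tau> b)" for t
  proof -
    define \<sigma> where "\<sigma> = \<tau>(b := [t])"
    have \<sigma>: "\<sigma> b = [t]" "\<sigma> a = \<tau> a" using assms by (auto simp: \<sigma>_def)
    let ?z = "leg j t" and ?Y = "u @ (a, i) # v @ (a, \<not> i) # w"
    let ?S = "PiE V (\<lambda>a. {..<length (\<sigma> a)})"
    note single = tensor_value_single[of b V \<sigma> t _ j, OF assms(3) \<sigma>(1)]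
    have words:
      "u @ [(b, j), (a, i)] @ v @ [(a, \<not> i)] @ w = u @ (b, j) # ((a, i) # v @ (a, \<not> i) # w)"
      "u @ [(a, i), (b, j)] @ v @ [(a, \<not> i)] @ w = (u @ [(a, i)]) @ (b, j) # (v @ (a, \<not> i) # w)"
      "u @ [(a, i)] @ v @ [(b, j), (a, \<not> i)] @ w = (u @ (a, i) # v) @ (b, j) # ((a, \<not> i) # w)"
      "u @ [(a, i)] @ v @ [(a, \<not> i), (b, j)] @ w = (u @ (a, i) # v @ [(a, \<not> i)]) @ (b, j) # w"
      by simp_all
    have "?F \<sigma> = (\<Sum>s\<in>?S.
        assigned_word \<sigma> s u * ad ?z (leg i (\<tau> a ! s a)) * assigned_word \<sigma> s v
          * leg (\<not> i) (\<tau> a ! s a) * assigned_word \<sigma> s w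
        + assigned_word \<sigma> s u * leg i (\<tau> a ! s a) * assigned_word \<sigma> s v
          * ad ?z (leg (\<not> i) (\<tau> a ! s a)) * assigned_word \<sigma> s w)"
      unfolding words single sum_subtractf[symmetric] sum.distrib[symmetric]
      by (intro sum.cong)
         (simp_all add: assigned_word_append assigned_word_Cons ad_def \<sigma> algebra_simps)
    also have "\<dots> = (\<Sum>s\<in>?S. assigned_word (modify_leg (ad ?z) (a, i) \<sigma>) s ?Y
        + assigned_word (modify_leg (ad ?z) (a, \<not> i) \<sigma>) s ?Y)"
    proof (rule sum.cong)
      fix s assume s: "s \<in> ?S"
      have sa: "s a < length (\<tau> a)" using PiE_mem[OF s assms(2)] \<sigma> by simp
      have N: "assigned_word (modify_leg (ad ?z) (a, k) \<sigma>) s Z = assigned_word \<sigma> s Z"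
        if "(a, k) \<notin> set Z" for k Z
        using that sa by (intro assigned_word_modify_leg_notin) (auto simp: \<sigma>)
      have L: "leg k (modify_leg (ad ?z) (a, l) \<sigma> a ! s a)
        = (if k = l then ad ?z (leg k (\<tau> a ! s a)) else leg k (\<tau> a ! s a))" for k l
        using sa by (auto simp: modify_leg_def leg_nth_map_leg \<sigma>)
      have nin: "(a, k) \<notin> set u" "(a, k) \<notin> set v" "(a, k) \<notin> set w" for k
        using dist by (cases "k = i"; auto)+
      show "assigned_word \<sigma> s u * ad ?z (leg i (\<tau> a ! s a)) * assigned_word \<sigma> s v
          * leg (\<not> i) (\<tau> a ! s a) * assigned_word \<sigma> s w
        + assigned_word \<sigma> s u * leg i (\<tau> a ! s a) * assigned_word \<sigma> s v
          * ad ?z (leg (\<not> i) (\<tau> a ! s a)) * assigned_word \<sigma> s w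
        = assigned_word (modify_leg (ad ?z) (a, i) \<sigma>) s ?Y
        + assigned_word (modify_leg (ad ?z) (a, \<not> i) \<sigma>) s ?Y"
        by (simp add: assigned_word_append assigned_word_Cons L \<sigma> N[OF nin(1)] N[OF nin(2)] N[OF
            nin(3)]
            mult.assoc)
    qed simp
    also have "\<dots> = tensor_value V (modify_leg (ad ?z) (a, i) \<sigma>) ?Y
        + tensor_value V (modify_leg (ad ?z) (a, \<not> i) \<sigma>) ?Y"
      by (simp add: tensor_value_def sum.distrib)
    also have "\<dots> = tensor_value V (modify_leg (ad ?z) (a, False) \<sigma>) ?Y
        + tensor_value V (modify_leg (ad ?z) (a, True) \<sigma>) ?Y"
      by (cases i) (simp_all add: add.commute)
    also have "\<dots> = 0"
      using assms t \<sigma> by (intro tensor_value_invariant) (cases i; auto)+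
    finally show ?thesis by (simp only: \<sigma>_def)
  qed
  have "?F \<tau> = (\<Sum>t\<leftarrow>\<tau> b. ?F (\<tau>(b := [t])))"
    unfolding tensor_value_sum_list[OF assms(1,3), of \<tau>]
    by (simp only: sum_list_subtractf sum_list_addf)
  also have "\<dots> = (\<Sum>t\<leftarrow>\<tau> b. 0)"
    using zero by (intro arg_cong[where f = sum_list] map_cong) auto
  finally show ?thesis by simp
qed

lemma tensor_value_append:
  assumes "V1 \<inter> V2 = {}" "fst ` set Y1 \<subseteq> V1" "fst ` set Y2 \<subseteq> V2"
  shows "tensor_value (V1 \<union> V2) \<tau> (Y1 @ Y2) = tensor_value V1 \<tau> Y1 * tensor_value V2 \<tau> Y2"
proof -
  let ?L = "\<lambda>a. {..<length (\<tau> a)}"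
  have "tensor_value V1 \<tau> Y1 * tensor_value V2 \<tau> Y2
      = (\<Sum>(s, s')\<in>PiE V1 ?L \<times> PiE V2 ?L. assigned_word \<tau> s Y1 * assigned_word \<tau> s' Y2)"
    unfolding tensor_value_def sum_product by (simp add: sum.cartesian_product)
  also have "\<dots> = tensor_value (V1 \<union> V2) \<tau> (Y1 @ Y2)"
    unfolding tensor_value_def
  proof (rule sum.reindex_bij_witness[of _ "\<lambda>s. (restrict s V1, restrict s V2)"
        "\<lambda>(s, s') a. if a \<in> V1 then s a else s' a"])
    show "(\<lambda>s. (restrict s V1, restrict s V2)) ((\<lambda>(s, s') a. if a \<in> V1 then s a else s' a) q) = q"
      if "q \<in> PiE V1 ?L \<times> PiE V2 ?L" for q
      using that assms(1) by (force simp: PiE_iff extensional_def restrict_def)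
    show "(\<lambda>(s, s') a. if a \<in> V1 then s a else s' a) q \<in> PiE (V1 \<union> V2) ?L"
      if "q \<in> PiE V1 ?L \<times> PiE V2 ?L" for q
      using that by (auto simp: PiE_iff extensional_def)
    show "assigned_word \<tau> ((\<lambda>(s, s') a. if a \<in> V1 then s a else s' a) q) (Y1 @ Y2)
      = (case q of (s, s') \<Rightarrow> assigned_word \<tau> s Y1 * assigned_word \<tau> s' Y2)"
      if "q \<in> PiE V1 ?L \<times> PiE V2 ?L" for q
    proof -
      have "a \<in> V1" if "(a, i) \<in> set Y1" for a i using that assms(2) by force
      moreover have "a \<notin> V1" if "(a, i) \<in> set Y2" for a i using that assms(1,3) by force
      ultimately show ?thesis
        by (cases q) (auto simp: assigned_word_append intro!: arg_cong2[where f
            = times] assigned_word_cong)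
    qed
  qed (auto simp: PiE_iff extensional_def restrict_def fun_eq_iff)
  finally show ?thesis by simp
qed

lemma tensor_value_scalar_chord:
  assumes "finite V" "b \<in> V" "distinct Y" "(b, False) \<in> set Y" "(b, True) \<in> set Y"
    and "\<tau> b = [(z, 1)]" and z: "\<And>x. z * x = x * z"
  shows "tensor_value V \<tau> Y = z * tensor_value (V - {b}) \<tau> (filter (\<lambda>p. fst p \<noteq> b) Y)"
proof -
  obtain Y0 i Y1 Y2 where Y: "Y = Y0 @ (b, i) # Y1 @ (b, \<not> i) # Y2"
    and b: "b \<notin> fst ` set (Y0 @ Y1 @ Y2)"
    using chord_split assms(3-5) by metis
  have "filter (\<lambda>p. fst p \<noteq> b) Y = Y0 @ Y1 @ Y2"
  proof -
    have "filter (\<lambda>p. fst p \<noteq> b) Z = Z" if "b \<notin> fst ` set Z" for Z :: "('a \<times> bool) list"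
      using that by (auto simp: filter_id_conv image_iff)
    with b show ?thesis by (simp add: Y image_Un)
  qed
  moreover have "x * (leg i (z, 1) * y * leg (\<not> i) (z, 1)) * w = z * (x * (y * w))" for x y w
    using z by (cases i) (simp_all add: leg_def, (metis mult.assoc)+)
  ultimately show ?thesis
    unfolding tensor_value_sandwich[OF assms(1,2) Y b] assms(6)
    by (simp add: tensor_value_def sandwich_def assigned_word_append sum_distrib_left)
qed

text \<open>Used with the negative Casimir scalar, to subtract it chord by chord, and with
  \<open>1\<close>, to delete chords that carry \<open>1 \<otimes> 1\<close>.\<close>

lemma tensor_value_scalar_chords:
  assumes "finite V" "distinct Y" "set Y = V \<times> UNIV" "U \<subseteq> V"
    and "\<And>b. b \<in> V - U \<Longrightarrow> \<tau> b = [(z, 1)]" and z: "\<And>x. z * x = x * z"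
  shows "tensor_value V \<tau> Y = z ^ card (V - U) * tensor_value U \<tau> (filter (\<lambda>p. fst p \<in> U) Y)"
proof -
  have "tensor_value V \<tau> Y = z ^ card B * tensor_value (V - B) \<tau> (filter (\<lambda>p. fst p \<notin> B) Y)"
    if "finite B" "B \<subseteq> V - U" for B
    using that
  proof (induction B)
    case (insert b B)
    have "tensor_value (V - B) \<tau> (filter (\<lambda>p. fst p \<notin> B) Y)
        = z * tensor_value (V - B - {b}) \<tau> (filter (\<lambda>p. fst p \<noteq> b) (filter (\<lambda>p. fst p \<notin> B) Y))"
      using insert assms by (intro tensor_value_scalar_chord) auto
    moreover have "filter (\<lambda>p. fst p \<noteq> b) (filter (\<lambda>p. fst p \<notin> B) Y)
        = filter (\<lambda>p. fst p \<notin> insert b B) Y"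
      by (auto simp: intro: filter_cong)
    moreover have "V - B - {b} = V - insert b B" by auto
    ultimately show ?case using insert by (simp add: power_Suc2 mult.assoc del: power_Suc)
  qed simp
  from this[of "V - U"] assms(1) have "tensor_value V \<tau> Y
      = z ^ card (V - U) * tensor_value (V - (V - U)) \<tau> (filter (\<lambda>p. fst p \<notin> V - U) Y)" by simp
  moreover have "V - (V - U) = U" using assms(4) by auto
  moreover have "filter (\<lambda>p. fst p \<notin> V - U) Y = filter (\<lambda>p. fst p \<in> U) Y"
    using assms(3,4) by (intro filter_cong) auto
  ultimately show ?thesis by simp
qed

text \<open>Moving endpoints disturbs the convention on which endpoint of a chord comes first; for
  symmetric tensors this does no harm.\<close>

lemma tensor_value_relabel_endpoints:
  assumes "finite V" "distinct Y" "set Y = V \<times> UNIV" "distinct Y'"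
    and fst: "map fst Y = map fst Y'"
    and sym: "\<And>a. a \<in> V \<Longrightarrow> tensor_equiv (map prod.swap (\<tau> a)) (\<tau> a)"
  shows "tensor_value V \<tau> Y = tensor_value V \<tau> Y'"
proof -
  have len: "length Y' = length Y" using map_eq_imp_length_eq[OF fst] by simp
  have f: "fst (Y' ! k) = fst (Y ! k)" if "k < length Y" for k
    using that fst len by (metis nth_map)
  \<comment> \<open>The chords whose labels are exchanged between \<open>Y\<close> and
    \<open>Y'\<close>. A mismatch at one end forces one at the other end, since both words are
    distinct.\<close>
  define B where "B = {a. \<exists>k<length Y. fst (Y ! k) = a \<and> Y ! k \<noteq> Y' ! k}"
  define \<tau>' where "\<tau>' = (\<lambda>a. if a \<in> B then map prod.swap (\<tau> a) else \<tau> a)"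
  have Y': "Y' ! k = (fst (Y ! k), if fst (Y ! k) \<in> B then \<not> snd (Y ! k) else snd (Y ! k))"
    if k: "k < length Y" for k
  proof (cases "fst (Y ! k) \<in> B")
    case True
    then obtain l where l: "l < length Y" "fst (Y ! l) = fst (Y ! k)" "Y ! l \<noteq> Y' ! l"
      by (auto simp: B_def)
    have "k = l \<or> Y ! k \<noteq> Y ! l \<and> Y' ! k \<noteq> Y' ! l"
      using k l assms(2,4) len by (auto simp: nth_eq_iff_index_eq)
    then have "snd (Y' ! k) = (\<not> snd (Y ! k))"
      using l f[OF k] f[OF l(1)] by (auto simp: prod_eq_iff)
    then show ?thesis using True f[OF k] by (simp add: prod_eq_iff)
  next
    case False
    then have "Y' ! k = Y ! k" using k by (auto simp: B_def)
    then show ?thesis using False by (simp add: prod_eq_iff)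
  qed
  have "assigned_word \<tau> s Y' = assigned_word \<tau>' s Y"
    if s: "s \<in> PiE V (\<lambda>a. {..<length (\<tau> a)})" for s
    unfolding assigned_word_def
  proof (intro arg_cong[where f = prod_list] nth_equalityI)
    fix k assume "k < length (map (\<lambda>p. leg (snd p) (\<tau> (fst p) ! s (fst p))) Y')"
    then have k: "k < length Y" using len by simp
    then have "fst (Y ! k) \<in> V" using assms(3) nth_mem[OF k] by auto
    then have "s (fst (Y ! k)) < length (\<tau> (fst (Y ! k)))" using s by (auto simp: PiE_iff)
    then show "map (\<lambda>p. leg (snd p) (\<tau> (fst p) ! s (fst p))) Y' ! k
        = map (\<lambda>p. leg (snd p) (\<tau>' (fst p) ! s (fst p))) Y ! k"
      using k len by (simp add: Y' \<tau>'_def leg_def)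
  qed (simp add: len)
  moreover have "length (\<tau>' a) = length (\<tau> a)" for a by (simp add: \<tau>'_def)
  ultimately have "tensor_value V \<tau> Y' = tensor_value V \<tau>' Y"
    unfolding tensor_value_def by simp
  also have "\<dots> = tensor_value V \<tau> Y"
    using assms(1-3) by (rule tensor_value_equiv) (auto simp: \<tau>'_def sym tensor_equiv_def[of "\<tau> _"])
  finally show ?thesis ..
qed

section \<open>Words of endpoints of a chord diagram\<close>

text \<open>The endpoint of \<open>a\<close> met first is \<open>(a, False)\<close>, the other one is \<open>(a, True)\<close>.\<close>

definition endpoints :: "'c list \<Rightarrow> ('c \<times> bool) list" where
  "endpoints D = map (\<lambda>p. (D ! p, D ! p \<in> set (take p D))) [0..<length D]"

lemma map_fst_endpoints [simp]: "map fst (endpoints D) = D"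
  by (simp add: endpoints_def comp_def map_nth)

lemma length_endpoints [simp]: "length (endpoints D) = length D"
  by (simp add: endpoints_def)

lemma endpoints_Nil [simp]: "endpoints [] = []"
  by (simp add: endpoints_def)

lemma endpoints_snoc: "endpoints (D @ [a]) = endpoints D @ [(a, a \<in> set D)]"
  by (auto simp: endpoints_def nth_append intro!: map_cong)

lemma fst_set_endpoints: "fst ` set (endpoints D) = set D"
  by (metis list.set_map map_fst_endpoints)

lemma endpoints_filter:
  "endpoints (filter P D) = filter (\<lambda>p. P (fst p)) (endpoints D)"
  by (induction D rule: rev_induct) (auto simp: endpoints_snoc)

lemma endpoints_append:
  "set D \<inter> set D' = {} \<Longrightarrow> endpoints (D @ D') = endpoints D @ endpoints D'"
proof (induction D' rule: rev_induct)
  case (snoc a D')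
  then show ?case by (auto simp: endpoints_snoc simp flip: append_assoc)
qed simp

lemma endpoints_map:
  "inj_on f (set D) \<Longrightarrow> endpoints (map f D) = map (apfst f) (endpoints D)"
proof (induction D rule: rev_induct)
  case (snoc a D)
  then show ?case by (auto simp: endpoints_snoc inj_on_def)
qed simp

lemma count_list_eq_card: "count_list D a = card {p. p < length D \<and> D ! p = a}"
proof (induction D rule: rev_induct)
  case (snoc x D)
  have "{p. p < length (D @ [x]) \<and> (D @ [x]) ! p = a}
      = {p. p < length D \<and> D ! p = a} \<union> (if x = a then {length D} else {})"
    by (auto simp: nth_append)
  then show ?case using snoc by auto
qed simp

lemma chord_diagram_positions:
  assumes "chord_diagram D" "a \<in> set D"
  obtains p q where "p < q" "q < length D" "{k. k < length D \<and> D ! k = a} = {p, q}"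
proof -
  have "card {k. k < length D \<and> D ! k = a} = 2"
    using assms by (simp add: chord_diagram_def count_list_eq_card)
  then obtain p q where pq: "{k. k < length D \<and> D ! k = a} = {p, q}" "p \<noteq> q"
    by (auto simp: card_2_iff)
  have "p \<in> {k. k < length D \<and> D ! k = a}" "q \<in> {k. k < length D \<and> D ! k = a}"
    using pq by auto
  then show ?thesis
    using pq that[of p q] that[of q p] by (cases "p < q") (auto simp: insert_commute)
qed

lemma endpoints_nth:
  "p < length D \<Longrightarrow> endpoints D ! p = (D ! p, \<exists>q<p. D ! q = D ! p)"
  by (simp add: endpoints_def nth_image[symmetric] image_iff) (metis atLeast0LessThan lessThan_iff)

lemma endpoints_at_positions:
  assumes "p < q" "q < length D" "{k. k < length D \<and> D ! k = a} = {p, q}"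
  shows "endpoints D ! p = (a, False)" "endpoints D ! q = (a, True)"
proof -
  have a: "D ! k = a \<longleftrightarrow> k = p \<or> k = q" if "k < length D" for k
    using assms(3) that by blast
  have "D ! p = a" "D ! q = a" using assms a by auto
  moreover have "\<not> D ! k = a" if "k < p" for k using a[of k] that assms by auto
  ultimately show "endpoints D ! p = (a, False)" "endpoints D ! q = (a, True)"
    using assms(1,2) by (auto simp: endpoints_nth)
qed

lemma set_endpoints:
  assumes "chord_diagram D"
  shows "set (endpoints D) = set D \<times> UNIV"
proof
  show "set (endpoints D) \<subseteq> set D \<times> UNIV"
    using fst_set_endpoints[of D] by force
  show "set D \<times> UNIV \<subseteq> set (endpoints D)"
  proof clarify
    fix a and i :: bool assume "a \<in> set D"
    then obtain p q where pq: "p < q" "q < length D" "{k. k < length D \<and> D ! k = a} = {p, q}"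
      using chord_diagram_positions assms by metis
    have "endpoints D ! p \<in> set (endpoints D)" "endpoints D ! q \<in> set (endpoints D)"
      using pq by (auto intro: nth_mem)
    then show "(a, i) \<in> set (endpoints D)"
      using endpoints_at_positions[OF pq] by (cases i) auto
  qed
qed

lemma distinct_endpoints:
  assumes "chord_diagram D"
  shows "distinct (endpoints D)"
proof -
  have *: False if kl: "k < l" "l < length D" and eq: "endpoints D ! k = endpoints D ! l" for k l
  proof -
    have "D ! k = D ! l" using kl eq by (simp add: endpoints_nth)
    moreover obtain p q where pq: "p < q" "q < length D" "{m. m < length D \<and> D ! m = D ! k}
        = {p, q}"
      using chord_diagram_positions[OF assms, of "D ! k"] kl by auto
    ultimately have "k \<in> {p, q}" "l \<in> {p, q}" unfolding pq(3)[symmetric] using kl by simp_all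
    then have "k = p" "l = q" using kl pq(1) by auto
    then show False using endpoints_at_positions[OF pq] eq by simp
  qed
  then show ?thesis
    unfolding distinct_conv_nth length_endpoints
  proof (intro allI impI)
    fix i j assume "i < length D" "j < length D" "i \<noteq> j"
    then show "endpoints D ! i \<noteq> endpoints D ! j"
      using *[of i j] *[of j i] by (cases "i < j") auto
  qed
qed

lemma chord_weight_eq_tensor_value:
  assumes "distinct js"
  shows "chord_weight (set js) e e' D
    = tensor_value (set D) (\<lambda>_. map (\<lambda>i. (e i, e' i)) js) (endpoints D)"
proof -
  let ?f = "\<lambda>i. inv_into {..<length js} ((!) js) i"
  have bij: "bij_betw ((!) js) {..<length js} (set js)"
    using assms by (rule bij_betw_nth) auto
  have f: "?f (js ! k) = k" if "k < length js" for k
    using bij_betw_inv_into_left[OF bij] that by simp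
  have f': "js ! ?f i = i" "?f i < length js" if "i \<in> set js" for i
    using bij_betw_inv_into_right[OF bij that] inv_into_into[of i "(!) js" "{..<length js}"] that
        bij
    by (auto simp: bij_betw_def)
  show ?thesis
    unfolding chord_weight_def tensor_value_def
  proof (rule sum.reindex_bij_witness[of _ "\<lambda>s. \<lambda>a\<in>set D. js ! s a" "\<lambda>s. \<lambda>a\<in>set D. ?f (s a)"])
    fix s assume s: "s \<in> set D \<rightarrow>\<^sub>E set js"
    show "assigned_word (\<lambda>_. map (\<lambda>i. (e i, e' i)) js) (\<lambda>a\<in>set D. ?f (s a)) (endpoints D)
      = prod_list (map (\<lambda>p. if D ! p \<in> set (take p D) then e' (s (D ! p)) else e (s (D ! p)))
          [0..<length D])"
      unfolding assigned_word_def endpoints_def map_map comp_def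
    proof (intro arg_cong[where f = prod_list] map_cong refl)
      fix p assume "p \<in> set [0..<length D]"
      then have "D ! p \<in> set D" by simp
      then have "s (D ! p) \<in> set js" using s by (auto simp: PiE_iff)
      then show "leg (snd (D ! p, D ! p \<in> set (take p D)))
          (map (\<lambda>i. (e i, e' i)) js ! (\<lambda>a\<in>set D. ?f (s a)) (fst (D ! p, D ! p \<in> set (take p D))))
        = (if D ! p \<in> set (take p D) then e' (s (D ! p)) else e (s (D ! p)))"
        using \<open>D ! p \<in> set D\<close> f' by (simp add: leg_def)
    qed
  qed (auto simp: PiE_iff f f' restrict_def extensional_def fun_eq_iff)
qed

definition chord_value :: "('u::ring_1 \<times> 'u) list \<Rightarrow> 'c list \<Rightarrow> 'u" where
  "chord_value T D = tensor_value (set D) (\<lambda>_. T) (endpoints D)"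

lemma chord_value_Nil [simp]: "chord_value T [] = 1"
  by (simp add: chord_value_def tensor_value_def)

lemma chord_value_append:
  "set D \<inter> set D' = {} \<Longrightarrow> chord_value T (D @ D') = chord_value T D * chord_value T D'"
  by (simp add: chord_value_def endpoints_append tensor_value_append fst_set_endpoints)

lemma chord_value_concat_restrict:
  assumes "disjoint (set Vs)" "distinct Vs"
  shows "chord_value T (concat (map (restrict_chords D) Vs))
    = prod_list (map (\<lambda>V. chord_value T (restrict_chords D V)) Vs)"
  using assms
proof (induction Vs)
  case (Cons V Vs)
  have "set (restrict_chords D V) \<inter> set (concat (map (restrict_chords D) Vs)) = {}"
  proof -
    have "V \<inter> W = {}" if "W \<in> set Vs" for W
      using Cons.prems that by (auto simp: disjoint_def)
    then show ?thesis by (fastforce simp: restrict_chords_def)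
  qed
  then show ?case using Cons by (simp add: chord_value_append disjoint_def)
qed simp

lemma chord_value_map:
  assumes "inj_on f (set D)"
  shows "chord_value T (map f D) = chord_value T D"
  unfolding chord_value_def tensor_value_def endpoints_map[OF assms]
proof (rule sum.reindex_bij_witness[of _ "\<lambda>s. \<lambda>b\<in>f ` set D. s (the_inv_into (set D) f b)"
      "\<lambda>s. \<lambda>a\<in>set D. s (f a)"])
  fix s assume "s \<in> set (map f D) \<rightarrow>\<^sub>E {..<length T}"
  have "assigned_word (\<lambda>_. T) (\<lambda>a\<in>set D. s (f a)) (endpoints D)
      = assigned_word (\<lambda>_. T) (\<lambda>a. s (f a)) (endpoints D)"
    using fst_set_endpoints[of D] by (intro assigned_word_cong) force
  also have "\<dots> = assigned_word (\<lambda>_. T) s (map (apfst f) (endpoints D))"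
    by (simp add: assigned_word_def comp_def)
  finally show "assigned_word (\<lambda>_. T) (\<lambda>a\<in>set D. s (f a)) (endpoints D) = \<dots>" .
qed (use assms in \<open>auto simp: PiE_iff extensional_def fun_eq_iff the_inv_into_f_f\<close>)

section \<open>Values of symmetric invariant tensors\<close>

lemma sandwich_map_swap: "sandwich i (map prod.swap t) X = sandwich (\<not> i) t X"
  by (induction t) (auto simp: sandwich_Cons leg_def)

lemma chord_diagram_mset:
  assumes "mset D = mset D'"
  shows "chord_diagram D \<longleftrightarrow> chord_diagram D'"
  unfolding chord_diagram_def count_mset[symmetric] assms set_mset_mset[symmetric] ..

lemma chord_diagram_rotate1: "chord_diagram (a # D) \<Longrightarrow> chord_diagram (D @ [a])"
  by (subst chord_diagram_mset[of _ "a # D"]) auto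

text \<open>The properties of \<open>\<Sum> e_i \<otimes> e_i^*\<close> that make its values respect
  the relations. Invariance is asked for under the legs, since those are what gets moved along the
  circle.\<close>

locale invariant_tensor =
  fixes T :: "('u::ring_1 \<times> 'u) list"
  assumes symmetric: "tensor_equiv (map prod.swap T) T"
    and invariant: "t \<in> set T \<Longrightarrow> tensor_invariant (leg i t) T"
begin

lemma chord_value_eq:
  assumes "chord_diagram D" "map fst Y = D" "distinct Y"
  shows "tensor_value (set D) (\<lambda>_. T) Y = chord_value T D"
  unfolding chord_value_def
  by (rule tensor_value_relabel_endpoints[symmetric])
     (use assms distinct_endpoints set_endpoints symmetric in auto)

text \<open>The two orders of the legs give the two contractions of \<open>T\<close> around
  \<open>1\<close>, which agree by symmetry.\<close>

lemma sum_ad_legs: "(\<Sum>t\<leftarrow>T. ad (leg i t) (leg (\<not> i) t)) = 0"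
proof -
  have "(\<Sum>t\<leftarrow>T. ad (leg i t) (leg (\<not> i) t)) = sandwich i T 1 - sandwich (\<not> i) T 1"
    by (simp add: sandwich_def ad_def sum_list_subtractf)
  also have "sandwich (\<not> i) T 1 = sandwich i T 1"
    using symmetric by (simp add: tensor_equiv_def sandwich_map_swap[symmetric])
  finally show ?thesis by simp
qed

lemma chord_value_rotate1:
  assumes "chord_diagram (a # D)"
  shows "chord_value T (D @ [a]) = chord_value T (a # D)"
proof -
  obtain p Y where Y: "endpoints (a # D) = p # Y"
    by (metis length_endpoints length_Suc_conv)
  have d: "distinct (p # Y)" "set (p # Y) = set (a # D) \<times> UNIV"
    using distinct_endpoints[OF assms] set_endpoints[OF assms] Y by auto
  have f: "map fst (p # Y) = a # D" using Y map_fst_endpoints by metis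
  have "chord_value T (a # D) = tensor_value (set (a # D)) (\<lambda>_. T) (p # Y)"
    unfolding chord_value_def Y ..
  also have "\<dots> = tensor_value (set (a # D)) (\<lambda>_. T) (Y @ [p])"
    by (rule tensor_value_rotate) (use d invariant sum_ad_legs in auto)
  also have "\<dots> = tensor_value (set (D @ [a])) (\<lambda>_. T) (Y @ [p])"
    by simp
  also have "\<dots> = chord_value T (D @ [a])"
    by (rule chord_value_eq) (use f d(1) chord_diagram_rotate1[OF assms] in auto)
  finally show ?thesis ..
qed

lemma chord_value_rotate:
  assumes "chord_diagram D"
  shows "chord_value T (rotate i D) = chord_value T D \<and> chord_diagram (rotate i D)"
proof (induction i)
  case (Suc i)
  show ?case
  proof (cases "rotate i D")
    case (Cons a E)
    then show ?thesis
      using Suc chord_value_rotate1[of a E] chord_diagram_rotate1[of a E]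
      by (simp add: rotate_Suc)
  qed (use Suc in \<open>simp add: rotate_Suc\<close>)
qed (use assms in simp)

lemma chord_value_four_term:
  assumes D: "chord_diagram (u @ [b, a] @ v @ [a] @ z)"
  shows "chord_value T (u @ [b, a] @ v @ [a] @ z) - chord_value T (u @ [a, b] @ v @ [a] @ z)
    + chord_value T (u @ [a] @ v @ [b, a] @ z) - chord_value T (u @ [a] @ v @ [a, b] @ z) = 0"
proof -
  let ?D = "u @ [b, a] @ v @ [a] @ z"
  have count: "count_list ?D a = 2" by (rule D[unfolded chord_diagram_def, rule_format]) simp
  have "a \<noteq> b"
  proof
    assume "a = b"
    then show False using count by simp
  qed
  have diag_mset: "chord_diagram E" if "mset E = mset ?D" for E
    using D chord_diagram_mset[OF that] by simp
  have diag: "chord_diagram (u @ [a, b] @ v @ [a] @ z)" "chord_diagram (u @ [a] @ v @ [b, a] @ z)"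
    "chord_diagram (u @ [a] @ v @ [a, b] @ z)"
    by (rule diag_mset; simp)+
  define Y where "Y = endpoints ?D"
  have "map fst Y = u @ [b, a] @ v @ [a] @ z" by (simp add: Y_def)
  then obtain u' b' i' v' j' z' where Y: "Y = u' @ [(b, b'), (a, i')] @ v' @ [(a, j')] @ z'"
    and fst: "map fst u' = u" "map fst v' = v" "map fst z' = z"
    by (auto simp: map_eq_append_conv map_eq_Cons_conv append_eq_map_conv Cons_eq_map_conv)
  have "distinct Y" using distinct_endpoints D by (simp add: Y_def)
  then have j': "j' = (\<not> i')" unfolding Y by auto
  have dist: "distinct (u' @ [(b, b'), (a, i')] @ v' @ [(a, \<not> i')] @ z')"
    using \<open>distinct Y\<close> by (simp only: Y j')
  let ?V = "set ?D"
  have V: "set (u @ [a, b] @ v @ [a] @ z) = ?V" "set (u @ [a] @ v @ [b, a] @ z) = ?V"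
    "set (u @ [a] @ v @ [a, b] @ z) = ?V" by auto
  have "tensor_value ?V (\<lambda>_. T) (u' @ [(b, b'), (a, i')] @ v' @ [(a, \<not> i')] @ z')
    - tensor_value ?V (\<lambda>_. T) (u' @ [(a, i'), (b, b')] @ v' @ [(a, \<not> i')] @ z')
    + tensor_value ?V (\<lambda>_. T) (u' @ [(a, i')] @ v' @ [(b, b'), (a, \<not> i')] @ z')
    - tensor_value ?V (\<lambda>_. T) (u' @ [(a, i')] @ v' @ [(a, \<not> i'), (b, b')] @ z') = 0"
    by (rule tensor_value_four_term) (use dist invariant \<open>a \<noteq> b\<close> in auto)
  moreover have "tensor_value ?V (\<lambda>_. T) (u' @ [(b, b'), (a, i')] @ v' @ [(a, \<not> i')] @ z')
      = chord_value T ?D"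
    unfolding chord_value_def Y_def[symmetric] Y j' ..
  moreover have "tensor_value ?V (\<lambda>_. T) (u' @ [(a, i'), (b, b')] @ v' @ [(a, \<not> i')] @ z')
      = chord_value T (u @ [a, b] @ v @ [a] @ z)"
    unfolding V(1)[symmetric] by (rule chord_value_eq) (use dist diag fst in auto)
  moreover have "tensor_value ?V (\<lambda>_. T) (u' @ [(a, i')] @ v' @ [(b, b'), (a, \<not> i')] @ z')
      = chord_value T (u @ [a] @ v @ [b, a] @ z)"
    unfolding V(2)[symmetric] by (rule chord_value_eq) (use dist diag fst in auto)
  moreover have "tensor_value ?V (\<lambda>_. T) (u' @ [(a, i')] @ v' @ [(a, \<not> i'), (b, b')] @ z')
      = chord_value T (u @ [a] @ v @ [a, b] @ z)"
    unfolding V(3)[symmetric] by (rule chord_value_eq) (use dist diag fst in auto)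
  ultimately show ?thesis by simp
qed

text \<open>The commutator acts on both legs of a chord together, so it vanishes chord by
  chord.\<close>

lemma ad_chord_value:
  assumes "chord_diagram D" "tensor_invariant z T"
  shows "ad z (chord_value T D) = 0"
proof -
  let ?Y = "endpoints D"
  have "ad z (chord_value T D)
      = (\<Sum>p\<in>set D \<times> UNIV. tensor_value (set D) (modify_leg (ad z) p (\<lambda>_. T)) ?Y)"
    unfolding chord_value_def set_endpoints[OF assms(1), symmetric]
    by (intro ad_tensor_value distinct_endpoints assms) (simp add: fst_set_endpoints)
  also have "\<dots> = (\<Sum>b\<in>set D. tensor_value (set D) (modify_leg (ad z) (b, False) (\<lambda>_. T)) ?Y
          + tensor_value (set D) (modify_leg (ad z) (b, True) (\<lambda>_. T)) ?Y)"
    by (simp add: sum.cartesian_product' UNIV_bool add.commute)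
  also have "\<dots> = 0"
    using assms by (intro sum.neutral ballI tensor_value_invariant)
      (auto simp: distinct_endpoints set_endpoints)
  finally show ?thesis .
qed

end

section \<open>Representations of the enveloping algebra\<close>

lemma poly_mapping_monomial_induct [case_names zero add]:
  fixes p :: "'k \<Rightarrow>\<^sub>0 'b::comm_monoid_add"
  assumes "P 0" "\<And>w c p. P p \<Longrightarrow> P (Poly_Mapping.single w c + p)"
  shows "P p"
proof -
  have "P (\<Sum>w\<in>A. Poly_Mapping.single w (Poly_Mapping.lookup p w))" if "finite A" for A
    using that by induction (auto intro: assms)
  moreover have "(\<Sum>w\<in>Poly_Mapping.keys p. Poly_Mapping.single w (Poly_Mapping.lookup p w)) = p"
    by (rule poly_mapping_eqI)
       (auto simp: lookup_sum lookup_single when_def in_keys_iff)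
  ultimately show ?thesis by (metis finite_keys)
qed

definition U_const :: "'a::field_char_0 \<Rightarrow> 'a U_sl2" where
  "U_const c = U_sl2 (Poly_Mapping.single 0 c)"

lemma U_scale_eq: "U_scale c u = U_const c * u"
  by (simp add: U_scale_def U_const_def)

lemma U_sl2_eq_iff: "U_sl2 p = U_sl2 q \<longleftrightarrow> p - q \<in> sl2_ideal"
  by (rule U_sl2.abs_eq_iff)

lemma U_sl2_times: "U_sl2 p * U_sl2 q = U_sl2 (p * q)"
  by (simp add: times_U_sl2.abs_eq)

lemma U_sl2_plus: "U_sl2 p + U_sl2 q = U_sl2 (p + q)"
  by (simp add: plus_U_sl2.abs_eq)

lemma U_sl2_minus: "U_sl2 p - U_sl2 q = U_sl2 (p - q)"
  by (simp add: minus_U_sl2.abs_eq)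

lemma U_const_add: "U_const (a + b) = U_const a + U_const b"
  and U_const_mult: "U_const (a * b) = U_const a * U_const b"
  and U_const_0 [simp]: "U_const 0 = 0"
  and U_const_1 [simp]: "U_const 1 = 1"
  by (simp_all add: U_const_def U_sl2_times U_sl2_plus single_add mult_single
      zero_U_sl2_def one_U_sl2_def)

lemma U_const_uminus: "U_const (- a) = - U_const a"
  using U_const_add[of a "- a"] by (simp add: eq_neg_iff_add_eq_0 add.commute)

lemma single_0_commute:
  "Poly_Mapping.single 0 c * p = p * Poly_Mapping.single (0 :: 'g word) (c :: 'a::comm_ring_1)"
  by (induction p rule: poly_mapping_monomial_induct)
     (simp_all add: distrib_left distrib_right mult_single mult.commute)

lemma U_const_commute: "U_const c * u = u * U_const c"
  by (induction u rule: U_sl2.abs_induct) (simp add: U_const_def U_sl2_times single_0_commute)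

lemma U_incl_add: "U_incl (x + y) = U_incl x + U_incl y"
proof -
  have "letter (x + y) - letter x - letter y \<in> sl2_ideal"
    unfolding sl2_ideal_def by (rule enveloping_ideal.linear_add)
  then show ?thesis unfolding U_incl_def U_sl2_plus U_sl2_eq_iff by (simp add: algebra_simps)
qed

lemma U_incl_scale: "U_incl (sl2_scale c x) = U_const c * U_incl x"
  unfolding U_incl_def U_const_def U_sl2_times U_sl2_eq_iff sl2_ideal_def
  by (rule enveloping_ideal.linear_scale)

lemma ad_U_incl: "ad (U_incl x) (U_incl y) = U_incl (sl2_bracket x y)"
  unfolding ad_def U_incl_def U_sl2_times U_sl2_minus U_sl2_eq_iff sl2_ideal_def
  by (rule enveloping_ideal.commutator)

lemma U_incl_0 [simp]: "U_incl 0 = 0"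
  using U_incl_add[of 0 0] by simp

lemma U_incl_sum: "U_incl (\<Sum>i\<in>I. x i) = (\<Sum>i\<in>I. U_incl (x i))"
  by (induction I rule: infinite_finite_induct) (simp_all add: U_incl_add)

fun word_letters :: "'g word \<Rightarrow> 'g list" where
  "word_letters (Word xs) = xs"

lemma word_letters_0 [simp]: "word_letters 0 = []"
  by (simp add: zero_word_def)

lemma word_letters_add [simp]: "word_letters (v + w) = word_letters v @ word_letters w"
  by (cases v; cases w) simp

definition free_lift ::
  "('a::comm_ring_1 \<Rightarrow> 'u::ring_1) \<Rightarrow> ('g \<Rightarrow> 'u) \<Rightarrow> ('g word \<Rightarrow>\<^sub>0 'a) \<Rightarrow> 'u" where
  "free_lift \<kappa> \<rho> p = (\<Sum>w\<in>Poly_Mapping.keys p.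
     \<kappa> (Poly_Mapping.lookup p w) * prod_list (map \<rho> (word_letters w)))"

text \<open>The representative is an arbitrary choice; for a representation the ideal is mapped to
  \<open>0\<close>, which makes the choice immaterial.\<close>

definition U_lift :: "('a::field_char_0 \<Rightarrow> 'u::ring_1) \<Rightarrow> ('a sl2 \<Rightarrow> 'u) \<Rightarrow> 'a U_sl2 \<Rightarrow> 'u" where
  "U_lift \<kappa> \<rho> u = free_lift \<kappa> \<rho> (rep_U_sl2 u)"

locale sl2_representation =
  fixes \<kappa> :: "'a::field_char_0 \<Rightarrow> 'u::ring_1" and \<rho> :: "'a sl2 \<Rightarrow> 'u"
  assumes const_add: "\<kappa> (a + b) = \<kappa> a + \<kappa> b"
    and const_mult: "\<kappa> (a * b) = \<kappa> a * \<kappa> b"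
    and const_1: "\<kappa> 1 = 1"
    and const_central: "\<kappa> a * u = u * \<kappa> a"
    and rep_add: "\<rho> (x + y) = \<rho> x + \<rho> y"
    and rep_scale: "\<rho> (sl2_scale a x) = \<kappa> a * \<rho> x"
    and rep_bracket: "\<rho> (sl2_bracket x y) = ad (\<rho> x) (\<rho> y)"
begin

lemma const_0: "\<kappa> 0 = 0"
  using const_add[of 0 0] by simp

lemma free_lift_superset:
  assumes "finite A" "Poly_Mapping.keys p \<subseteq> A"
  shows "free_lift \<kappa> \<rho> p
    = (\<Sum>w\<in>A. \<kappa> (Poly_Mapping.lookup p w) * prod_list (map \<rho> (word_letters w)))"
  unfolding free_lift_def
  by (rule sum.mono_neutral_left) (use assms in \<open>auto simp: in_keys_iff const_0\<close>)

lemma free_lift_add: "free_lift \<kappa> \<rho> (p + q) = free_lift \<kappa> \<rho> p + free_lift \<kappa> \<rho> q"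
proof -
  let ?A = "Poly_Mapping.keys p \<union> Poly_Mapping.keys q"
  show ?thesis
    using keys_add[of p q]
    by (simp add: free_lift_superset[of ?A] lookup_add const_add distrib_right sum.distrib)
qed

lemma free_lift_0 [simp]: "free_lift \<kappa> \<rho> 0 = 0"
  by (simp add: free_lift_def)

lemma free_lift_minus: "free_lift \<kappa> \<rho> (p - q) = free_lift \<kappa> \<rho> p - free_lift \<kappa> \<rho> q"
  using free_lift_add[of "p - q" q] by simp

lemma free_lift_single:
  "free_lift \<kappa> \<rho> (Poly_Mapping.single w c) = \<kappa> c * prod_list (map \<rho> (word_letters w))"
  by (subst free_lift_superset[of "{w}"]) auto

lemma free_lift_mult: "free_lift \<kappa> \<rho> (p * q) = free_lift \<kappa> \<rho> p * free_lift \<kappa> \<rho> q"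
proof (induction p rule: poly_mapping_monomial_induct)
  case (add w c p)
  have "free_lift \<kappa> \<rho> (Poly_Mapping.single w c * q)
      = free_lift \<kappa> \<rho> (Poly_Mapping.single w c) * free_lift \<kappa> \<rho> q"
  proof (induction q rule: poly_mapping_monomial_induct)
    case (add v d q)
    have "\<kappa> c * \<kappa> d * (prod_list (map \<rho> (word_letters w)) * prod_list (map \<rho> (word_letters v)))
        = \<kappa> c * prod_list (map \<rho> (word_letters w)) * (\<kappa> d * prod_list (map \<rho> (word_letters v)))"
      by (metis const_central mult.assoc)
    with add show ?case
      by (simp add: distrib_left free_lift_add mult_single free_lift_single const_mult)
  qed simp
  with add show ?case by (simp add: distrib_right free_lift_add)
qed simp

lemma free_lift_letter: "free_lift \<kappa> \<rho> (letter x) = \<rho> x"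
  by (simp add: free_lift_single const_1)

lemma free_lift_ideal: "p \<in> enveloping_ideal sl2_scale sl2_bracket \<Longrightarrow> free_lift \<kappa> \<rho> p = 0"
proof (induction rule: enveloping_ideal.induct)
  case (linear_scale c x)
  have "free_lift \<kappa> \<rho> (Poly_Mapping.single 0 c) = \<kappa> c" by (simp add: free_lift_single)
  then show ?case by (simp only: free_lift_minus free_lift_mult free_lift_letter rep_scale) simp
qed (simp_all only: free_lift_minus free_lift_add free_lift_mult free_lift_letter
    rep_add rep_bracket ad_def, simp_all)

lemma U_lift_U_sl2: "U_lift \<kappa> \<rho> (U_sl2 p) = free_lift \<kappa> \<rho> p"
proof -
  have "rep_U_sl2 (U_sl2 p) - p \<in> sl2_ideal"
    using Quotient_abs_rep[OF Quotient_U_sl2, of "U_sl2 p"] by (simp only: U_sl2_eq_iff)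
  then have "free_lift \<kappa> \<rho> (rep_U_sl2 (U_sl2 p) - p) = 0"
    unfolding sl2_ideal_def by (rule free_lift_ideal)
  then show ?thesis by (simp add: U_lift_def free_lift_minus)
qed

lemma U_lift_add: "U_lift \<kappa> \<rho> (u + v) = U_lift \<kappa> \<rho> u + U_lift \<kappa> \<rho> v"
  by (induction u rule: U_sl2.abs_induct; induction v rule: U_sl2.abs_induct) (simp add: U_sl2_plus
      U_lift_U_sl2 free_lift_add)

lemma U_lift_mult: "U_lift \<kappa> \<rho> (u * v) = U_lift \<kappa> \<rho> u * U_lift \<kappa> \<rho> v"
  by (induction u rule: U_sl2.abs_induct; induction v rule: U_sl2.abs_induct) (simp add:
      U_sl2_times U_lift_U_sl2 free_lift_mult)

lemma U_lift_const: "U_lift \<kappa> \<rho> (U_const c) = \<kappa> c"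
  by (simp add: U_const_def U_lift_U_sl2 free_lift_single)

lemma U_lift_0: "U_lift \<kappa> \<rho> 0 = 0" and U_lift_1: "U_lift \<kappa> \<rho> 1 = 1"
  using U_lift_const[of 0] U_lift_const[of 1] by (simp_all add: const_0 const_1)

lemma U_lift_incl: "U_lift \<kappa> \<rho> (U_incl x) = \<rho> x"
  by (simp add: U_incl_def U_lift_U_sl2 free_lift_letter)

lemma U_lift_sum: "U_lift \<kappa> \<rho> (\<Sum>i\<in>I. u i) = (\<Sum>i\<in>I. U_lift \<kappa> \<rho> (u i))"
  by (induction I rule: infinite_finite_induct) (simp_all add: U_lift_add U_lift_0)

lemma U_lift_prod_list: "U_lift \<kappa> \<rho> (prod_list us) = prod_list (map (U_lift \<kappa> \<rho>) us)"
  by (induction us) (simp_all add: U_lift_mult U_lift_1)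

lemma U_lift_power: "U_lift \<kappa> \<rho> (u ^ n) = U_lift \<kappa> \<rho> u ^ n"
  by (induction n) (simp_all add: U_lift_mult U_lift_1)

lemma U_lift_tensor_value:
  assumes "finite V" "set Y \<subseteq> V \<times> UNIV"
  shows "U_lift \<kappa> \<rho> (tensor_value V \<tau> Y)
    = tensor_value V (\<lambda>a. map (map_prod (U_lift \<kappa> \<rho>) (U_lift \<kappa> \<rho>)) (\<tau> a)) Y"
  unfolding tensor_value_def U_lift_sum assigned_word_def U_lift_prod_list length_map map_map
      comp_def
proof (intro sum.cong arg_cong[where f = prod_list] map_cong refl)
  fix s p assume "s \<in> PiE V (\<lambda>a. {..<length (\<tau> a)})" "p \<in> set Y"
  then have "s (fst p) < length (\<tau> (fst p))" using assms by (auto simp: PiE_iff)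
  then show "U_lift \<kappa> \<rho> (leg (snd p) (\<tau> (fst p) ! s (fst p)))
      = leg (snd p) (map (map_prod (U_lift \<kappa> \<rho>) (U_lift \<kappa> \<rho>)) (\<tau> (fst p)) ! s (fst p))"
    by (simp add: leg_def)
qed

lemma U_lift_chord_value:
  "U_lift \<kappa> \<rho> (chord_value T D)
    = chord_value (map (map_prod (U_lift \<kappa> \<rho>) (U_lift \<kappa> \<rho>)) T) D"
  unfolding chord_value_def
  by (rule U_lift_tensor_value) (use fst_set_endpoints[of D] in force)+

end

section \<open>Generators of \<open>sl_2\<close> and the Casimir tensor\<close>

lift_definition sl2_H :: "'a::field_char_0 sl2" is
  "\<chi> i j. if i = j then (if i = 1 then 1 else - 1) else 0"
  by (simp add: trace_def sum_2)

lift_definition sl2_E :: "'a::field_char_0 sl2" is "\<chi> i j. if i = 1 \<and> j = 2 then 1 else 0"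
  by (simp add: trace_def sum_2)

lift_definition sl2_F :: "'a::field_char_0 sl2" is "\<chi> i j. if i = 2 \<and> j = 1 then 1 else 0"
  by (simp add: trace_def sum_2)

lemma std_rep_22: "std_rep X $ 2 $ 2 = - std_rep X $ 1 $ 1"
  using std_rep[of X] by (simp add: trace_def sum_2 eq_neg_iff_add_eq_0 add.commute)

lemma sl2_decompose:
  "X = sl2_scale (std_rep X $ 1 $ 1) sl2_H + sl2_scale (std_rep X $ 1 $ 2) sl2_E
    + sl2_scale (std_rep X $ 2 $ 1) sl2_F"
proof -
  have "std_rep X = std_rep (sl2_scale (std_rep X $ 1 $ 1) sl2_H + sl2_scale (std_rep X $ 1 $ 2)
      sl2_E
    + sl2_scale (std_rep X $ 2 $ 1) sl2_F)"
    by (simp add: vec_eq_iff forall_2 plus_sl2.rep_eq sl2_scale.rep_eq sl2_H.rep_eq sl2_E.rep_eq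
        sl2_F.rep_eq std_rep_22)
  then show ?thesis by (simp only: std_rep_inject)
qed

lemma sl2_brackets:
  "sl2_bracket sl2_H sl2_E = sl2_E + sl2_E"
  "sl2_bracket sl2_H sl2_F = - (sl2_F + sl2_F)"
  "sl2_bracket sl2_E sl2_F = sl2_H"
  by (simp_all flip: std_rep_inject add: vec_eq_iff forall_2 plus_sl2.rep_eq uminus_sl2.rep_eq
      minus_sl2.rep_eq sl2_bracket.rep_eq matrix_matrix_mult_def sum_2 sl2_H.rep_eq sl2_E.rep_eq
          sl2_F.rep_eq)

text \<open>
  The inverse of the form \<open>2\<langle>x, y\<rangle>\<close>, for which \<open>H\<close> has square \<open>4\<close> and \<open>E\<close>, \<open>F\<close> pair to \<open>2\<close>. The
  factor \<open>1/2\<close> is split into two quarters so that identities in it are purely additive.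
\<close>

definition casimir_tensor :: "('a::field_char_0 U_sl2 \<times> 'a U_sl2) list" where
  "casimir_tensor =
    [(U_const (1 / 4) * U_incl sl2_H, U_incl sl2_H),
     ((U_const (1 / 4) + U_const (1 / 4)) * U_incl sl2_E, U_incl sl2_F),
     ((U_const (1 / 4) + U_const (1 / 4)) * U_incl sl2_F, U_incl sl2_E)]"

lemma U_incl_uminus: "U_incl (- x) = - U_incl x"
  using U_incl_add[of x "- x"] by (simp add: eq_neg_iff_add_eq_0 add.commute)

lemma ad_generators:
  "ad (U_incl sl2_H) (U_incl sl2_E) = U_incl sl2_E + U_incl sl2_E"
  "ad (U_incl sl2_H) (U_incl sl2_F) = - (U_incl sl2_F + U_incl sl2_F)"
  "ad (U_incl sl2_E) (U_incl sl2_F) = U_incl sl2_H"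
  by (simp_all only: ad_U_incl sl2_brackets U_incl_uminus U_incl_add)

lemma ad_self [simp]: "ad z z = 0"
  and ad_swap: "ad z w = - ad w z"
  and ad_add_right: "ad z (x + y) = ad z x + ad z y"
  by (simp_all add: ad_def algebra_simps)

lemma ad_generators':
  "ad (U_incl sl2_E) (U_incl sl2_H) = - (U_incl sl2_E + U_incl sl2_E)"
  "ad (U_incl sl2_F) (U_incl sl2_H) = U_incl sl2_F + U_incl sl2_F"
  "ad (U_incl sl2_F) (U_incl sl2_E) = - U_incl sl2_H"
  by (subst ad_swap, simp add: ad_generators)+

lemma ad_mult_central:
  assumes "\<And>x. c * x = x * c"
  shows "ad (c * z) x = c * ad z x" "ad z (c * x) = c * ad z x"
  unfolding ad_def right_diff_distrib by (metis assms mult.assoc)+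

lemma tensor_invariant_mult_central:
  assumes c: "\<And>x. c * x = x * c" and "tensor_invariant z t"
  shows "tensor_invariant (c * z) t"
  unfolding tensor_invariant_def
proof (intro allI)
  fix i X
  have *: "x * (c * y) * w = c * (x * y * w)" "x * y * (c * w) = c * (x * y * w)" for x y w
    using c by (metis mult.assoc)+
  have "sandwich i (map_leg j (ad (c * z)) t) X = c * sandwich i (map_leg j (ad z) t) X" for j
    by (induction t)
       (auto simp: sandwich_Cons map_leg_def leg_def ad_mult_central[OF c] distrib_left *
          mult.assoc[of c])
  then show "sandwich i (map_leg False (ad (c * z)) t) X + sandwich i (map_leg True (ad (c
      * z)) t) X = 0"
    using assms(2) by (simp add: tensor_invariant_def flip: distrib_left)
qed

text \<open>These three elements suffice because each leg of the tensor is a central multiple of one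
  of them.\<close>

lemma casimir_tensor_invariant_generators:
  "tensor_invariant (U_incl sl2_H) (casimir_tensor :: ('a U_sl2 \<times> 'a U_sl2) list)"
  "tensor_invariant (U_incl sl2_E) (casimir_tensor :: ('a U_sl2 \<times> 'a U_sl2) list)"
  "tensor_invariant (U_incl sl2_F) (casimir_tensor :: ('a::field_char_0 U_sl2 \<times> 'a U_sl2) list)"
proof -
  define q :: "'a U_sl2" where "q = U_const (1 / 4)"
  have q: "q * x = x * q" for x unfolding q_def by (rule U_const_commute)
  have q2: "(q + q) * x = x * (q + q)" for x by (simp add: distrib_left distrib_right q)
  have q': "x * (q * y) = q * (x * y)" for x y by (metis q mult.assoc)
  show "tensor_invariant (U_incl sl2_H) (casimir_tensor :: ('a U_sl2 \<times> 'a U_sl2) list)"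
    "tensor_invariant (U_incl sl2_E) (casimir_tensor :: ('a U_sl2 \<times> 'a U_sl2) list)"
    "tensor_invariant (U_incl sl2_F) (casimir_tensor :: ('a U_sl2 \<times> 'a U_sl2) list)"
    unfolding tensor_invariant_def casimir_tensor_def q_def[symmetric]
    by (auto simp: sandwich_Cons map_leg_def leg_def ad_mult_central[OF q] ad_mult_central[OF q2]
        ad_add_right ad_generators ad_generators' algebra_simps q')
qed

lemma casimir_tensor_symmetric:
  "tensor_equiv (map prod.swap casimir_tensor)
    (casimir_tensor :: ('a::field_char_0 U_sl2 \<times> 'a U_sl2) list)"
proof -
  define q :: "'a U_sl2" where "q = U_const (1 / 4)"
  have "q * x = x * q" for x unfolding q_def by (rule U_const_commute)
  then have q': "x * (q * y) = q * (x * y)" for x y by (metis mult.assoc)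
  show ?thesis
    unfolding tensor_equiv_def casimir_tensor_def q_def[symmetric]
    by (auto simp: sandwich_Cons leg_def algebra_simps q')
qed

interpretation casimir_tensor: invariant_tensor "casimir_tensor :: ('a::field_char_0 U_sl2 \<times> 'a
    U_sl2) list"
proof
  fix t :: "'a U_sl2 \<times> 'a U_sl2" and i
  assume t: "t \<in> set casimir_tensor"
  have c: "(U_const (1 / 4) + U_const (1 / 4)) * x = x * (U_const (1 / 4) + U_const (1 / 4))" for x
      :: "'a U_sl2"
    by (simp add: distrib_left distrib_right U_const_commute)
  have "leg i t \<in> {U_const (1 / 4) * U_incl sl2_H, (U_const (1 / 4) + U_const (1 / 4))
      * U_incl sl2_E,
      (U_const (1 / 4) + U_const (1 / 4)) * U_incl sl2_F, U_incl sl2_H, U_incl sl2_E, U_incl sl2_F}"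
    using t by (auto simp: casimir_tensor_def leg_def)
  then show "tensor_invariant (leg i t) casimir_tensor"
    by (elim insertE emptyE; simp only:)
       (intro tensor_invariant_mult_central[OF c] tensor_invariant_mult_central[OF U_const_commute]
          casimir_tensor_invariant_generators)+
qed (rule casimir_tensor_symmetric)

definition casimir :: "'a::field_char_0 U_sl2" where
  "casimir = sandwich False casimir_tensor 1"

lemma casimir_eq:
  "casimir = U_const (1 / 4) * (U_incl sl2_H * U_incl sl2_H)
    + U_const (1 / 2) * (U_incl sl2_E * U_incl sl2_F + U_incl sl2_F * U_incl sl2_E)"
proof -
  have "U_const (1 / 4) + U_const (1 / 4) = (U_const (1 / 2) :: 'a U_sl2)"
    by (simp flip: U_const_add)
  then show ?thesis
    by (simp add: casimir_def casimir_tensor_def sandwich_Cons leg_def algebra_simps)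
qed

lemma ad_sandwich_1:
  "ad z (sandwich i t 1) = sandwich i (map_leg False (ad z) t) 1 + sandwich i (map_leg True (ad z)
      t) 1"
  by (induction t) (auto simp: sandwich_Cons map_leg_def leg_def ad_def algebra_simps)

lemma casimir_commute:
  "U_incl sl2_H * casimir = casimir * (U_incl sl2_H :: 'a::field_char_0 U_sl2)"
  "U_incl sl2_E * casimir = casimir * (U_incl sl2_E :: 'a U_sl2)"
  "U_incl sl2_F * casimir = casimir * (U_incl sl2_F :: 'a U_sl2)"
proof -
  have "z * casimir = casimir * z" if "tensor_invariant z casimir_tensor" for z :: "'a U_sl2"
    using ad_sandwich_1[of z False casimir_tensor] that
    by (simp add: casimir_def tensor_invariant_def ad_def)
  then show "U_incl sl2_H * casimir = casimir * (U_incl sl2_H :: 'a U_sl2)"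
    "U_incl sl2_E * casimir = casimir * (U_incl sl2_E :: 'a U_sl2)"
    "U_incl sl2_F * casimir = casimir * (U_incl sl2_F :: 'a U_sl2)"
    by (simp_all add: casimir_tensor_invariant_generators)
qed

lemma sl2_form_generators:
  "sl2_form l sl2_H Y = 2 * l * std_rep Y $ 1 $ 1"
  "sl2_form l sl2_E Y = l * std_rep Y $ 2 $ 1"
  "sl2_form l sl2_F Y = l * std_rep Y $ 1 $ 2"
  by (simp_all add: sl2_form_def trace_def matrix_matrix_mult_def sum_2 sl2_H.rep_eq sl2_E.rep_eq
      sl2_F.rep_eq std_rep_22)

lemma sl2_form_add_left: "sl2_form l (x + y) z = sl2_form l x z + sl2_form l y z"
  and sl2_form_scale_left: "sl2_form l (sl2_scale c x) z = c * sl2_form l x z"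
  by (simp_all add: sl2_form_def trace_def matrix_matrix_mult_def sum_2 plus_sl2.rep_eq
      sl2_scale.rep_eq algebra_simps)

lemma sl2_form_sum_left: "sl2_form l (\<Sum>i\<in>I. x i) z = (\<Sum>i\<in>I. sl2_form l (x i) z)"
proof -
  have "sl2_form l 0 z = 0" using sl2_form_scale_left[of l 0 0 z] by simp
  then show ?thesis
    by (induction I rule: infinite_finite_induct) (simp_all add: sl2_form_add_left)
qed

lemma sl2_dual_bases_expand:
  assumes "sl2_dual_bases (sl2_form l) I e e'"
  shows "X = (\<Sum>i\<in>I. sl2_scale (sl2_form l X (e' i)) (e i))"
proof -
  have fin: "finite I" and inj: "inj_on e I" and span: "sl2.span (e ` I) = UNIV"
    and dual: "\<And>i j. i \<in> I \<Longrightarrow> j \<in> I \<Longrightarrow> sl2_form l (e i) (e' j) = (if i = j then 1 else 0)"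
    using assms by (auto simp: sl2_dual_bases_def)
  have "X \<in> sl2.span (e ` I)" using span by simp
  then obtain u where u: "X = (\<Sum>v\<in>e ` I. sl2_scale (u v) v)"
    using sl2.span_finite[of "e ` I"] fin by auto
  then have X: "X = (\<Sum>i\<in>I. sl2_scale (u (e i)) (e i))"
    using inj by (simp add: sum.reindex)
  have coeff: "sl2_form l X (e' j) = u (e j)" if "j \<in> I" for j
  proof -
    have "sl2_form l X (e' j) = (\<Sum>i\<in>I. if i = j then u (e i) else 0)"
      unfolding X sl2_form_sum_left sl2_form_scale_left
      using dual that by (intro sum.cong) auto
    then show ?thesis using that fin by simp
  qed
  have "X = (\<Sum>i\<in>I. sl2_scale (u (e i)) (e i))" by (rule X)
  also have "\<dots> = (\<Sum>i\<in>I. sl2_scale (sl2_form l X (e' i)) (e i))"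
    by (intro sum.cong) (simp_all add: coeff)
  finally show ?thesis .
qed

text \<open>Independence of the chosen bases: writing every \<open>e' i\<close> in \<open>H\<close>,
  \<open>E\<close>, \<open>F\<close> leaves three linear combinations of the \<open>e i\<close>, and
  the dual expansions of \<open>H\<close>, \<open>E\<close> and \<open>F\<close> evaluate
  them.\<close>

lemma sum_dual_bases_eq_casimir_tensor:
  fixes e e' :: "'i \<Rightarrow> 'a::field_char_0 sl2"
  assumes dual: "sl2_dual_bases (sl2_form 2) I e e'"
  shows "(\<Sum>i\<in>I. U_incl (e i) * X * U_incl (e' i)) = sandwich False casimir_tensor X"
    and "(\<Sum>i\<in>I. U_incl (e' i) * X * U_incl (e i)) = sandwich True casimir_tensor X"
proof -
  define h where "h i = std_rep (e' i) $ 1 $ 1" for i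
  define b where "b i = std_rep (e' i) $ 1 $ 2" for i
  define c where "c i = std_rep (e' i) $ 2 $ 1" for i
  let ?H = "U_incl sl2_H :: 'a U_sl2" and ?E = "U_incl sl2_E :: 'a U_sl2" and ?F
      = "U_incl sl2_F :: 'a U_sl2"
  define S where "S g = (\<Sum>i\<in>I. U_const (g i) * U_incl (e i))" for g :: "'i \<Rightarrow> 'a"
  have e': "U_incl (e' i) = U_const (h i) * ?H + U_const (b i) * ?E + U_const (c i) * ?F" for i
    unfolding h_def b_def c_def
    by (subst sl2_decompose[of "e' i"]) (simp only: U_incl_add U_incl_scale)
  have Sc: "U_incl Z = S (\<lambda>i. sl2_form 2 Z (e' i))" for Z
    unfolding S_def
    by (subst sl2_dual_bases_expand[OF dual, of Z]) (simp add: U_incl_sum U_incl_scale)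
  have S_scale: "S (\<lambda>i. k * g i) = U_const k * S g" for k g
    by (simp add: S_def U_const_mult sum_distrib_left mult.assoc)
  have S: "S h = U_const (1 / 4) * ?H" "S b = (U_const (1 / 4) + U_const (1 / 4)) * ?F"
    "S c = (U_const (1 / 4) + U_const (1 / 4)) * ?E"
  proof -
    \<comment> \<open>The constants are \<open>2\<langle>H, Y\<rangle> = 4 Y_11\<close>,
      \<open>2\<langle>E, Y\<rangle> = 2 Y_21\<close> and
      \<open>2\<langle>F, Y\<rangle> = 2 Y_12\<close>. So the coordinates along \<open>F\<close>
      recover \<open>E\<close>, and conversely.\<close>
    have "?H = U_const 4 * S h" "?E = U_const 2 * S c" "?F = U_const 2 * S b"
      unfolding S_scale[symmetric] h_def b_def c_def by (subst Sc, simp add: sl2_form_generators)+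
    moreover have "U_const (1 / 4) * (U_const 4 * u) = u"
      "(U_const (1 / 4) + U_const (1 / 4)) * (U_const 2 * u) = u" for u :: "'a U_sl2"
      by (simp_all flip: mult.assoc U_const_mult U_const_add)
    ultimately show "S h = U_const (1 / 4) * ?H" "S b = (U_const (1 / 4) + U_const (1 / 4)) * ?F"
      "S c = (U_const (1 / 4) + U_const (1 / 4)) * ?E" by simp_all
  qed
  have comm: "x * (U_const k * y) = U_const k * (x * y)" for x y :: "'a U_sl2" and k
    by (metis U_const_commute mult.assoc)
  have "(\<Sum>i\<in>I. U_incl (e i) * X * U_incl (e' i)) = S h * X * ?H + S b * X * ?E + S c * X * ?F"
    by (simp add: e' S_def sum_distrib_right distrib_left sum.distrib comm mult.assoc)
  then show "(\<Sum>i\<in>I. U_incl (e i) * X * U_incl (e' i)) = sandwich False casimir_tensor X"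
    by (simp add: S casimir_tensor_def sandwich_Cons leg_def add_ac)
  have "(\<Sum>i\<in>I. U_incl (e' i) * X * U_incl (e i)) = ?H * X * S h + ?E * X * S b + ?F * X * S c"
    by (simp add: e' S_def sum_distrib_left distrib_right sum.distrib comm mult.assoc)
  then show "(\<Sum>i\<in>I. U_incl (e' i) * X * U_incl (e i)) = sandwich True casimir_tensor X"
    by (simp add: S casimir_tensor_def sandwich_Cons leg_def add_ac)
qed

lemma casimir_sl2_eq:
  "sl2_dual_bases (sl2_form 2) I e e' \<Longrightarrow> casimir_sl2 I e e' = casimir"
  using sum_dual_bases_eq_casimir_tensor(1)[of I e e' 1] by (simp add: casimir_sl2_def casimir_def)

lemma chord_weight_eq_chord_value:
  assumes dual: "sl2_dual_bases (sl2_form 2) I e e'" and D: "chord_diagram D"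
  shows "chord_weight I (U_incl \<circ> e) (U_incl \<circ> e') D = chord_value casimir_tensor D"
proof -
  have "finite I" using dual by (simp add: sl2_dual_bases_def)
  then obtain js where js: "distinct js" "set js = I" using finite_distinct_list by metis
  let ?T = "map (\<lambda>i. ((U_incl \<circ> e) i, (U_incl \<circ> e') i)) js"
  have "tensor_equiv ?T casimir_tensor"
    unfolding tensor_equiv_def
  proof (intro allI)
    fix i X
    have "sandwich i ?T X = (if i then \<Sum>i\<in>I. U_incl (e' i) * X * U_incl (e i)
        else \<Sum>i\<in>I. U_incl (e i) * X * U_incl (e' i))"
      using js by (simp add: sandwich_def comp_def leg_def sum_list_distinct_conv_sum_set)
    then show "sandwich i ?T X = sandwich i casimir_tensor X"
      using sum_dual_bases_eq_casimir_tensor[OF dual] by simp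
  qed
  then have "tensor_value (set D) (\<lambda>_. ?T) (endpoints D) = chord_value casimir_tensor D"
    unfolding chord_value_def using D
    by (intro tensor_value_equiv) (simp_all add: distinct_endpoints set_endpoints)
  then show ?thesis using chord_weight_eq_tensor_value[OF js(1)] js(2) by metis
qed

section \<open>The weight system and Verma modules\<close>

lemma weight_sl2_superset:
  assumes "finite A" "Poly_Mapping.keys x \<subseteq> A"
  shows "weight_sl2 I e e' x
    = (\<Sum>D\<in>A. U_const (Poly_Mapping.lookup x D) * chord_weight I (U_incl \<circ> e) (U_incl \<circ> e') D)"
  unfolding weight_sl2_def U_scale_eq
  by (rule sum.mono_neutral_left) (use assms in \<open>auto simp: in_keys_iff\<close>)

lemma weight_sl2_0 [simp]: "weight_sl2 I e e' 0 = 0"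
  by (simp add: weight_sl2_def)

lemma weight_sl2_add: "weight_sl2 I e e' (x + y) = weight_sl2 I e e' x + weight_sl2 I e e' y"
  using keys_add[of x y]
  by (simp add: weight_sl2_superset[of "Poly_Mapping.keys x \<union> Poly_Mapping.keys y"] lookup_add
      U_const_add distrib_right sum.distrib)

lemma weight_sl2_diff: "weight_sl2 I e e' (x - y) = weight_sl2 I e e' x - weight_sl2 I e e' y"
  using weight_sl2_add[of I e e' "x - y" y] by simp

lemma weight_sl2_scale: "weight_sl2 I e e' (poly_mapping_scale c x) = U_const c * weight_sl2 I e e'
    x"
proof -
  have "Poly_Mapping.keys (poly_mapping_scale c x) \<subseteq> Poly_Mapping.keys x"
    by (auto simp: in_keys_iff)
  then show ?thesis
    by (simp add: weight_sl2_superset[of "Poly_Mapping.keys x"] U_const_mult sum_distrib_left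
        mult.assoc)
qed

lemma weight_sl2_single:
  "weight_sl2 I e e' (Poly_Mapping.single D c) = U_const c * chord_weight I (U_incl \<circ> e) (U_incl \<circ>
      e') D"
  by (subst weight_sl2_superset[of "{D}"]) auto

lemma weight_sl2_sum: "weight_sl2 I e e' (\<Sum>k\<in>K. x k) = (\<Sum>k\<in>K. weight_sl2 I e e' (x k))"
  by (induction K rule: infinite_finite_induct) (simp_all add: weight_sl2_add)

lemma weight_sl2_chord_relations:
  fixes e e' :: "'i \<Rightarrow> 'a::field_char_0 sl2"
  assumes dual: "sl2_dual_bases (sl2_form 2) I e e'" and x: "x \<in> chord_relations"
  shows "weight_sl2 I e e' x = 0"
proof -
  note chord_weight = chord_weight_eq_chord_value[OF dual]
  have "base_point_relations \<union> relabel_relations \<union> four_term_relations \<subseteq> {x. weight_sl2 I e e' x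
      = 0}"
  proof (intro Un_least subsetI CollectI)
    fix x :: "'c list \<Rightarrow>\<^sub>0 'a" assume "x \<in> base_point_relations"
    then obtain D i where x: "x = Poly_Mapping.single D 1 - Poly_Mapping.single (rotate i D) 1"
      and D: "chord_diagram D"
      by (auto simp: base_point_relations_def)
    have "chord_value (casimir_tensor :: ('a U_sl2 \<times> 'a U_sl2) list) (rotate i D)
        = chord_value casimir_tensor D" "chord_diagram (rotate i D)"
      using casimir_tensor.chord_value_rotate[OF D] by blast+
    then have "chord_weight I (U_incl \<circ> e) (U_incl \<circ> e') (rotate i D)
        = chord_weight I (U_incl \<circ> e) (U_incl \<circ> e') D"
      using D by (simp add: chord_weight)
    with x show "weight_sl2 I e e' x = 0"
      by (simp add: weight_sl2_diff weight_sl2_single)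
  next
    fix x :: "'c list \<Rightarrow>\<^sub>0 'a" assume "x \<in> relabel_relations"
    then obtain D f where x: "x = Poly_Mapping.single D 1 - Poly_Mapping.single (map f D) 1"
      and D: "chord_diagram D" and f: "inj_on f (set D)"
      by (auto simp: relabel_relations_def)
    have "chord_diagram (map f D)"
      unfolding chord_diagram_def
    proof
      fix b assume "b \<in> set (map f D)"
      then obtain a where a: "a \<in> set D" "b = f a" by auto
      have "count_list (map f E) (f a) = count_list E a" if "set E \<subseteq> set D" for E
        using that inj_onD[OF f _ _ a(1)] by (induction E) auto
      then show "count_list (map f D) b = 2" using D a by (simp add: chord_diagram_def)
    qed
    then show "weight_sl2 I e e' x = 0"
      using D f by (simp add: x weight_sl2_diff weight_sl2_single chord_weight chord_value_map)
  next
    fix x :: "'c list \<Rightarrow>\<^sub>0 'a" assume "x \<in> four_term_relations"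
    then obtain u v z a b where x: "x = Poly_Mapping.single (u @ [b, a] @ v @ [a] @ z) 1
        - Poly_Mapping.single (u @ [a, b] @ v @ [a] @ z) 1
        + Poly_Mapping.single (u @ [a] @ v @ [b, a] @ z) 1
        - Poly_Mapping.single (u @ [a] @ v @ [a, b] @ z) 1"
      and D: "chord_diagram (u @ [b, a] @ v @ [a] @ z)"
      unfolding four_term_relations_def by blast
    have "chord_diagram E" if "mset E = mset (u @ [b, a] @ v @ [a] @ z)" for E
      using D chord_diagram_mset[OF that] by simp
    from this[of "u @ [a, b] @ v @ [a] @ z"] this[of "u @ [a] @ v @ [b, a] @ z"]
      this[of "u @ [a] @ v @ [a, b] @ z"]
    have "chord_diagram (u @ [a, b] @ v @ [a] @ z)" "chord_diagram (u @ [a] @ v @ [b, a] @ z)"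
      "chord_diagram (u @ [a] @ v @ [a, b] @ z)" by simp_all
    note cw = chord_weight[OF D] this[THEN chord_weight]
    show "weight_sl2 I e e' x = 0"
      unfolding x weight_sl2_diff weight_sl2_add weight_sl2_single cw U_const_1 mult_1_left
      by (rule casimir_tensor.chord_value_four_term[OF D])
  qed
  moreover have "poly_mapping_space.subspace {x. weight_sl2 I e e' x = 0}"
    by (rule poly_mapping_space.subspaceI) (simp_all add: weight_sl2_add weight_sl2_scale)
  ultimately have "chord_relations \<subseteq> {x. weight_sl2 I e e' x = 0}"
    unfolding chord_relations_def by (rule poly_mapping_space.span_minimal)
  then show ?thesis using x by auto
qed

section \<open>Differential operators and the Verma module\<close>

typedef (overloaded) 'a poly_operator = "{f :: 'a::field_char_0 poly \<Rightarrow> 'a poly.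
    (\<forall>p q. f (p + q) = f p + f q) \<and> (\<forall>c p. f (smult c p) = smult c (f p))}"
  morphisms operator_apply Abs_poly_operator
  by (rule exI[of _ "\<lambda>_. 0"]) simp

setup_lifting type_definition_poly_operator

instantiation poly_operator :: (field_char_0) ring_1
begin

lift_definition zero_poly_operator :: "'a poly_operator" is "\<lambda>_. 0" by simp
lift_definition one_poly_operator :: "'a poly_operator" is "\<lambda>p. p" by simp
lift_definition plus_poly_operator :: "'a poly_operator \<Rightarrow> 'a poly_operator \<Rightarrow> 'a poly_operator"
  is "\<lambda>f g p. f p + g p" by (simp add: smult_add_right)
lift_definition minus_poly_operator :: "'a poly_operator \<Rightarrow> 'a poly_operator \<Rightarrow> 'a poly_operator"
  is "\<lambda>f g p. f p - g p" by (simp add: smult_diff_right)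
lift_definition uminus_poly_operator :: "'a poly_operator \<Rightarrow> 'a poly_operator"
  is "\<lambda>f p. - f p" by simp
lift_definition times_poly_operator :: "'a poly_operator \<Rightarrow> 'a poly_operator \<Rightarrow> 'a poly_operator"
  is "\<lambda>f g p. f (g p)" by simp

instance
proof
  fix P Q R :: "'a poly_operator"
  show "P + Q + R = P + (Q + R)" by transfer (simp add: add.assoc)
  show "P + Q = Q + P" by transfer (simp add: add.commute)
  show "0 + P = P" by transfer simp
  show "- P + P = 0" by transfer simp
  show "P - Q = P + - Q" by transfer simp
  show "P * Q * R = P * (Q * R)" by transfer simp
  show "1 * P = P" by transfer simp
  show "P * 1 = P" by transfer simp
  show "(P + Q) * R = P * R + Q * R" by transfer simp
  show "P * (Q + R) = P * Q + P * R" by transfer simp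
  show "(0 :: 'a poly_operator) \<noteq> 1"
    by transfer (metis zero_neq_one)
qed

end

lift_definition op_const :: "'a::field_char_0 \<Rightarrow> 'a poly_operator" is smult
  by (simp add: smult_add_right mult.commute)
lift_definition op_x :: "'a::field_char_0 poly_operator" is "pCons 0"
  by simp
lift_definition op_deriv :: "'a::field_char_0 poly_operator" is pderiv
  by (simp add: pderiv_add pderiv_smult)

lemma operator_apply_simps [simp]:
  "operator_apply (P + Q) p = operator_apply P p + operator_apply Q p"
  "operator_apply (P - Q) p = operator_apply P p - operator_apply Q p"
  "operator_apply (P * Q) p = operator_apply P (operator_apply Q p)"
  "operator_apply 0 p = 0"
  "operator_apply 1 p = p"
  "operator_apply (op_const c) p = smult c p"
  "operator_apply op_x p = pCons 0 p"
  by (simp_all add: plus_poly_operator.rep_eq minus_poly_operator.rep_eq times_poly_operator.rep_eq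
      zero_poly_operator.rep_eq one_poly_operator.rep_eq op_const.rep_eq op_x.rep_eq)

lemma operator_apply_sum: "operator_apply (\<Sum>i\<in>I. P i) p = (\<Sum>i\<in>I. operator_apply (P i) p)"
  by (induction I rule: infinite_finite_induct) simp_all

lemma op_const_add: "op_const (a + b) = op_const a + op_const b"
  and op_const_mult: "op_const (a * b) = op_const a * op_const b"
  and op_const_1 [simp]: "op_const 1 = 1"
  and op_const_0 [simp]: "op_const 0 = 0"
  and op_const_uminus: "op_const (- a) = - op_const a"
  by (transfer, simp add: fun_eq_iff smult_add_left)+

lemma op_const_of_nat: "op_const (of_nat n) = of_nat n"
  by (induction n) (simp_all add: op_const_add)

lemma op_const_commute: "op_const c * P = P * op_const c"
  by transfer simp

lemma op_deriv_x: "op_deriv * op_x = op_x * op_deriv + (1 :: 'a::field_char_0 poly_operator)"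
  by transfer (simp add: fun_eq_iff pderiv_pCons add.commute)

text \<open>
  The Verma module of highest weight \<open>l\<close> on the polynomials in \<open>x\<close>: the lowering operator \<open>F\<close> is
  multiplication by \<open>x\<close>, and \<open>1\<close> is the highest weight vector.
\<close>

definition verma_E :: "'a::field_char_0 \<Rightarrow> 'a poly_operator" where
  "verma_E l = op_const l * op_deriv - op_x * op_deriv * op_deriv"

definition verma_H :: "'a::field_char_0 \<Rightarrow> 'a poly_operator" where
  "verma_H l = op_const l - (op_x * op_deriv + op_x * op_deriv)"

lemma op_deriv_x_assoc:
  "op_deriv * (op_x * P) = op_x * (op_deriv * P) + (P :: 'a::field_char_0 poly_operator)"
  by (simp add: mult.assoc[symmetric] op_deriv_x distrib_right)

lemma op_const_left_commute:
  "op_x * (op_const c * P) = op_const c * (op_x * P)"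
  "op_deriv * (op_const c * P) = op_const c * (op_deriv * P)"
  "op_x * op_const c = op_const c * op_x"
  "op_deriv * op_const c = op_const c * op_deriv"
  by (metis op_const_commute mult.assoc)+

lemma verma_brackets:
  "ad (verma_H l) (verma_E l) = verma_E l + verma_E l"
  "ad (verma_H l) op_x = - (op_x + op_x)"
  "ad (verma_E l) op_x = verma_H l"
  by (simp_all add: ad_def verma_E_def verma_H_def algebra_simps op_deriv_x_assoc op_deriv_x
      op_const_left_commute)

definition verma_rep :: "'a::field_char_0 \<Rightarrow> 'a sl2 \<Rightarrow> 'a poly_operator" where
  "verma_rep l X = op_const (std_rep X $ 1 $ 1) * verma_H l
    + op_const (std_rep X $ 1 $ 2) * verma_E l + op_const (std_rep X $ 2 $ 1) * op_x"

lemma ad_add_left: "ad (x + y) z = ad x z + ad y z"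
  by (simp add: ad_def algebra_simps)

interpretation verma: sl2_representation op_const "verma_rep l"
proof
  fix x y :: "'a sl2" and a b :: 'a and u :: "'a poly_operator"
  show "op_const (a + b) = op_const a + op_const b" by (rule op_const_add)
  show "op_const (a * b) = op_const a * op_const b" by (rule op_const_mult)
  show "op_const a * u = u * op_const a" by (rule op_const_commute)
  show "verma_rep l (x + y) = verma_rep l x + verma_rep l y"
    by (simp add: verma_rep_def plus_sl2.rep_eq op_const_add algebra_simps)
  show "verma_rep l (sl2_scale a x) = op_const a * verma_rep l x"
    by (simp add: verma_rep_def sl2_scale.rep_eq op_const_mult algebra_simps)
  have br: "ad (verma_E l) (verma_H l) = - (verma_E l + verma_E l)"
    "ad op_x (verma_H l) = op_x + op_x" "ad op_x (verma_E l) = - verma_H l"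
    by (subst ad_swap, simp add: verma_brackets)+
  note comm = ad_mult_central[OF op_const_commute]
  have d: "op_const (a - b) = op_const a - op_const b" for a b :: 'a
    using op_const_add[of "a - b" b] by simp
  have assoc: "op_const a * (op_const b * P) = op_const (a * b) * P" for a b :: 'a and P
    by (simp add: op_const_mult mult.assoc)
  define a b c a' b' c' where abc: "a = std_rep x $ 1 $ 1" "b = std_rep x $ 1 $ 2" "c
      = std_rep x $ 2 $ 1"
    "a' = std_rep y $ 1 $ 1" "b' = std_rep y $ 1 $ 2" "c' = std_rep y $ 2 $ 1"
  have "ad (verma_rep l x) (verma_rep l y)
      = (op_const (b * c') * verma_H l - op_const (b' * c) * verma_H l)
      + (op_const (a * b') * verma_E l + op_const (a * b') * verma_E l
        - (op_const (a' * b) * verma_E l + op_const (a' * b) * verma_E l))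
      + (op_const (a' * c) * op_x + op_const (a' * c) * op_x
        - (op_const (a * c') * op_x + op_const (a * c') * op_x))"
    by (simp add: verma_rep_def ad_add_left ad_add_right comm verma_brackets br assoc distrib_left
        right_diff_distrib
        abc[symmetric] mult.commute)
  also have "\<dots> = op_const (b * c' - b' * c) * verma_H l
      + op_const ((a * b' + a * b') - (a' * b + a' * b)) * verma_E l
      + op_const ((a' * c + a' * c) - (a * c' + a * c')) * op_x"
    by (simp only: d op_const_add left_diff_distrib distrib_right)
  also have "\<dots> = verma_rep l (sl2_bracket x y)"
    by (simp add: verma_rep_def sl2_bracket.rep_eq matrix_matrix_mult_def sum_2 std_rep_22
        abc[symmetric] algebra_simps)
  finally show "verma_rep l (sl2_bracket x y) = ad (verma_rep l x) (verma_rep l y)" ..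
qed simp

lemma verma_rep_generators [simp]:
  "verma_rep l sl2_H = verma_H l" "verma_rep l sl2_E = verma_E l" "verma_rep l sl2_F = op_x"
  by (simp_all add: verma_rep_def sl2_H.rep_eq sl2_E.rep_eq sl2_F.rep_eq)

abbreviation U_verma :: "'a::field_char_0 \<Rightarrow> 'a U_sl2 \<Rightarrow> 'a poly_operator" where
  "U_verma l \<equiv> U_lift op_const (verma_rep l)"

definition casimir_poly :: "'a::field_char_0 poly" where
  "casimir_poly = [:0, 1 / 2, 1 / 4:]"

lemma U_verma_casimir: "U_verma l casimir = op_const (poly casimir_poly l)"
proof -
  define q :: "'a poly_operator" where "q = op_const (1 / 4)"
  define L where "L = op_const l"
  note q = op_const_left_commute[of "1 / 4", folded q_def] and L = op_const_left_commute[of l,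
      folded L_def]
  have Lq: "L * q = q * L" "L * (q * P) = q * (L * P)" for P
    unfolding q_def L_def by (metis op_const_commute mult.assoc)+
  have half: "op_const (1 / 2) = q + q"
    unfolding q_def by (simp flip: op_const_add)
  have "poly casimir_poly l = 1 / 4 * (l * l) + 1 / 4 * l + 1 / 4 * l"
    by (simp add: casimir_poly_def field_simps)
  then have "op_const (poly casimir_poly l) = q * (L * L) + q * L + q * L"
    by (simp only: op_const_add op_const_mult q_def L_def)
  then show ?thesis
    unfolding casimir_eq verma.U_lift_add verma.U_lift_mult verma.U_lift_const verma.U_lift_incl
      verma_rep_generators half verma_E_def verma_H_def q_def[symmetric] L_def[symmetric]
    by (simp add: algebra_simps op_deriv_x_assoc op_deriv_x q L Lq)
qed

section \<open>Values in polynomials of the Casimir element\<close>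

definition casimir_eval :: "'a::field_char_0 poly \<Rightarrow> 'a U_sl2" where
  "casimir_eval p = (\<Sum>i\<le>degree p. U_const (coeff p i) * casimir ^ i)"

lemma casimir_eval_superset:
  "degree p \<le> n \<Longrightarrow> casimir_eval p = (\<Sum>i\<le>n. U_const (coeff p i) * casimir ^ i)"
  unfolding casimir_eval_def by (rule sum.mono_neutral_left) (auto simp: coeff_eq_0)

lemma casimir_eval_0 [simp]: "casimir_eval 0 = 0"
  by (simp add: casimir_eval_def)

lemma casimir_eval_pCons: "casimir_eval (pCons a p) = U_const a + casimir * casimir_eval p"
proof -
  have "casimir_eval (pCons a p) = (\<Sum>i\<le>Suc (degree p). U_const (coeff (pCons a p) i) * casimir ^ i)"
    by (rule casimir_eval_superset) (rule degree_pCons_le)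
  also have "\<dots> = U_const a + (\<Sum>i\<le>degree p. U_const (coeff p i) * (casimir * casimir ^ i))"
    by (subst sum.atMost_Suc_shift) simp
  also have "\<dots> = U_const a + casimir * casimir_eval p"
    unfolding casimir_eval_def sum_distrib_left
    by (metis (no_types, lifting) U_const_commute mult.assoc)
  finally show ?thesis .
qed

lemma casimir_eval_add: "casimir_eval (p + q) = casimir_eval p + casimir_eval q"
proof -
  let ?n = "max (degree p) (degree q)"
  have "degree (p + q) \<le> ?n" by (rule degree_add_le_max)
  then show ?thesis
    by (simp add: casimir_eval_superset[of _ ?n] U_const_add distrib_right sum.distrib)
qed

lemma casimir_eval_smult: "casimir_eval (smult c p) = U_const c * casimir_eval p"
  by (simp add: casimir_eval_superset[of _ "degree p"] degree_smult_le U_const_mult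
      sum_distrib_left mult.assoc)

lemma casimir_eval_mult: "casimir_eval (p * q) = casimir_eval p * casimir_eval q"
proof (induction p)
  case (pCons a p)
  then show ?case
    by (simp add: casimir_eval_pCons casimir_eval_add casimir_eval_smult algebra_simps)
qed simp

lemma casimir_eval_1 [simp]: "casimir_eval 1 = 1"
  unfolding one_pCons by (simp add: casimir_eval_pCons)

lemma casimir_eval_sum: "casimir_eval (\<Sum>i\<in>I. p i) = (\<Sum>i\<in>I. casimir_eval (p i))"
  by (induction I rule: infinite_finite_induct) (simp_all add: casimir_eval_add)

lemma casimir_eval_prod_list: "casimir_eval (prod_list ps) = prod_list (map casimir_eval ps)"
  by (induction ps) (simp_all add: casimir_eval_mult)

text \<open>Composition with \<open>casimir_poly\<close> translates polynomials in the Casimir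
  element into polynomials in the highest weight \<open>l\<close>, doubling the degree.\<close>

lemma U_verma_casimir_eval:
  "U_verma l (casimir_eval p) = op_const (poly (pcompose p casimir_poly) l)"
proof (induction p)
  case (pCons a p)
  then show ?case
    by (simp add: casimir_eval_pCons verma.U_lift_add verma.U_lift_mult verma.U_lift_const
        U_verma_casimir pcompose_pCons op_const_add op_const_mult)
qed (simp add: verma.U_lift_0)

text \<open>This will serve as the space of elements of weight zero. Closure under left
  multiplication is enough, since words are built up from the left.\<close>

inductive_set casimir_cartan :: "'a::field_char_0 U_sl2 set" where
  one: "1 \<in> casimir_cartan"
| add: "u \<in> casimir_cartan \<Longrightarrow> v \<in> casimir_cartan \<Longrightarrow> u + v \<in> casimir_cartan"
| const: "u \<in> casimir_cartan \<Longrightarrow> U_const c * u \<in> casimir_cartan"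
| casimir: "u \<in> casimir_cartan \<Longrightarrow> casimir * u \<in> casimir_cartan"
| H: "u \<in> casimir_cartan \<Longrightarrow> U_incl sl2_H * u \<in> casimir_cartan"

text \<open>\<open>H\<close> commutes with polynomials in the Casimir element, so its powers can be
  collected on the right.\<close>

lemma casimir_cartan_normal_form:
  assumes "u \<in> casimir_cartan"
  shows "\<exists>N P. u = (\<Sum>j<N. casimir_eval (P j) * U_incl sl2_H ^ j)"
  using assms
proof induction
  case one
  show ?case by (rule exI[of _ 1], rule exI[of _ "\<lambda>_. 1"]) simp
next
  case (add u v)
  then obtain N P M Q where u: "u = (\<Sum>j<N. casimir_eval (P j) * U_incl sl2_H ^ j)"
    and v: "v = (\<Sum>j<M. casimir_eval (Q j) * U_incl sl2_H ^ j)" by metis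
  let ?P = "\<lambda>j. if j < N then P j else 0" and ?Q = "\<lambda>j. if j < M then Q j else 0"
  have "u = (\<Sum>j<max N M. casimir_eval (?P j) * U_incl sl2_H ^ j)"
    unfolding u by (rule sum.mono_neutral_cong_left) auto
  moreover have "v = (\<Sum>j<max N M. casimir_eval (?Q j) * U_incl sl2_H ^ j)"
    unfolding v by (rule sum.mono_neutral_cong_left) auto
  ultimately have "u + v = (\<Sum>j<max N M. casimir_eval (?P j + ?Q j) * U_incl sl2_H ^ j)"
    by (simp only: casimir_eval_add distrib_right sum.distrib)
  then show ?case by (intro exI)
next
  case (const u c)
  then obtain N P where "u = (\<Sum>j<N. casimir_eval (P j) * U_incl sl2_H ^ j)" by metis
  then have "U_const c * u = (\<Sum>j<N. casimir_eval (smult c (P j)) * U_incl sl2_H ^ j)"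
    by (simp add: casimir_eval_smult sum_distrib_left mult.assoc)
  then show ?case by (intro exI)
next
  case (casimir u)
  then obtain N P where "u = (\<Sum>j<N. casimir_eval (P j) * U_incl sl2_H ^ j)" by metis
  then have "casimir * u = (\<Sum>j<N. casimir_eval (pCons 0 (P j)) * U_incl sl2_H ^ j)"
    by (simp add: casimir_eval_pCons sum_distrib_left mult.assoc)
  then show ?case by (intro exI)
next
  case (H u)
  then obtain N P where u: "u = (\<Sum>j<N. casimir_eval (P j) * U_incl sl2_H ^ j)" by metis
  have comm: "U_incl sl2_H * casimir_eval p = casimir_eval p * U_incl sl2_H" for p :: "'a poly"
  proof (induction p)
    case (pCons a p)
    have "U_incl sl2_H * (casimir * casimir_eval p) = casimir * casimir_eval p * U_incl sl2_H"
      by (metis casimir_commute(1) mult.assoc pCons.IH)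
    then show ?case by (simp add: casimir_eval_pCons distrib_left distrib_right U_const_commute)
  qed simp
  have "U_incl sl2_H * u = (\<Sum>j<N. casimir_eval (P j) * U_incl sl2_H ^ Suc j)"
    unfolding u by (simp add: sum_distrib_left comm flip: mult.assoc)
  also have "\<dots> = (\<Sum>j<Suc N. casimir_eval (if j = 0 then 0 else P (j - 1)) * U_incl sl2_H ^ j)"
    by (subst sum.lessThan_Suc_shift) simp
  finally show ?case by (intro exI)
qed

lemma H_power_commute:
  fixes x :: "'a::field_char_0 U_sl2"
  assumes x: "ad (U_incl sl2_H) x = U_const k * x"
  shows "U_incl sl2_H * x ^ n = x ^ n * U_incl sl2_H + U_const (of_nat n * k) * x ^ n"
proof (induction n)
  case (Suc n)
  let ?H = "U_incl sl2_H :: 'a U_sl2" and ?c = "U_const (of_nat n * k)"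
  have "?H * x = x * ?H + U_const k * x" using x by (simp add: ad_def algebra_simps)
  then have "?H * x ^ Suc n = x * (?H * x ^ n) + U_const k * x ^ Suc n"
    by (simp add: distrib_right flip: mult.assoc)
  also have "\<dots> = x ^ Suc n * ?H + (x * (?c * x ^ n) + U_const k * x ^ Suc n)"
    unfolding Suc by (simp only: distrib_left mult.assoc power_Suc add.assoc)
  also have "x * (?c * x ^ n) = ?c * x ^ Suc n"
    unfolding power_Suc by (metis U_const_commute mult.assoc)
  also have "?c * x ^ Suc n + U_const k * x ^ Suc n = U_const (of_nat n * k + k) * x ^ Suc n"
    by (simp only: distrib_right U_const_add)
  also have "of_nat n * k + k = of_nat (Suc n) * k"
    by (simp add: algebra_simps)
  finally show ?case .
qed simp

lemma ad_H_generators: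
  "ad (U_incl sl2_H) (U_incl sl2_E) = U_const 2 * (U_incl sl2_E :: 'a::field_char_0 U_sl2)"
  "ad (U_incl sl2_H) (U_incl sl2_F) = U_const (- 2) * (U_incl sl2_F :: 'a::field_char_0 U_sl2)"
proof -
  have "U_const 2 = (1 + 1 :: 'a U_sl2)" by (simp flip: U_const_1 U_const_add)
  then show "ad (U_incl sl2_H) (U_incl sl2_E) = U_const 2 * (U_incl sl2_E :: 'a U_sl2)"
    "ad (U_incl sl2_H) (U_incl sl2_F) = U_const (- 2) * (U_incl sl2_F :: 'a U_sl2)"
    unfolding U_const_uminus ad_generators by (simp_all add: mult_2)
qed

definition power_multiples :: "'a::field_char_0 U_sl2 \<Rightarrow> nat \<Rightarrow> 'a U_sl2 set" where
  "power_multiples x n = (*) (x ^ n) ` casimir_cartan"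

lemma power_multiples_closed:
  assumes x: "x * casimir = casimir * x"
    and H: "U_incl sl2_H * x ^ n = x ^ n * U_incl sl2_H + U_const k * x ^ n"
    and u: "u \<in> power_multiples x n"
  shows "U_const c * u \<in> power_multiples x n" "casimir * u \<in> power_multiples x n"
    "U_incl sl2_H * u \<in> power_multiples x n"
    "v \<in> power_multiples x n \<Longrightarrow> u + v \<in> power_multiples x n"
proof -
  obtain s where s: "s \<in> casimir_cartan" and us: "u = x ^ n * s"
    using u by (auto simp: power_multiples_def)
  have "U_const c * u = x ^ n * (U_const c * s)"
    unfolding us by (metis U_const_commute mult.assoc)
  then show "U_const c * u \<in> power_multiples x n"
    using casimir_cartan.const[OF s] by (auto simp: power_multiples_def)
  have "casimir * x ^ n = x ^ n * casimir" using power_commuting_commutes[OF x] by simp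
  then have "casimir * u = x ^ n * (casimir * s)" unfolding us by (metis mult.assoc)
  then show "casimir * u \<in> power_multiples x n"
    using casimir_cartan.casimir[OF s] by (auto simp: power_multiples_def)
  have "U_incl sl2_H * u = x ^ n * (U_incl sl2_H * s + U_const k * s)"
    unfolding us mult.assoc[symmetric] H by (simp add: distrib_right distrib_left mult.assoc)
      (metis U_const_commute mult.assoc)
  then show "U_incl sl2_H * u \<in> power_multiples x n"
    using casimir_cartan.add[OF casimir_cartan.H[OF s] casimir_cartan.const[OF s]]
    by (auto simp: power_multiples_def)
  show "u + v \<in> power_multiples x n" if "v \<in> power_multiples x n"
    using that s unfolding us power_multiples_def
    by (auto simp: distrib_left[symmetric] intro!: imageI casimir_cartan.add)
qed

text \<open>Solves for \<open>E F\<close> and \<open>F E\<close> the two equations given by the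
  Casimir element and by \<open>[E, F] = H\<close>.\<close>

lemma E_F_product:
  "U_incl sl2_E * U_incl sl2_F = casimir + U_const (1 / 2) * U_incl sl2_H
    + U_const (- (1 / 4)) * (U_incl sl2_H * (U_incl sl2_H :: 'a::field_char_0 U_sl2))"
  "U_incl sl2_F * U_incl sl2_E = casimir + U_const (- (1 / 2)) * U_incl sl2_H
    + U_const (- (1 / 4)) * (U_incl sl2_H * (U_incl sl2_H :: 'a::field_char_0 U_sl2))"
proof -
  let ?H = "U_incl sl2_H :: 'a U_sl2" and ?E = "U_incl sl2_E :: 'a U_sl2" and ?F
      = "U_incl sl2_F :: 'a U_sl2"
  have h: "?E * ?F = ?F * ?E + ?H" using ad_generators(3) by (simp add: ad_def algebra_simps)
  have two: "U_const (1 / 2) * x + U_const (1 / 2) * x = x" for x :: "'a U_sl2"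
    by (simp flip: distrib_right U_const_add)
  have two': "U_const (1 / 2) * x + (U_const (1 / 2) * x + y) = x + y" for x y :: "'a U_sl2"
    by (simp add: two flip: add.assoc)
  show fe: "?F * ?E = casimir + U_const (- (1 / 2)) * ?H + U_const (- (1 / 4)) * (?H * ?H)"
    unfolding casimir_eq h by (simp add: U_const_uminus distrib_left two two')
  show "?E * ?F = casimir + U_const (1 / 2) * ?H + U_const (- (1 / 4)) * (?H * ?H)"
    unfolding h fe using two[of ?H] by (simp add: U_const_uminus algebra_simps)
qed

text \<open>
  The weight spaces for the adjoint action of \<open>H\<close>, described without a basis of the enveloping
  algebra: the products \<open>E F\<close> and \<open>F E\<close> are polynomials in the Casimir element and \<open>H\<close>, so every
  word of weight \<open>k\<close> is such a polynomial times a power of \<open>E\<close> or \<open>F\<close>.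
\<close>

definition weight_space :: "int \<Rightarrow> 'a::field_char_0 U_sl2 set" where
  "weight_space k = (if 0 \<le> k then power_multiples (U_incl sl2_E) (nat k)
     else power_multiples (U_incl sl2_F) (nat (- k)))"

lemma weight_space_closed:
  fixes u :: "'a::field_char_0 U_sl2"
  assumes "u \<in> weight_space k"
  shows "U_const c * u \<in> weight_space k" "U_incl sl2_H * u \<in> weight_space k"
    "U_incl sl2_E * u \<in> weight_space (k + 1)" "U_incl sl2_F * u \<in> weight_space (k - 1)"
proof -
  note E = power_multiples_closed[OF casimir_commute(2) H_power_commute[OF ad_H_generators(1)]]
    and F = power_multiples_closed[OF casimir_commute(3) H_power_commute[OF ad_H_generators(2)]]
  have E_eq: "weight_space (int n) = power_multiples (U_incl sl2_E :: 'a U_sl2) n"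
    and F_eq: "weight_space (- int n) = power_multiples (U_incl sl2_F :: 'a U_sl2) n" for n
    by (auto simp: weight_space_def power_multiples_def)
  show "U_const c * u \<in> weight_space k" "U_incl sl2_H * u \<in> weight_space k"
    using assms E(1,3) F(1,3) by (auto simp: weight_space_def split: if_splits)
  have raise: "x * u \<in> power_multiples x (Suc n)" if "u \<in> power_multiples x n" for x :: "'a U_sl2"
      and n
    using that by (auto simp: power_multiples_def mult.assoc)
  show "U_incl sl2_E * u \<in> weight_space (k + 1)"
  proof (cases "0 \<le> k")
    case True
    then obtain n where k: "k = int n" using nonneg_int_cases by blast
    then show ?thesis using raise[of "U_incl sl2_E" n] assms E_eq[of n] E_eq[of "Suc n"]
      by (simp add: add.commute)
  next
    case False
    then obtain n where k: "k = - int (Suc n)" by (metis neg_int_cases not_le gr0_implies_Suc)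
    then obtain s where s: "s \<in> casimir_cartan" "u = U_incl sl2_F ^ Suc n * s"
      using assms F_eq[of "Suc n"] by (auto simp: power_multiples_def)
    let ?v = "U_incl sl2_F ^ n * s"
    have v: "?v \<in> power_multiples (U_incl sl2_F) n" using s by (auto simp: power_multiples_def)
    \<comment> \<open>The leading \<open>F\<close> cancels against \<open>E\<close>, at the price of
      a polynomial in the Casimir element and \<open>H\<close>.\<close>
    have "U_incl sl2_E * u = (U_incl sl2_E * U_incl sl2_F) * ?v" by (simp add: s mult.assoc)
    also have "\<dots> = casimir * ?v + U_const (1 / 2) * (U_incl sl2_H * ?v)
        + U_const (- (1 / 4)) * (U_incl sl2_H * (U_incl sl2_H * ?v))"
      unfolding E_F_product by (simp only: distrib_right mult.assoc)
    also have "\<dots> \<in> power_multiples (U_incl sl2_F) n"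
      by (intro F v)
    finally show ?thesis using F_eq[of n] by (simp add: k)
  qed
  show "U_incl sl2_F * u \<in> weight_space (k - 1)"
  proof (cases "k \<le> 0")
    case True
    then obtain n where k: "k = - int n" by (metis nonpos_int_cases)
    have "k - 1 = - int (Suc n)" by (simp add: k)
    then show ?thesis using raise[of "U_incl sl2_F" n] assms k F_eq[of n] F_eq[of "Suc n"] by metis
  next
    case False
    then obtain n where k: "k = int (Suc n)" by (metis pos_int_cases not_le gr0_implies_Suc)
    then obtain s where s: "s \<in> casimir_cartan" "u = U_incl sl2_E ^ Suc n * s"
      using assms E_eq[of "Suc n"] by (auto simp: power_multiples_def)
    let ?v = "U_incl sl2_E ^ n * s"
    have v: "?v \<in> power_multiples (U_incl sl2_E) n" using s by (auto simp: power_multiples_def)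
    have "U_incl sl2_F * u = (U_incl sl2_F * U_incl sl2_E) * ?v" by (simp add: s mult.assoc)
    also have "\<dots> = casimir * ?v + U_const (- (1 / 2)) * (U_incl sl2_H * ?v)
        + U_const (- (1 / 4)) * (U_incl sl2_H * (U_incl sl2_H * ?v))"
      unfolding E_F_product by (simp only: distrib_right mult.assoc)
    also have "\<dots> \<in> power_multiples (U_incl sl2_E) n"
      by (intro E v)
    finally show ?thesis using E_eq[of n] by (simp add: k)
  qed
qed

text \<open>Half the eigenvalue of \<open>ad H\<close>, so that \<open>E\<close> has weight
  \<open>1\<close>. The index \<open>j\<close> runs over the summands \<open>H \<otimes> H\<close>,
  \<open>E \<otimes> F\<close>, \<open>F \<otimes> E\<close> of
  \<open>casimir_tensor\<close>.\<close>

definition leg_weight :: "bool \<Rightarrow> nat \<Rightarrow> int" where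
  "leg_weight i j = (if j = 0 then 0 else if (j = 1) = i then - 1 else 1)"

lemma leg_casimir_tensor_weight:
  fixes u :: "'a::field_char_0 U_sl2"
  assumes "u \<in> weight_space k" "j < 3"
  shows "leg i (casimir_tensor ! j) * u \<in> weight_space (leg_weight i j + k)"
proof -
  have half: "(U_const (1 / 4) + U_const (1 / 4)) * v = U_const (1 / 2) * (v :: 'a U_sl2)" for v
    by (simp flip: U_const_add)
  consider "j = 0" | "j = 1" | "j = 2" using assms(2) by linarith
  then show ?thesis
    using weight_space_closed[OF assms(1)]
    by cases (auto simp: casimir_tensor_def leg_def leg_weight_def half mult.assoc add.commute
        intro!: weight_space_closed(1))
qed

text \<open>The two legs of a summand have opposite weights, so already every single assignment
  gives a word of weight zero.\<close>

lemma chord_value_casimir_cartan: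
  fixes D :: "'b list"
  assumes "chord_diagram D"
  shows "chord_value casimir_tensor D \<in> (casimir_cartan :: 'a::field_char_0 U_sl2 set)"
proof -
  let ?T = "casimir_tensor :: ('a U_sl2 \<times> 'a U_sl2) list"
  have len: "length ?T = 3" by (simp add: casimir_tensor_def)
  have zero: "0 \<in> (casimir_cartan :: 'a U_sl2 set)"
    using casimir_cartan.const[OF casimir_cartan.one, of 0] by simp
  have word: "assigned_word (\<lambda>_. ?T) s Y \<in> weight_space (\<Sum>p\<leftarrow>Y. leg_weight (snd p) (s (fst p)))"
    if "\<forall>p\<in>set Y. s (fst p) < 3" for Y and s :: "'b \<Rightarrow> nat"
    using that
  proof (induction Y)
    case Nil
    have "1 \<in> power_multiples (U_incl sl2_E :: 'a U_sl2) 0"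
      by (auto simp: power_multiples_def image_iff intro: casimir_cartan.one)
    then show ?case by (simp add: weight_space_def)
  qed (auto simp: assigned_word_Cons intro!: leg_casimir_tensor_weight)
  have weight: "(\<Sum>p\<leftarrow>endpoints D. leg_weight (snd p) (s (fst p))) = 0" for s :: "'b \<Rightarrow> nat"
  proof -
    have "(\<Sum>p\<leftarrow>endpoints D. leg_weight (snd p) (s (fst p)))
        = (\<Sum>p\<in>set D \<times> UNIV. leg_weight (snd p) (s (fst p)))"
      using assms by (simp add: sum_list_distinct_conv_sum_set distinct_endpoints set_endpoints)
    also have "\<dots> = (\<Sum>a\<in>set D. leg_weight False (s a) + leg_weight True (s a))"
      by (simp add: sum.cartesian_product' UNIV_bool add.commute)
    also have "\<dots> = 0" by (intro sum.neutral) (auto simp: leg_weight_def)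
    finally show ?thesis .
  qed
  have "assigned_word (\<lambda>_. ?T) s (endpoints D) \<in> weight_space 0"
    if "s \<in> PiE (set D) (\<lambda>_. {..<3})" for s
  proof -
    have "\<forall>p\<in>set (endpoints D). s (fst p) < 3"
    proof
      fix p assume "p \<in> set (endpoints D)"
      then have "fst p \<in> set D" by (metis fst_set_endpoints imageI)
      then show "s (fst p) < 3" using PiE_mem[OF that] by auto
    qed
    then show ?thesis using word weight by metis
  qed
  moreover have "weight_space 0 = (casimir_cartan :: 'a U_sl2 set)"
    by (auto simp: weight_space_def power_multiples_def)
  ultimately have words: "assigned_word (\<lambda>_. ?T) s (endpoints D) \<in> casimir_cartan"
    if "s \<in> PiE (set D) (\<lambda>_. {..<3})" for s
    using that by blast
  have sums: "(\<Sum>s\<in>S. g s) \<in> casimir_cartan" if "\<And>s. s \<in> S \<Longrightarrow> g s \<in> casimir_cartan"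
    for g :: "('b \<Rightarrow> nat) \<Rightarrow> 'a U_sl2" and S
    using that by (induction S rule: infinite_finite_induct) (auto intro: casimir_cartan.add zero)
  show ?thesis
    unfolding chord_value_def tensor_value_def len by (rule sums) (rule words)
qed

lemma operator_apply_smult: "operator_apply P (smult c p) = smult c (operator_apply P p)"
  using operator_apply[of P] by simp

lemma operator_apply_verma_H:
  "operator_apply (verma_H l) (monom 1 k) = smult (l - 2 * of_nat k) (monom 1 k)"
proof -
  have "pCons 0 (pderiv (monom 1 k)) = smult (of_nat k) (monom (1 :: 'a) k)"
    by (cases k) (simp_all add: pderiv_monom smult_monom flip: monom_Suc)
  then show ?thesis
    by (simp add: verma_H_def op_deriv.rep_eq smult_diff_left flip: smult_add_left)
qed

text \<open>
  On the vector \<open>x\<^sup>k\<close> of a Verma module, \<open>H\<close> acts by \<open>l - 2 k\<close> and the Casimir element by a scalar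
  that does not depend on \<open>k\<close>. Commutation with \<open>F\<close> makes the eigenvalue of \<open>u\<close> independent of \<open>k\<close>,
  which leaves no room for \<open>H\<close>.
\<close>

lemma casimir_cartan_central:
  fixes u :: "'a::field_char_0 U_sl2"
  assumes "u \<in> casimir_cartan" "U_incl sl2_F * u = u * U_incl sl2_F"
  shows "\<exists>p. u = casimir_eval p"
proof -
  obtain N P where u: "u = (\<Sum>j<N. casimir_eval (P j) * U_incl sl2_H ^ j)"
    using casimir_cartan_normal_form[OF assms(1)] by blast
  have "pcompose (P j) casimir_poly = 0" if j: "0 < j" "j < N" for j
  proof -
    \<comment> \<open>For fixed \<open>l\<close> the infinitely many eigenvalues of \<open>H\<close>
      force the polynomial \<open>G\<close> to be constant. Varying \<open>l\<close> then kills its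
      higher coefficients as polynomials in \<open>l\<close>.\<close>
    have "poly (pcompose (P j) casimir_poly) l = 0" for l :: 'a
    proof -
      define G where "G = (\<Sum>j<N. monom (poly (pcompose (P j) casimir_poly) l) j)"
      have H_power: "operator_apply (verma_H l ^ i) (monom 1 k) = smult ((l
          - 2 * of_nat k) ^ i) (monom 1 k)" for i k
        by (induction i) (simp_all add: operator_apply_verma_H operator_apply_smult mult.commute)
      have eigen: "operator_apply (U_verma l u) (monom 1 k) = smult (poly G (l
          - 2 * of_nat k)) (monom 1 k)" for k
        by (simp add: u verma.U_lift_sum verma.U_lift_mult verma.U_lift_power verma.U_lift_incl
            operator_apply_sum U_verma_casimir_eval H_power G_def poly_sum poly_monom smult_sum)
      have const: "poly G (l - 2 * of_nat k) = poly G l" for k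
      proof (induction k)
        case (Suc k)
        have "U_verma l (U_incl sl2_F * u) = U_verma l (u * U_incl sl2_F)" using assms(2) by simp
        then have "operator_apply (op_x * U_verma l u) (monom 1 k) = operator_apply (U_verma l u
            * op_x) (monom 1 k)"
          by (simp add: verma.U_lift_mult verma.U_lift_incl)
        then have "smult (poly G (l - 2 * of_nat k)) (monom 1 (Suc k))
            = smult (poly G (l - 2 * of_nat (Suc k))) (monom 1 (Suc k))"
          by (simp add: eigen smult_monom flip: monom_Suc)
        then show ?case using Suc by (simp add: smult_monom)
      qed simp
      have "G - [:poly G l:] = 0"
      proof (rule ccontr)
        assume "G - [:poly G l:] \<noteq> 0"
        then have "finite {y. poly (G - [:poly G l:]) y = 0}" by (rule poly_roots_finite)
        moreover have "range (\<lambda>k. l - 2 * of_nat k) \<subseteq> {y. poly (G - [:poly G l:]) y = 0}"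
          using const by auto
        moreover have "inj (\<lambda>k. l - 2 * of_nat k :: 'a)" by (auto simp: inj_on_def)
        ultimately show False using finite_imageD finite_subset infinite_UNIV_nat by metis
      qed
      then have "coeff G j = coeff [:poly G l:] j" by simp
      moreover have "coeff G j = poly (pcompose (P j) casimir_poly) l"
        using j by (simp add: G_def coeff_sum)
      ultimately show ?thesis using j by (simp add: coeff_pCons split: nat.splits)
    qed
    then show ?thesis using poly_all_0_iff_0 by blast
  qed
  moreover have "degree (casimir_poly :: 'a poly) > 0" by (simp add: casimir_poly_def)
  ultimately have P: "P j = 0" if "0 < j" "j < N" for j
    using that pcompose_eq_0_iff by blast
  show ?thesis
  proof (cases N)
    case 0
    then show ?thesis using u by (intro exI[of _ 0]) simp
  next
    case (Suc M)
    have "u = casimir_eval (P 0) + (\<Sum>j<M. casimir_eval (P (Suc j)) * U_incl sl2_H ^ Suc j)"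
      unfolding u Suc by (subst sum.lessThan_Suc_shift) simp
    also have "\<dots> = casimir_eval (P 0)" using P Suc by simp
    finally show ?thesis by blast
  qed
qed

lemma chord_value_casimir_eval:
  assumes "chord_diagram D"
  shows "\<exists>p :: 'b::field_char_0 poly. chord_value casimir_tensor D = casimir_eval p"
proof (rule casimir_cartan_central)
  have "ad (U_incl sl2_F) (chord_value casimir_tensor D) = (0 :: 'b U_sl2)"
    by (rule casimir_tensor.ad_chord_value[OF assms casimir_tensor_invariant_generators(3)])
  then show "U_incl sl2_F * chord_value casimir_tensor D
      = chord_value casimir_tensor D * (U_incl sl2_F :: 'b U_sl2)"
    by (simp add: ad_def)
qed (rule chord_value_casimir_cartan[OF assms])

section \<open>Chord diagrams in the Weyl algebra\<close>

definition chord_interior :: "('c \<times> bool) list \<Rightarrow> 'c \<Rightarrow> ('c \<times> bool) set" where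
  "chord_interior Y v = {p. \<exists>Y0 Y1 Y2. Y = Y0 @ (v, False) # Y1 @ (v, True) # Y2 \<and> p \<in> set Y1}"

text \<open>
  The sign is opposite to that of the edge from \<open>v\<close> to \<open>b\<close> when every tail is the endpoint met first.
  This does no harm, as it is only multiplied along circuits of even length.
\<close>

definition crossing_number :: "('c \<times> bool) list \<Rightarrow> 'c \<Rightarrow> 'c \<Rightarrow> int" where
  "crossing_number Y v b = of_bool ((b, True) \<in> chord_interior Y v)
      - of_bool ((b, False) \<in> chord_interior Y v)"

text \<open>\<open>ad z\<close> has opposite effects on the two legs. A chord with both ends in the
  range of \<open>ad z\<close> therefore cancels, and one with a single end there leaves
  \<open>t'\<close>, with a sign telling which end it is.\<close>

definition leg_derivative :: "'u::ring_1 \<Rightarrow> ('u \<times> 'u) list \<Rightarrow> int \<Rightarrow> ('u \<times> 'u) list \<Rightarrow> bool" where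
  "leg_derivative z t c t' \<longleftrightarrow>
    (\<forall>i X. sandwich i (map_leg True (ad z) t) X = of_int c * sandwich i t' X
       \<and> sandwich i (map_leg False (ad z) t) X = of_int (- c) * sandwich i t' X)"

locale ordered_endpoint_word =
  fixes V :: "'c set" and Y :: "('c \<times> bool) list"
  assumes finite_chords: "finite V" and distinct_word: "distinct Y" and set_word: "set Y = V \<times> UNIV"
    and ordered: "v \<in> V \<Longrightarrow> \<exists>Y0 Y1 Y2. Y = Y0 @ (v, False) # Y1 @ (v, True) # Y2"
begin

lemma chord_decomposition:
  assumes "v \<in> V"
  obtains Y0 Y1 Y2 where "Y = Y0 @ (v, False) # Y1 @ (v, True) # Y2" "chord_interior Y v = set Y1"
    "v \<notin> fst ` set (Y0 @ Y1 @ Y2)"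
proof -
  obtain Y0 Y1 Y2 where Y: "Y = Y0 @ (v, False) # Y1 @ (v, True) # Y2"
    using ordered[OF assms] by blast
  have "Z1 = Y1" if Z: "Y = Z0 @ (v, False) # Z1 @ (v, True) # Z2" for Z0 Z1 Z2
  proof -
    have d: "distinct (Y0 @ (v, False) # (Y1 @ (v, True) # Y2))" "distinct (Z0 @ (v, False) # (Z1 @
        (v, True) # Z2))"
      using distinct_word Y Z by metis+
    have "Y1 @ (v, True) # Y2 = Z1 @ (v, True) # Z2"
      using d Y Z append_Cons_eq_iff[of "(v, False)" Y0 "Y1 @ (v, True) # Y2" Z0 "Z1 @ (v, True) #
          Z2"]
      by auto
    moreover have "(v, True) \<notin> set Y1" "(v, True) \<notin> set Y2" using d(1) by auto
    ultimately show ?thesis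
      using append_Cons_eq_iff[of "(v, True)" Y1 Y2 Z1 Z2] by simp
  qed
  then have "chord_interior Y v = set Y1" using Y by (auto simp: chord_interior_def)
  moreover have "v \<notin> fst ` set (Y0 @ Y1 @ Y2)"
  proof
    assume "v \<in> fst ` set (Y0 @ Y1 @ Y2)"
    then obtain i where "(v, i) \<in> set (Y0 @ Y1 @ Y2)" by (metis imageE prod.collapse)
    then show False using distinct_word Y by (cases i) auto
  qed
  ultimately show ?thesis using that Y by blast
qed

lemma chord_interior_subset: "v \<in> V \<Longrightarrow> chord_interior Y v \<subseteq> (V - {v}) \<times> UNIV"
proof
  fix p assume v: "v \<in> V" and p: "p \<in> chord_interior Y v"
  obtain Y0 Y1 Y2 where Y: "Y = Y0 @ (v, False) # Y1 @ (v, True) # Y2" "chord_interior Y v = set Y1"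
    "v \<notin> fst ` set (Y0 @ Y1 @ Y2)" using chord_decomposition v by metis
  have "p \<in> V \<times> UNIV" using p Y(1,2) unfolding set_word[symmetric] by simp
  moreover have "fst p \<noteq> v" using p Y(2,3) by auto
  ultimately show "p \<in> (V - {v}) \<times> UNIV" by auto
qed

lemma crossing_number_self [simp]: "v \<in> V \<Longrightarrow> crossing_number Y v v = 0"
  using chord_interior_subset[of v] by (auto simp: crossing_number_def)

text \<open>\<open>ad z\<close> runs over the endpoints enclosed by \<open>v\<close>, and the
  crossing number collects both ends of each chord. The tensor \<open>s\<close> is left at
  \<open>v\<close>, and \<open>t' b\<close> at the chord \<open>b\<close> that was reached.\<close>

lemma tensor_value_leg_derivative:
  assumes v: "v \<in> V"
    and t: "\<And>X. sandwich False (\<tau> v) X = sandwich False s (ad z X)"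
    and der: "\<And>b. b \<in> V - {v} \<Longrightarrow> leg_derivative z (\<tau> b) (c b) (t' b)"
  shows "tensor_value V \<tau> Y
    = (\<Sum>b\<in>V - {v}. of_int (crossing_number Y v b * c b) * tensor_value V (\<tau>(b := t' b, v := s)) Y)"
proof -
  obtain Y0 Y1 Y2 where Y: "Y = Y0 @ (v, False) # Y1 @ (v, \<not> False) # Y2" "chord_interior Y v
      = set Y1"
    and v': "v \<notin> fst ` set (Y0 @ Y1 @ Y2)" using chord_decomposition[OF v] by auto
  let ?g = "\<lambda>p. tensor_value V ((modify_leg (ad z) p \<tau>)(v := s)) Y"
  have g: "?g (b, i) = of_int (if i then c b else - c b) * tensor_value V (\<tau>(b := t' b, v := s)) Y"
    if b: "b \<in> V - {v}" for b i
  proof -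
    have "?g (b, i) = tensor_value V ((\<tau>(v := s))(b := map_leg i (ad z) (\<tau> b))) Y"
      using b by (simp add: modify_leg_def fun_upd_twist)
    also have "\<dots> = of_int (if i then c b else - c b) * tensor_value V ((\<tau>(v := s))(b := t' b)) Y
        + tensor_value V ((\<tau>(v := s))(b := [])) Y"
      using finite_chords distinct_word set_word b der[OF b]
      by (intro tensor_value_linear mult_of_int_commute) (auto simp: leg_derivative_def)
    also have "\<dots> = of_int (if i then c b else - c b) * tensor_value V (\<tau>(b := t' b, v := s)) Y"
      using b by (simp add: tensor_value_Nil fun_upd_twist)
    finally show ?thesis .
  qed
  have "tensor_value V \<tau> Y = tensor_value V (\<tau>(v := \<tau> v)) Y" by simp
  also have "\<dots> = (\<Sum>p\<in>chord_interior Y v. ?g p)"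
    unfolding Y(2)
    by (rule tensor_value_ad_interior[OF finite_chords v Y(1) v' distinct_word])
       (use set_word t in auto)
  also have "\<dots> = (\<Sum>p\<in>(V - {v}) \<times> UNIV. if p \<in> chord_interior Y v then ?g p else 0)"
    using chord_interior_subset[OF v] finite_chords by (simp add: Int_absorb1 flip:
        sum.inter_restrict)
  also have "\<dots> = (\<Sum>b\<in>V - {v}. (if (b, False) \<in> chord_interior Y v then ?g (b, False) else 0)
      + (if (b, True) \<in> chord_interior Y v then ?g (b, True) else 0))"
    by (simp add: sum.cartesian_product' UNIV_bool add.commute)
  also have "\<dots> = (\<Sum>b\<in>V - {v}. of_int (crossing_number Y v b * c b) * tensor_value V (\<tau>(b := t' b,
      v := s)) Y)"
    by (intro sum.cong) (auto simp: g crossing_number_def)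
  finally show ?thesis .
qed

end

section \<open>Path sums\<close>

fun chain_weight :: "('c \<Rightarrow> 'c \<Rightarrow> int) \<Rightarrow> 'c list \<Rightarrow> int" where
  "chain_weight J (a # b # vs) = J a b * chain_weight J (b # vs)"
| "chain_weight J vs = 1"

text \<open>Weighted paths from \<open>v\<close> to \<open>w\<close> with all of \<open>W\<close> in
  between. For \<open>w = v\<close> these are directed circuits with marked starting point
  \<open>v\<close>.\<close>

definition path_sum :: "('c \<Rightarrow> 'c \<Rightarrow> int) \<Rightarrow> 'c \<Rightarrow> 'c set \<Rightarrow> 'c \<Rightarrow> int" where
  "path_sum J v W w = (\<Sum>vs\<in>permutations_of_set W. chain_weight J (v # vs @ [w]))"

lemma path_sum_empty: "path_sum J v {} w = J v w"
  by (simp add: path_sum_def)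

lemma path_sum_nonempty:
  assumes "finite W" "W \<noteq> {}"
  shows "path_sum J v W w = (\<Sum>b\<in>W. J v b * path_sum J b (W - {b}) w)"
proof -
  have "path_sum J v W w
      = (\<Sum>b\<in>W. \<Sum>vs\<in>(#) b ` permutations_of_set (W - {b}). chain_weight J (v # vs @ [w]))"
    unfolding path_sum_def permutations_of_set_nonempty[OF assms(2)]
    using assms(1) by (intro sum.UNION_disjoint) auto
  also have "\<dots> = (\<Sum>b\<in>W. J v b * path_sum J b (W - {b}) w)"
    by (simp add: path_sum_def sum.reindex sum_distrib_left)
  finally show ?thesis .
qed

text \<open>Both sides choose a subset with a marked element, which will be the next vertex of a
  path.\<close>

lemma sum_Pow_choose:
  assumes "finite U"
  shows "(\<Sum>b\<in>U. \<Sum>W\<in>Pow (U - {b}). g b W) = (\<Sum>W\<in>Pow U - {{}}. \<Sum>b\<in>W. g b (W - {b}))"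
proof -
  have "(\<Sum>b\<in>U. \<Sum>W\<in>Pow (U - {b}). g b W) = (\<Sum>(b, W)\<in>Sigma U (\<lambda>b. Pow (U - {b})). g b W)"
    using assms by (subst sum.Sigma) auto
  also have "\<dots> = (\<Sum>(W, b)\<in>Sigma (Pow U - {{}}) (\<lambda>W. W). g b (W - {b}))"
    by (rule sum.reindex_bij_witness[of _ "\<lambda>(W, b). (b, W - {b})" "\<lambda>(b, W). (insert b W, b)"])
       (auto intro!: arg_cong[where f = "g _"])
  also have "\<dots> = (\<Sum>W\<in>Pow U - {{}}. \<Sum>b\<in>W. g b (W - {b}))"
    using assms by (subst sum.Sigma) (auto intro: finite_subset)
  finally show ?thesis .
qed

section \<open>Following a path in the Weyl algebra\<close>

locale weyl_pair =
  fixes x d :: "'u::ring_1"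
  assumes weyl: "d * x = x * d + 1"
begin

text \<open>
  The tensor \<open>l/2 * oscillator\<close> is the part of degree one in \<open>l\<close> of the invariant tensor on the Verma module
  of highest weight \<open>l\<close>, after the scalar by which the Casimir element acts has been subtracted.
\<close>

definition unit_tensor :: "('u \<times> 'u) list" where "unit_tensor = [(1, 1)]"
definition annihilator :: "('u \<times> 'u) list" where "annihilator = [(d, 1), (- 1, d)]"
definition creator :: "('u \<times> 'u) list" where "creator = [(x, 1), (- 1, x)]"
definition oscillator :: "('u \<times> 'u) list" where
  "oscillator = [(d, x), (x, d), (- (x * d), 1), (- 1, x * d), (- 1, 1)]"

lemma weyl_assoc: "d * (x * u) = x * (d * u) + u"
  using weyl by (metis distrib_right mult.assoc mult_1_left)

text \<open>The three fates of a path led by \<open>[d, -]\<close>: it dies on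
  \<open>1 \<otimes> 1\<close>, continues from an oscillator as
  \<open>d \<otimes> 1 - 1 \<otimes> d\<close>, or ends at a creator.\<close>

lemma leg_derivatives:
  "leg_derivative d unit_tensor 0 []"
  "leg_derivative d oscillator 1 annihilator"
  "leg_derivative d creator (- 1) unit_tensor"
  by (auto simp: leg_derivative_def unit_tensor_def oscillator_def annihilator_def creator_def
      sandwich_Cons map_leg_def leg_def ad_def algebra_simps weyl weyl_assoc)

lemma sandwich_annihilator: "sandwich False annihilator X = sandwich False unit_tensor (ad d X)"
  by (simp add: annihilator_def unit_tensor_def sandwich_Cons leg_def ad_def)

lemma sandwich_oscillator:
  "sandwich False oscillator X = sandwich False [(- x, 1), (1, x)] (ad d X)"
  by (simp add: oscillator_def sandwich_Cons leg_def ad_def algebra_simps weyl)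

end

locale oscillator_word = ordered_endpoint_word V Y + weyl_pair x d
  for V :: "'c set" and Y and x d :: "'u::ring_1"
begin

definition closed_value :: "'c set \<Rightarrow> 'u" where
  "closed_value U = tensor_value V (\<lambda>a. if a \<in> U then oscillator else unit_tensor) Y"

text \<open>An unfinished path: \<open>v\<close> is its head, from which \<open>[d, -]\<close> goes
  on, and \<open>w\<close> is the chord where it has to end.\<close>

definition open_value :: "'c set \<Rightarrow> 'c \<Rightarrow> 'c \<Rightarrow> 'u" where
  "open_value U v w = tensor_value V
     (\<lambda>a. if a = v then annihilator else if a = w then creator else if a \<in> U then oscillator else
         unit_tensor) Y"

abbreviation "J \<equiv> crossing_number Y"

lemma closed_value_empty [simp]: "closed_value {} = 1"
proof -
  have "PiE V (\<lambda>a. {..<Suc 0}) = {\<lambda>a\<in>V. 0}"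
    by (auto simp: PiE_iff extensional_def fun_eq_iff)
  moreover have "assigned_word (\<lambda>_. unit_tensor) (\<lambda>a\<in>V. 0) Z = 1" if "set Z \<subseteq> V \<times> UNIV" for Z
    using that by (induction Z) (auto simp: assigned_word_Cons unit_tensor_def leg_def)
  ultimately show ?thesis
    using set_word by (simp add: closed_value_def tensor_value_def unit_tensor_def)
qed

text \<open>The annihilator at \<open>v\<close> differentiates what \<open>v\<close> encloses.
  Reaching \<open>w\<close> ends the path, with the factor \<open>-1\<close> of the creator in
  \<open>leg_derivatives\<close>; reaching \<open>b\<close> in \<open>U\<close> moves the head to
  \<open>b\<close>.\<close>

lemma open_value_rec:
  assumes "v \<in> V" "w \<in> V" "v \<noteq> w" "U \<subseteq> V" "v \<notin> U" "w \<notin> U"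
  shows "open_value U v w
    = of_int (- J v w) * closed_value U + (\<Sum>b\<in>U. of_int (J v b) * open_value (U - {b}) b w)"
proof -
  let ?\<tau> = "\<lambda>a. if a = v then annihilator else if a = w then creator else if a \<in> U then oscillator
      else unit_tensor"
  define c where "c a = (if a = w then - 1 else if a \<in> U then 1 else (0 :: int))" for a
  define t where "t a = (if a = w then unit_tensor else if a \<in> U then annihilator else [])" for a
  let ?g = "\<lambda>b. of_int (J v b * c b) * tensor_value V (?\<tau>(b := t b, v := unit_tensor)) Y"
  have fin: "finite U" using assms finite_chords finite_subset by blast
  have "open_value U v w = (\<Sum>b\<in>V - {v}. ?g b)"
    unfolding open_value_def
  proof (rule tensor_value_leg_derivative[OF assms(1)])
    show "leg_derivative d (?\<tau> b) (c b) (t b)" if "b \<in> V - {v}" for b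
      using that leg_derivatives by (auto simp: c_def t_def)
  qed (simp add: sandwich_annihilator)
  also have "\<dots> = (\<Sum>b\<in>insert w U. ?g b)"
    using assms finite_chords by (intro sum.mono_neutral_right) (auto simp: c_def)
  also have "\<dots> = ?g w + (\<Sum>b\<in>U. ?g b)"
    using assms fin by simp
  also have "?\<tau>(w := t w, v := unit_tensor) = (\<lambda>a. if a \<in> U then oscillator else unit_tensor)"
    using assms by (auto simp: fun_eq_iff t_def)
  also have "of_int (J v w * c w) * tensor_value V (\<lambda>a. if a \<in> U then oscillator else unit_tensor) Y
      = of_int (- J v w) * closed_value U"
    by (simp add: c_def closed_value_def)
  also have "(\<Sum>b\<in>U. ?g b) = (\<Sum>b\<in>U. of_int (J v b) * open_value (U - {b}) b w)"
  proof (rule sum.cong)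
    fix b assume b: "b \<in> U"
    have "?\<tau>(b := t b, v := unit_tensor)
        = (\<lambda>a. if a = b then annihilator else if a = w then creator
             else if a \<in> U - {b} then oscillator else unit_tensor)"
      using assms b by (auto simp: fun_eq_iff t_def)
    then show "?g b = of_int (J v b) * open_value (U - {b}) b w"
      using b assms by (simp add: open_value_def c_def) (auto simp: c_def)
  qed simp
  finally show ?thesis .
qed

lemma closed_value_rec:
  assumes "v \<in> V" "U \<subseteq> V" "v \<notin> U"
  shows "closed_value (insert v U) = - (\<Sum>b\<in>U. of_int (J v b) * open_value (U - {b}) b v)"
proof -
  let ?\<tau> = "\<lambda>a. if a \<in> insert v U then oscillator else unit_tensor"
  \<comment> \<open>What remains at \<open>v\<close> once \<open>[d, -]\<close> has left it. It is
    minus a creator, which makes \<open>v\<close> the target of its own path.\<close>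
  let ?s = "[(- x, 1), (1, x)]"
  define c where "c a = (if a \<in> U then 1 else (0 :: int))" for a
  define t where "t a = (if a \<in> U then annihilator else [])" for a
  let ?g = "\<lambda>b. of_int (J v b * c b) * tensor_value V (?\<tau>(b := t b, v := ?s)) Y"
  have fin: "finite U" using assms finite_chords finite_subset by blast
  have "closed_value (insert v U) = (\<Sum>b\<in>V - {v}. ?g b)"
    unfolding closed_value_def
  proof (rule tensor_value_leg_derivative[OF assms(1)])
    show "leg_derivative d (?\<tau> b) (c b) (t b)" if "b \<in> V - {v}" for b
      using that leg_derivatives by (auto simp: c_def t_def)
  qed (simp add: sandwich_oscillator)
  also have "\<dots> = (\<Sum>b\<in>U. ?g b)"
    using assms finite_chords by (intro sum.mono_neutral_right) (auto simp: c_def)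
  also have "\<dots> = (\<Sum>b\<in>U. - (of_int (J v b) * open_value (U - {b}) b v))"
  proof (rule sum.cong)
    fix b assume b: "b \<in> U"
    then have bv: "b \<noteq> v" using assms by auto
    have "tensor_value V (?\<tau>(b := t b, v := ?s)) Y
        = - 1 * tensor_value V (?\<tau>(b := t b, v := creator)) Y + tensor_value V (?\<tau>(b := t b, v :=
            [])) Y"
      using finite_chords distinct_word set_word assms(1)
      by (intro tensor_value_linear) (auto simp: creator_def sandwich_Cons leg_def)
    also have "\<dots> = - tensor_value V (?\<tau>(b := t b, v := creator)) Y"
      using assms(1) by (simp add: tensor_value_Nil)
    also have "?\<tau>(b := t b, v := creator)
        = (\<lambda>a. if a = b then annihilator else if a = v then creator
             else if a \<in> U - {b} then oscillator else unit_tensor)"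
      using assms b bv by (auto simp: fun_eq_iff t_def)
    finally have "tensor_value V (?\<tau>(b := t b, v := ?s)) Y = - open_value (U - {b}) b v"
      unfolding open_value_def .
    then show "?g b = - (of_int (J v b) * open_value (U - {b}) b v)"
      using b by (simp only: c_def if_True mult_1_right mult_minus_right)
  qed simp
  finally show ?thesis by (simp add: sum_negf)
qed

lemma path_sum_step:
  assumes "finite U"
  shows "(\<Sum>b\<in>U. of_int (J v b) *
      (\<Sum>W\<in>Pow (U - {b}). of_int (path_sum J b W w) * closed_value (U - {b} - W)))
    = (\<Sum>W\<in>Pow U - {{}}. of_int (path_sum J v W w) * closed_value (U - W))"
  unfolding sum_distrib_left sum_Pow_choose[OF assms]
proof (rule sum.cong)
  fix W assume W: "W \<in> Pow U - {{}}"
  then have "U - {b} - (W - {b}) = U - W" if "b \<in> W" for b using that by auto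
  moreover have "finite W" using W assms finite_subset by auto
  ultimately show "(\<Sum>b\<in>W. of_int (J v b) *
      (of_int (path_sum J b (W - {b}) w) * closed_value (U - {b} - (W - {b}))))
    = of_int (path_sum J v W w) * closed_value (U - W)"
    using W by (simp add: path_sum_nonempty sum_distrib_right mult.assoc)
qed simp

text \<open>Iterates \<open>open_value_rec\<close>, with the head changing along the way. The
  oscillators off the path survive in \<open>closed_value (U - W)\<close>, and the overall sign
  comes from the end of the path.\<close>

lemma open_value_eq:
  assumes "v \<in> V" "w \<in> V" "v \<noteq> w" "U \<subseteq> V" "v \<notin> U" "w \<notin> U"
  shows "open_value U v w = - (\<Sum>W\<in>Pow U. of_int (path_sum J v W w) * closed_value (U - W))"
  using assms
proof (induction "card U" arbitrary: U v rule: less_induct)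
  case less
  have fin: "finite U" using less finite_chords finite_subset by blast
  let ?p = "\<lambda>v W. of_int (path_sum J v W w) :: 'u"
  have "open_value (U - {b}) b w = - (\<Sum>W\<in>Pow (U - {b}). ?p b W * closed_value (U - {b} - W))"
    if b: "b \<in> U" for b
    using less.prems b card_Diff1_less[OF fin b] by (intro less.hyps) auto
  then have "(\<Sum>b\<in>U. of_int (J v b) * open_value (U - {b}) b w)
      = - (\<Sum>W\<in>Pow U - {{}}. ?p v W * closed_value (U - W))"
    by (simp add: sum_negf flip: path_sum_step[OF fin])
  also have "- (\<Sum>W\<in>Pow U - {{}}. ?p v W * closed_value (U - W))
      = ?p v {} * closed_value U - (\<Sum>W\<in>Pow U. ?p v W * closed_value (U - W))"
    using fin by (subst sum.remove[of "Pow U" "{}"]) auto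
  finally show ?case
    using open_value_rec[OF less.prems] by (simp add: path_sum_empty)
qed

text \<open>The sign of the open path cancels that of the starting chord, and the empty path
  contributes nothing as \<open>J v v = 0\<close>. The result is the recursion that characterises
  the logarithmic derivative.\<close>

lemma closed_value_insert:
  assumes "v \<in> V" "U \<subseteq> V" "v \<notin> U"
  shows "closed_value (insert v U) = (\<Sum>W\<in>Pow U. of_int (path_sum J v W v) * closed_value (U - W))"
proof -
  have fin: "finite U" using assms finite_chords finite_subset by blast
  let ?p = "\<lambda>v' W. of_int (path_sum J v' W v) :: 'u"
  have "open_value (U - {b}) b v = - (\<Sum>W\<in>Pow (U - {b}). ?p b W * closed_value (U - {b} - W))"
    if b: "b \<in> U" for b
    using assms b by (intro open_value_eq) auto
  then have "closed_value (insert v U) = (\<Sum>W\<in>Pow U - {{}}. ?p v W * closed_value (U - W))"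
    unfolding closed_value_rec[OF assms] by (simp add: sum_negf flip: path_sum_step[OF fin])
  also have "\<dots> = (\<Sum>W\<in>Pow U. ?p v W * closed_value (U - W))"
    using fin assms(1) by (intro sum.mono_neutral_left) (auto simp: path_sum_empty)
  finally show ?thesis .
qed

end

section \<open>Circuits in the intersection graph\<close>

definition first_pos :: "'c list \<Rightarrow> 'c \<Rightarrow> nat" where
  "first_pos D a = Min {k. k < length D \<and> D ! k = a}"

definition last_pos :: "'c list \<Rightarrow> 'c \<Rightarrow> nat" where
  "last_pos D a = Max {k. k < length D \<and> D ! k = a}"

lemma positions:
  assumes "chord_diagram D" "a \<in> set D"
  shows "first_pos D a < last_pos D a" "last_pos D a < length D"
    "{k. k < length D \<and> D ! k = a} = {first_pos D a, last_pos D a}"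
proof -
  obtain p q where pq: "p < q" "q < length D" "{k. k < length D \<and> D ! k = a} = {p, q}"
    using chord_diagram_positions assms by metis
  then have "first_pos D a = p" "last_pos D a = q" by (auto simp: first_pos_def last_pos_def)
  with pq show "first_pos D a < last_pos D a" "last_pos D a < length D"
    "{k. k < length D \<and> D ! k = a} = {first_pos D a, last_pos D a}" by auto
qed

lemma ordered_endpoints:
  assumes "chord_diagram D"
  shows "ordered_endpoint_word (set D) (endpoints D)"
proof
  fix v assume v: "v \<in> set D"
  let ?p = "first_pos D v" and ?q = "last_pos D v" and ?Y = "endpoints D"
  note pos = positions[OF assms v] and at = endpoints_at_positions[OF positions[OF assms v]]
  have "?Y = take ?p ?Y @ ?Y ! ?p # drop (Suc ?p) ?Y"
    using pos by (intro id_take_nth_drop) simp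
  moreover have "drop (Suc ?p) ?Y ! (?q - Suc ?p) = (v, True)" "?q - Suc ?p < length (drop (Suc ?p)
      ?Y)"
    using pos at by auto
  then have "(v, True) \<in> set (drop (Suc ?p) ?Y)" by (metis nth_mem)
  then obtain Y1 Y2 where "drop (Suc ?p) ?Y = Y1 @ (v, True) # Y2" by (meson split_list)
  ultimately show "\<exists>Y0 Y1 Y2. ?Y = Y0 @ (v, False) # Y1 @ (v, True) # Y2"
    using at by metis
qed (use assms in \<open>simp_all add: distinct_endpoints set_endpoints\<close>)

lemma chord_interior_endpoints:
  assumes D: "chord_diagram D" and v: "v \<in> set D"
  shows "chord_interior (endpoints D) v
    = {endpoints D ! k |k. first_pos D v < k \<and> k < last_pos D v}"
proof -
  interpret ordered_endpoint_word "set D" "endpoints D" by (rule ordered_endpoints[OF D])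
  let ?Y = "endpoints D"
  obtain Y0 Y1 Y2 where Y: "?Y = Y0 @ (v, False) # Y1 @ (v, True) # Y2" "chord_interior ?Y v
      = set Y1"
    using chord_decomposition[OF v] by metis
  note pos = positions[OF D v] and at = endpoints_at_positions[OF positions[OF D v]]
  have nth: "?Y ! length Y0 = (v, False)" "?Y ! (length Y0 + Suc (length Y1)) = (v, True)"
    and len: "length Y0 + Suc (length Y1) < length ?Y"
    unfolding Y by (simp_all add: nth_append)
  have p: "first_pos D v = length Y0"
    using nth(1) at(1) pos len nth_eq_iff_index_eq[OF distinct_word, of "first_pos D v" "length
        Y0"] by simp
  have q: "last_pos D v = length Y0 + Suc (length Y1)"
    using nth(2) at(2) pos len
      nth_eq_iff_index_eq[OF distinct_word, of "last_pos D v" "length Y0 + Suc (length Y1)"] by simp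
  have "Y1 ! j = ?Y ! (length Y0 + Suc j)" if "j < length Y1" for j
    unfolding Y using that by (simp add: nth_append)
  then have Y1: "?Y ! k = Y1 ! (k - Suc (length Y0))" if "length Y0 < k" "k < length Y0
      + Suc (length Y1)" for k
    using that by simp
  have "x \<in> set Y1 \<longleftrightarrow> (\<exists>k. x = ?Y ! k \<and> first_pos D v < k \<and> k < last_pos D v)" for x
  proof
    assume "x \<in> set Y1"
    then obtain j where "j < length Y1" "x = Y1 ! j" by (metis in_set_conv_nth)
    then show "\<exists>k. x = ?Y ! k \<and> first_pos D v < k \<and> k < last_pos D v"
      using Y1[of "length Y0 + Suc j"] by (intro exI[of _ "length Y0 + Suc j"]) (simp add: p q)
  next
    assume "\<exists>k. x = ?Y ! k \<and> first_pos D v < k \<and> k < last_pos D v"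
    then obtain k where k: "x = ?Y ! k" "length Y0 < k" "k < length Y0 + Suc (length Y1)"
      by (auto simp: p q)
    then have "k - Suc (length Y0) < length Y1" by simp
    then show "x \<in> set Y1" using Y1[OF k(2,3)] k(1) by simp
  qed
  then show ?thesis using Y by auto
qed

lemma crossing_number_endpoints:
  assumes D: "chord_diagram D" and "a \<in> set D" "b \<in> set D"
  shows "crossing_number (endpoints D) a b
    = of_bool (first_pos D a < last_pos D b \<and> last_pos D b < last_pos D a)
      - of_bool (first_pos D a < first_pos D b \<and> first_pos D b < last_pos D a)"
proof -
  note pos = positions[OF D assms(2)] positions[OF D assms(3)]
  note at = endpoints_at_positions[OF pos(4-6)]
  have "endpoints D ! k = endpoints D ! l \<longleftrightarrow> k = l" if "k < length D" "l < length D" for k l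
    using nth_eq_iff_index_eq[OF distinct_endpoints[OF D]] that by simp
  then have *: "endpoints D ! l \<in> chord_interior (endpoints D) a \<longleftrightarrow> first_pos D a < l \<and> l < last_pos
      D a"
    if "l < length D" for l
    unfolding chord_interior_endpoints[OF D assms(2)] using that pos(2) by force
  have "last_pos D b < length D" "first_pos D b < length D" using pos by auto
  from *[OF this(1)] *[OF this(2)] show ?thesis
    by (simp add: crossing_number_def at)
qed

lemma restrict_chords_sorted:
  assumes "sorted_wrt (<) ks" "set ks = {k. k < length D \<and> D ! k \<in> U}"
  shows "restrict_chords D U = map ((!) D) ks"
proof -
  have "restrict_chords D U = map ((!) D) (filter (\<lambda>k. D ! k \<in> U) [0..<length D])"
    using filter_map[of "\<lambda>a. a \<in> U" "(!) D" "[0..<length D]"]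
    by (simp add: restrict_chords_def map_nth comp_def)
  moreover have "filter (\<lambda>k. D ! k \<in> U) [0..<length D] = ks"
    by (rule strict_sorted_equal[OF assms(1)]) (simp_all add: sorted_wrt_filter assms(2))
  ultimately show ?thesis by simp
qed

lemma nth_positions:
  assumes "chord_diagram D" "a \<in> set D"
  shows "D ! first_pos D a = a" "D ! last_pos D a = a"
proof -
  have "first_pos D a \<in> {k. k < length D \<and> D ! k = a}" "last_pos D a \<in> {k. k < length D \<and> D ! k
      = a}"
    unfolding positions(3)[OF assms] by simp_all
  then show "D ! first_pos D a = a" "D ! last_pos D a = a" by simp_all
qed

lemma positions_distinct:
  assumes D: "chord_diagram D" and "a \<in> set D" "b \<in> set D" "a \<noteq> b"
  shows "first_pos D a \<noteq> first_pos D b" "first_pos D a \<noteq> last_pos D b"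
    "last_pos D a \<noteq> first_pos D b" "last_pos D a \<noteq> last_pos D b"
  using nth_positions[OF D assms(2)] nth_positions[OF D assms(3)] assms(4) by metis+

lemma intersecting_iff:
  assumes D: "chord_diagram D" and ab: "a \<in> set D" "b \<in> set D" "a \<noteq> b"
  shows "intersecting D a b \<longleftrightarrow>
    first_pos D a < first_pos D b \<and> first_pos D b < last_pos D a \<and> last_pos D a < last_pos D b \<or>
    first_pos D b < first_pos D a \<and> first_pos D a < last_pos D b \<and> last_pos D b < last_pos D a"
proof -
  let ?p = "first_pos D a" and ?q = "last_pos D a" and ?r = "first_pos D b" and ?s = "last_pos D b"
  note pos = positions[OF D ab(1)] positions[OF D ab(2)] and ne = positions_distinct[OF D ab]
    and nth = nth_positions[OF D ab(1)] nth_positions[OF D ab(2)]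
  have "{k. k < length D \<and> D ! k \<in> {a, b}} = {k. k < length D \<and> D ! k = a} \<union> {k. k < length D \<and> D !
      k = b}"
    by auto
  also have "\<dots> = {?p, ?q, ?r, ?s}" using pos(3,6) by auto
  finally have word: "restrict_chords D {a, b} = map ((!) D) ks"
    if "sorted_wrt (<) ks" "set ks = {?p, ?q, ?r, ?s}" for ks
    using that by (intro restrict_chords_sorted) simp_all
  consider "?p < ?r" "?r < ?q" "?q < ?s" | "?r < ?p" "?p < ?s" "?s < ?q" | "?p < ?r" "?s < ?q"
    | "?r < ?p" "?q < ?s" | "?q < ?r" | "?s < ?p"
    using ne by linarith
  then show ?thesis
  proof cases
    case 1
    then have "restrict_chords D {a, b} = map ((!) D) [?p, ?r, ?q, ?s]" by (intro word) auto
    then show ?thesis using 1 ab nth by (simp add: intersecting_def)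
  next
    case 2
    then have "restrict_chords D {a, b} = map ((!) D) [?r, ?p, ?s, ?q]" by (intro word) auto
    then show ?thesis using 2 ab nth by (simp add: intersecting_def)
  next
    case 3
    then have "restrict_chords D {a, b} = map ((!) D) [?p, ?r, ?s, ?q]" using pos
        by (intro word) auto
    then show ?thesis using 3 ab nth by (simp add: intersecting_def)
  next
    case 4
    then have "restrict_chords D {a, b} = map ((!) D) [?r, ?p, ?q, ?s]" using pos
        by (intro word) auto
    then show ?thesis using 4 ab nth by (simp add: intersecting_def)
  next
    case 5
    then have "restrict_chords D {a, b} = map ((!) D) [?p, ?q, ?r, ?s]" using pos
        by (intro word) auto
    then show ?thesis using 5 ab nth pos by (auto simp: intersecting_def)
  next
    case 6
    then have "restrict_chords D {a, b} = map ((!) D) [?r, ?s, ?p, ?q]" using pos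
        by (intro word) auto
    then show ?thesis using 6 ab nth pos by (auto simp: intersecting_def)
  qed
qed

lemma crossing_number_skew:
  assumes "chord_diagram D" "a \<in> set D" "b \<in> set D"
  shows "crossing_number (endpoints D) b a = - crossing_number (endpoints D) a b"
proof (cases "a = b")
  case False
  then show ?thesis
    using positions(1)[OF assms(1,2)] positions(1)[OF assms(1,3)] positions_distinct[OF assms False]
    unfolding crossing_number_endpoints[OF assms] crossing_number_endpoints[OF assms(1,3,2)]
        of_bool_def
    by auto
qed (use crossing_number_endpoints[OF assms] in auto)

lemma crossing_number_eq_0_iff:
  assumes "chord_diagram D" "a \<in> set D" "b \<in> set D"
  shows "crossing_number (endpoints D) a b = 0 \<longleftrightarrow> \<not> intersecting D a b"
proof (cases "a = b")
  case False
  then show ?thesis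
    using positions(1)[OF assms(1,2)] positions(1)[OF assms(1,3)] positions_distinct[OF assms False]
    unfolding crossing_number_endpoints[OF assms] intersecting_iff[OF assms False] of_bool_def
    by auto
qed (use crossing_number_endpoints[OF assms] in \<open>auto simp: intersecting_def\<close>)

text \<open>Compares the chosen tails with those at the first endpoints: reversing a chord reverses
  every edge at it.\<close>

definition tail_sign :: "'c list \<Rightarrow> ('c \<Rightarrow> nat) \<Rightarrow> 'c \<Rightarrow> int" where
  "tail_sign D t a = (if t a = first_pos D a then 1 else - 1)"

lemma chord_head_eq:
  assumes D: "chord_diagram D" and t: "chord_orientation D t" and a: "a \<in> set D"
  shows "t a = first_pos D a \<and> chord_head D t a = last_pos D a
    \<or> t a = last_pos D a \<and> chord_head D t a = first_pos D a"
proof -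
  note pos = positions[OF D a]
  have "t a < length D" "D ! t a = a" using t a by (auto simp: chord_orientation_def)
  then have "t a \<in> {first_pos D a, last_pos D a}" using pos(3) by blast
  moreover have "p < length D \<and> D ! p = a \<and> p \<noteq> t a \<longleftrightarrow> p \<in> {first_pos D a, last_pos D a}
      - {t a}" for p
    using pos(3) by blast
  then have "chord_head D t a = (THE p. p \<in> {first_pos D a, last_pos D a} - {t a})"
    by (simp add: chord_head_def)
  ultimately consider "t a = first_pos D a" "chord_head D t a = (THE p. p \<in> {last_pos D a})"
    | "t a = last_pos D a" "chord_head D t a = (THE p. p \<in> {first_pos D a})"
    using pos(1) by fastforce
  then show ?thesis by cases simp_all
qed

text \<open>With both tails at the first endpoints the edge sign is minus the crossing number.
  Reversing either chord exchanges the two sides of its arc or the end of the other chord that is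
  tested, and flips the sign.\<close>

lemma edge_sign:
  assumes D: "chord_diagram D" and t: "chord_orientation D t" and ab: "intersecting D a b"
    and mem: "a \<in> set D" "b \<in> set D"
  shows "(if edge_from_to D t a b then 1 else - 1)
    = tail_sign D t a * tail_sign D t b * - crossing_number (endpoints D) a b"
proof -
  have ne: "a \<noteq> b" using ab by (simp add: intersecting_def)
  note pos = positions[OF D mem(1)] positions[OF D mem(2)]
  show ?thesis
    using ab chord_head_eq[OF D t mem(1)] chord_head_eq[OF D t mem(2)] pos(1,2,4,5)
    unfolding intersecting_iff[OF D mem ne] crossing_number_endpoints[OF D mem] edge_from_to_def
      ccw_arc_def tail_sign_def
    by (elim disjE conjE) (simp_all add: of_bool_def)
qed

section \<open>Products around a circuit\<close>

definition cyclic_weight :: "('c \<Rightarrow> 'c \<Rightarrow> int) \<Rightarrow> 'c list \<Rightarrow> int" where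
  "cyclic_weight J vs = (\<Prod>i<length vs. J (vs ! i) (vs ! (Suc i mod length vs)))"

lemma prod_lessThan_rotate:
  fixes f :: "nat \<Rightarrow> int"
  shows "(\<Prod>i<n. f ((r + i) mod n)) = (\<Prod>i<n. f i)"
proof (cases "n = 0")
  case False
  have "inj_on (\<lambda>i. (r + i) mod n) {..<n}"
  proof (rule inj_onI)
    fix i j assume ij: "i \<in> {..<n}" "j \<in> {..<n}" "(r + i) mod n = (r + j) mod n"
    have *: "k = l" if "k \<le> l" "l < n" "(r + k) mod n = (r + l) mod n" for k l
    proof -
      have "n dvd l - k" using that mod_eq_dvd_iff_nat[of "r + k" "r + l" n] by simp
      then show ?thesis using that by (auto dest: dvd_imp_le)
    qed
    show "i = j"
    proof (cases "i \<le> j")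
      case True
      then show ?thesis using *[of i j] ij by simp
    next
      case False
      then have "j = i" using *[of j i] ij by simp
      then show ?thesis ..
    qed
  qed
  moreover have "(\<lambda>i. (r + i) mod n) ` {..<n} \<subseteq> {..<n}" using False by auto
  ultimately have "bij_betw (\<lambda>i. (r + i) mod n) {..<n} {..<n}"
    by (simp add: bij_betw_def endo_inj_surj)
  then show ?thesis by (rule prod.reindex_bij_betw)
qed simp

lemma cyclic_weight_rotate: "cyclic_weight J (rotate r vs) = cyclic_weight J vs"
proof -
  let ?n = "length vs" and ?f = "\<lambda>i. J (vs ! i) (vs ! (Suc i mod length vs))"
  have "cyclic_weight J (rotate r vs) = (\<Prod>i<?n. ?f ((r + i) mod ?n))"
    unfolding cyclic_weight_def length_rotate
  proof (rule prod.cong)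
    fix i assume "i \<in> {..<?n}"
    then have i: "i < ?n" by simp
    then have "0 < ?n" by linarith
    then have i': "Suc i mod ?n < ?n" by simp
    have "(r + Suc i mod ?n) mod ?n = Suc ((r + i) mod ?n) mod ?n"
      by (metis add_Suc_right mod_Suc_eq mod_add_right_eq)
    then show "J (rotate r vs ! i) (rotate r vs ! (Suc i mod ?n)) = ?f ((r + i) mod ?n)"
      using i i' by (simp add: nth_rotate)
  qed simp
  also have "\<dots> = cyclic_weight J vs"
    unfolding cyclic_weight_def by (rule prod_lessThan_rotate)
  finally show ?thesis .
qed

text \<open>Reversal traverses every edge backwards; the signs cancel because their number is
  even.\<close>

lemma cyclic_weight_rev:
  assumes skew: "\<And>a b. a \<in> set vs \<Longrightarrow> b \<in> set vs \<Longrightarrow> J b a = - J a b" and even: "even (length vs)"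
  shows "cyclic_weight J (rev vs) = cyclic_weight J vs"
proof -
  let ?n = "length vs" and ?f = "\<lambda>i. J (vs ! i) (vs ! (Suc i mod length vs))"
  \<comment> \<open>Edge \<open>i\<close> of the reversed list is edge \<open>n - 2 - i\<close> of
    the original, and the closing edge stays last. Written as a reflection followed by a shift by
    \<open>n - 1\<close> modulo \<open>n\<close>, it can be removed by two reindexings.\<close>
  have "cyclic_weight J (rev vs) = (\<Prod>i<?n. - ?f ((?n - 1 + (?n - Suc i)) mod ?n))"
    unfolding cyclic_weight_def length_rev
  proof (rule prod.cong)
    fix i assume "i \<in> {..<?n}"
    then have i: "i < ?n" by auto
    show "J (rev vs ! i) (rev vs ! (Suc i mod ?n)) = - ?f ((?n - 1 + (?n - Suc i)) mod ?n)"
    proof (cases "Suc i = ?n")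
      case True
      then have "?n - Suc i = 0" "(?n - 1) mod ?n = ?n - 1" "Suc (?n - 1) mod ?n = 0" "Suc i mod ?n
          = 0"
        by (simp_all flip: True)
      moreover have "rev vs ! i = vs ! 0" "rev vs ! 0 = vs ! (?n - 1)"
        using i True rev_nth[of i vs] rev_nth[of 0 vs] by fastforce+
      moreover have "vs ! 0 \<in> set vs" "vs ! (?n - 1) \<in> set vs" using i by (auto intro!: nth_mem)
      ultimately show ?thesis using skew[of "vs ! (?n - 1)" "vs ! 0"] by simp
    next
      case False
      then have "?n - 1 + (?n - Suc i) = ?n + (?n - Suc (Suc i))" using i by simp
      then have 1: "(?n - 1 + (?n - Suc i)) mod ?n = ?n - Suc (Suc i)"
        using i False by (metis diff_less gr_implies_not0 mod_add_self1 mod_less not_gr0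
            zero_less_Suc)
      have 2: "Suc (?n - Suc (Suc i)) mod ?n = ?n - Suc i" "Suc i mod ?n = Suc i" using i False
          by auto
      show ?thesis
        unfolding 1 2 using i False skew[of "vs ! (?n - Suc (Suc i))" "vs ! (?n - Suc i)"]
        by (simp add: rev_nth)
    qed
  qed simp
  also have "\<dots> = (\<Prod>i<?n. ?f ((?n - 1 + (?n - Suc i)) mod ?n))"
    using even by (simp add: prod_uminus)
  also have "\<dots> = (\<Prod>i<?n. ?f ((?n - 1 + i) mod ?n))"
    by (rule prod.nat_diff_reindex)
  also have "\<dots> = cyclic_weight J vs"
    unfolding cyclic_weight_def by (rule prod_lessThan_rotate)
  finally show ?thesis .
qed

lemma chain_weight_cyclic:
  "chain_weight J (v # us @ [v]) = cyclic_weight J (v # us)"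
proof -
  have chain: "chain_weight J (ws @ [w]) = (\<Prod>i<length ws. J ((ws @ [w]) ! i) ((ws @ [w]) ! Suc i))"
    for ws w
  proof (induction ws)
    case (Cons a ws)
    then show ?case
      by (cases ws) (simp_all add: prod.lessThan_Suc_shift del: prod.lessThan_Suc)
  qed simp
  show ?thesis
    using chain[of "v # us" v] unfolding cyclic_weight_def append_Cons
  proof (elim trans, intro prod.cong refl)
    fix i assume "i \<in> {..<length (v # us)}"
    then have i: "i < Suc (length us)" by simp
    show "J ((v # us @ [v]) ! i) ((v # us @ [v]) ! Suc i)
        = J ((v # us) ! i) ((v # us) ! (Suc i mod length (v # us)))"
    proof (cases "i = length us")
      case True
      then have "Suc i mod length (v # us) = 0" by simp
      then show ?thesis using True nth_append[of "v # us" "[v]" i] nth_append[of us "[v]" i] by simp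
    next
      case False
      then have "Suc i mod length (v # us) = Suc i" using i by simp
      then show ?thesis
        using False i nth_append[of "v # us" "[v]" i] nth_append[of us "[v]" i] by simp
    qed
  qed
qed

lemma sum_path_sum_eq:
  assumes "finite V" "V \<noteq> {}"
  shows "(\<Sum>v\<in>V. path_sum J v (V - {v}) v) = (\<Sum>vs\<in>permutations_of_set V. cyclic_weight J vs)"
proof -
  have "(\<Sum>vs\<in>permutations_of_set V. cyclic_weight J vs)
      = (\<Sum>v\<in>V. \<Sum>vs\<in>(#) v ` permutations_of_set (V - {v}). cyclic_weight J vs)"
    unfolding permutations_of_set_nonempty[OF assms(2)]
    using assms(1) by (intro sum.UNION_disjoint) auto
  then show ?thesis
    by (simp add: sum.reindex path_sum_def chain_weight_cyclic)
qed

section \<open>Un-oriented circuits as classes of lists\<close>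

lemma self_in_circuit_class: "vs \<in> circuit_class vs"
  by (force simp: circuit_class_def intro: exI[of _ 0])

lemma rotate_inverse: "\<exists>j. rotate j (rotate i vs) = vs"
proof (cases "vs = []")
  case False
  have "rotate (length vs - i mod length vs) (rotate i vs) = rotate (length vs
      - i mod length vs) (rotate (i mod length vs) vs)"
    by (metis rotate_conv_mod)
  also have "\<dots> = rotate (length vs - i mod length vs + i mod length vs) vs"
    by (rule rotate_rotate)
  also have "\<dots> = rotate (length vs) vs"
    using False by simp
  finally show ?thesis using rotate_id[of "length vs" vs] by auto
qed simp

lemma rev_rotate: "\<exists>j. rev (rotate i vs) = rotate j (rev vs)"
proof -
  obtain j where j: "rotate j (rotate i vs) = vs" using rotate_inverse by blast
  have "\<exists>k. rotate k (rev ws) = rev (rotate j ws)" for ws :: "'a list"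
  proof (cases "ws = []")
    case False
    have "rotate (length ws - j mod length ws) (rev ws)
        = rev (rotate (length ws - (length ws - j mod length ws) mod length ws) ws)"
      by (rule rotate_rev)
    also have "rotate (length ws - (length ws - j mod length ws) mod length ws) ws = rotate j ws"
    proof (cases "j mod length ws = 0")
      case True
      then show ?thesis by (metis diff_zero mod_self rotate_conv_mod rotate_id)
    next
      case nz: False
      have "j mod length ws < length ws" using False by simp
      then have "length ws - (length ws - j mod length ws) mod length ws = j mod length ws"
        using nz by simp
      then show ?thesis by (metis rotate_conv_mod)
    qed
    finally show ?thesis by blast
  qed simp
  from this[of "rotate i vs"] obtain k where k: "rotate k (rev (rotate i vs))
      = rev (rotate j (rotate i vs))" ..
  then have "rotate k (rev (rotate i vs)) = rev vs" using j by simp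
  then show ?thesis by (metis rotate_inverse)
qed

lemma circuit_class_eq:
  assumes "ws \<in> circuit_class vs"
  shows "circuit_class ws = circuit_class vs"
proof -
  have sub: "circuit_class ws \<subseteq> circuit_class vs" if ws: "ws \<in> circuit_class vs" for ws vs :: "'a
      list"
  proof -
    have rot: "rotate j us \<in> circuit_class vs" if "us \<in> circuit_class vs" for j us
      using that unfolding circuit_class_def mem_Collect_eq by (metis rotate_rotate)
    have "rev ws \<in> circuit_class vs"
      using ws rev_rotate[of _ vs] rev_rotate[of _ "rev vs"]
      unfolding circuit_class_def mem_Collect_eq by (metis rev_rev_ident)
    then show ?thesis
      using rot ws unfolding circuit_class_def[of ws] by auto
  qed
  have "vs \<in> circuit_class ws"
  proof -
    obtain i us where us: "ws = rotate i us" "us = vs \<or> us = rev vs"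
      using assms by (auto simp: circuit_class_def)
    obtain j where j: "us = rotate j ws" using rotate_inverse[of i us] us by metis
    then have "us \<in> circuit_class ws" by (auto simp: circuit_class_def)
    moreover have "rev us \<in> circuit_class ws"
      using rev_rotate[of j ws] by (auto simp: circuit_class_def j)
    ultimately show ?thesis using us(2) by auto
  qed
  then show ?thesis using sub assms by blast
qed

lemma card_circuit_class:
  assumes "distinct vs" "length vs = n" "n \<ge> 3"
  shows "card (circuit_class vs) = 2 * n"
proof -
  let ?A = "(\<lambda>i. rotate i vs) ` {..<n}" and ?B = "(\<lambda>i. rotate i (rev vs)) ` {..<n}"
  have mod: "\<exists>j<n. rotate i ws = rotate j ws" if "length ws = n" for i and ws :: "'a list"
    using that assms(3) by (intro exI[of _ "i mod n"]) (auto simp: rotate_conv_mod[of i])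
  have "circuit_class vs = ?A \<union> ?B"
    using mod[of vs] mod[of "rev vs"] assms(2) by (fastforce simp: circuit_class_def)
  moreover have inj: "inj_on (\<lambda>i. rotate i ws) {..<n}" if "distinct ws" "length ws
      = n" for ws :: "'a list"
  proof (rule inj_onI)
    fix i j assume ij: "i \<in> {..<n}" "j \<in> {..<n}" "rotate i ws = rotate j ws"
    have "ws ! i = rotate i ws ! 0" "ws ! j = rotate j ws ! 0"
      using ij(1,2) that by (simp_all add: nth_rotate)
    then have "ws ! i = ws ! j" using ij(3) by metis
    then show "i = j" using ij(1,2) that by (simp add: nth_eq_iff_index_eq)
  qed
  \<comment> \<open>Two consecutive entries tell the directions apart: a rotation of
    \<open>vs\<close> steps forward through the indices and a rotation of \<open>rev vs\<close>
    backward, and modulo \<open>n \<ge> 3\<close> these steps differ.\<close>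
  moreover have "?A \<inter> ?B = {}"
  proof -
    have False if ij: "i < n" "j < n" "rotate i vs = rotate j (rev vs)" for i j
    proof -
      have less: "Suc i mod n < n" "Suc j mod n < n" using assms(3) by simp_all
      have nth: "rotate i vs ! k = vs ! ((i + k) mod n)"
        "rotate j (rev vs) ! k = vs ! (n - Suc ((j + k) mod n))" if "k < n" for k
        using that assms(2) by (simp_all add: nth_rotate rev_nth)
      have "vs ! i = vs ! (n - Suc j)" "vs ! (Suc i mod n) = vs ! (n - Suc (Suc j mod n))"
        using nth[of 0] nth[of 1] ij assms(3) by simp_all
      then have eq: "i = n - Suc j" "Suc i mod n = n - Suc (Suc j mod n)"
        using ij(1,2) assms less by (simp_all add: nth_eq_iff_index_eq)
      show False
      proof (cases "Suc j = n")
        case True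
        then have "Suc i mod n = 1" using eq(1) assms(3) by simp
        then show False using eq(2) True assms(3) by simp
      next
        case False
        then have "Suc j mod n = Suc j" using ij by simp
        then show False using eq ij assms(3) False by (cases "Suc i = n") auto
      qed
    qed
    then show ?thesis by fastforce
  qed
  ultimately show ?thesis
    using assms by (simp add: card_Un_disjoint card_image)
qed

text \<open>With two vertices the reversal is itself a rotation, which halves the class.\<close>

lemma card_circuit_class_2:
  assumes "distinct vs" "length vs = 2"
  shows "card (circuit_class vs) = 2"
proof -
  obtain a b where vs: "vs = [a, b]" "a \<noteq> b"
    using assms by (auto simp: length_Suc_conv numeral_2_eq_2)
  have rotate2: "rotate i [x, y] \<in> {[x, y], [y, x]}" for i and x y :: 'a
  proof -
    have "i mod length [x, y] = 0 \<or> i mod length [x, y] = 1"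
      by (simp flip: numeral_2_eq_2) presburger
    then show ?thesis
    proof
      assume "i mod length [x, y] = 0"
      then have "rotate i [x, y] = rotate 0 [x, y]" by (metis rotate_conv_mod)
      then show ?thesis by simp
    next
      assume "i mod length [x, y] = 1"
      then have "rotate i [x, y] = rotate (Suc 0) [x, y]" by (metis One_nat_def rotate_conv_mod)
      then show ?thesis by (simp add: rotate_Suc)
    qed
  qed
  have "circuit_class vs \<subseteq> {[a, b], [b, a]}"
  proof
    fix x assume "x \<in> circuit_class vs"
    then obtain i ws where x: "x = rotate i ws" and ws: "ws = vs \<or> ws = rev vs"
      unfolding circuit_class_def by blast
    have "ws = [a, b] \<or> ws = [b, a]" using ws by (simp add: vs)
    then show "x \<in> {[a, b], [b, a]}"
      using rotate2[of i a b] rotate2[of i b a] by (elim disjE) (simp_all only: x insert_commute)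
  qed
  moreover have "rotate 0 vs \<in> circuit_class vs" "rotate 0 (rev vs) \<in> circuit_class vs"
    unfolding circuit_class_def by blast+
  then have "[a, b] \<in> circuit_class vs" "[b, a] \<in> circuit_class vs" by (simp_all add: vs)
  ultimately have "circuit_class vs = {[a, b], [b, a]}" by blast
  then show ?thesis using vs(2) by simp
qed

text \<open>Every vertex lies on two edges of the circuit, so the \<open>tail_sign\<close> factors
  square away. The minus signs of \<open>edge_sign\<close> cancel by the even length.\<close>

lemma oriented_circuit_sign_eq_cyclic_weight:
  assumes D: "chord_diagram D" and t: "chord_orientation D t" and path: "closed_path D vs"
    and even: "even (length vs)"
  shows "oriented_circuit_sign D t vs = cyclic_weight (crossing_number (endpoints D)) vs"
proof -
  let ?n = "length vs" and ?J = "crossing_number (endpoints D)"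
  have mem: "vs ! i \<in> set D" if "i < ?n" for i
    using path that by (auto simp: closed_path_def)
  have "oriented_circuit_sign D t vs
      = (\<Prod>i<?n. tail_sign D t (vs ! i) * tail_sign D t (vs ! (Suc i mod ?n)) *
          - ?J (vs ! i) (vs ! (Suc i mod ?n)))"
    unfolding oriented_circuit_sign_def
  proof (rule prod.cong)
    fix i assume "i \<in> {..<?n}"
    then have i: "i < ?n" by simp
    then have "0 < ?n" by linarith
    then have "Suc i mod ?n < ?n" by simp
    with i show "(if edge_from_to D t (vs ! i) (vs ! (Suc i mod ?n)) then 1 else - 1)
      = tail_sign D t (vs ! i) * tail_sign D t (vs ! (Suc i mod ?n)) * - ?J (vs ! i) (vs ! (Suc i
          mod ?n))"
      using path mem by (intro edge_sign[OF D t]) (auto simp: closed_path_def)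
  qed simp
  also have "\<dots> = (\<Prod>i<?n. tail_sign D t (vs ! i)) * (\<Prod>i<?n. tail_sign D t (vs ! (Suc i mod ?n)))
      * (\<Prod>i<?n. - ?J (vs ! i) (vs ! (Suc i mod ?n)))"
    by (simp only: prod.distrib)
  also have "(\<Prod>i<?n. tail_sign D t (vs ! (Suc i mod ?n))) = (\<Prod>i<?n. tail_sign D t (vs ! i))"
    using prod_lessThan_rotate[of "\<lambda>i. tail_sign D t (vs ! i)" 1 ?n] by simp
  also have "(\<Prod>i<?n. tail_sign D t (vs ! i)) * (\<Prod>i<?n. tail_sign D t (vs ! i)) = 1"
    unfolding prod.distrib[symmetric] by (intro prod.neutral) (auto simp: tail_sign_def)
  also have "(\<Prod>i<?n. - ?J (vs ! i) (vs ! (Suc i mod ?n))) = cyclic_weight ?J vs"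
    using even by (simp add: prod_uminus cyclic_weight_def)
  finally show ?thesis by simp
qed

text \<open>A factor vanishes exactly at a pair of consecutive chords that do not intersect, so the
  sum over all permutations sees only circuits.\<close>

lemma closed_path_iff_cyclic_weight:
  assumes D: "chord_diagram D" and vs: "set vs \<subseteq> set D"
  shows "closed_path D vs \<longleftrightarrow> cyclic_weight (crossing_number (endpoints D)) vs \<noteq> 0"
proof -
  have "intersecting D (vs ! i) (vs ! (Suc i mod length vs))
      \<longleftrightarrow> crossing_number (endpoints D) (vs ! i) (vs ! (Suc i mod length vs)) \<noteq> 0"
    if i: "i < length vs" for i
  proof -
    have "0 < length vs" using i by linarith
    then have "vs ! i \<in> set D" "vs ! (Suc i mod length vs) \<in> set D"
      using vs i by (auto intro!: subsetD[OF vs] nth_mem)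
    then show ?thesis using crossing_number_eq_0_iff[OF D] by blast
  qed
  then show ?thesis
    using vs by (auto simp: closed_path_def cyclic_weight_def)
qed

text \<open>A class contains one list for every starting point and direction, that is
  \<open>2 * 2m\<close>, but only \<open>2\<close> for \<open>m = 1\<close>, and the weight is
  constant on it.\<close>

lemma sum_path_sum_eq_circuits:
  assumes D: "chord_diagram D" and t: "chord_orientation D t" and m: "m \<ge> 1" "card (set D) = 2 * m"
  shows "(\<Sum>v\<in>set D. path_sum (crossing_number (endpoints D)) v (set D - {v}) v)
    = (if m = 1 then 2 else 4 * int m) * (\<Sum>s\<in>circuits D (2 * m). circuit_sign D t s)"
proof -
  let ?J = "crossing_number (endpoints D)" and ?V = "set D"
  define L where "L = {vs. length vs = 2 * m \<and> distinct vs \<and> closed_path D vs}"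
  let ?w = "cyclic_weight ?J"
  have perm: "vs \<in> permutations_of_set ?V \<longleftrightarrow> length vs = 2 * m \<and> distinct vs \<and> set vs \<subseteq> ?V" for vs
  proof
    assume "length vs = 2 * m \<and> distinct vs \<and> set vs \<subseteq> ?V"
    then show "vs \<in> permutations_of_set ?V"
      using m(2) card_subset_eq[of ?V "set vs"] distinct_card[of vs]
          by (simp add: permutations_of_set_def)
  qed (use m(2) distinct_card[of vs] in \<open>auto simp: permutations_of_set_def\<close>)
  have L: "L = {vs \<in> permutations_of_set ?V. ?w vs \<noteq> 0}"
    using closed_path_iff_cyclic_weight[OF D] by (auto simp: L_def perm closed_path_def)
  have finL: "finite L" unfolding L by simp
  have same: "?w ws = ?w vs" "length ws = length vs" "distinct ws \<longleftrightarrow> distinct vs" "set ws = set vs"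
    if "ws \<in> circuit_class vs" "vs \<in> L" for vs ws
  proof -
    have "?w (rev vs) = ?w vs"
      using that(2) crossing_number_skew[OF D]
      by (intro cyclic_weight_rev) (auto simp: L_def closed_path_def)
    then show "?w ws = ?w vs" "length ws = length vs" "distinct ws \<longleftrightarrow> distinct vs" "set ws = set vs"
      using that(1) by (auto simp: circuit_class_def cyclic_weight_rotate)
  qed
  then have class_L: "ws \<in> L" if "ws \<in> circuit_class vs" "vs \<in> L" for vs ws
    using that(2) same[OF that] unfolding L mem_Collect_eq perm by simp
  have fiber: "{vs \<in> L. circuit_class vs = s} = s" if s: "s \<in> circuit_class ` L" for s
  proof -
    obtain vs where "vs \<in> L" "s = circuit_class vs" using s by auto
    then have "x \<in> s \<longleftrightarrow> x \<in> L \<and> circuit_class x = s" for x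
      using class_L circuit_class_eq self_in_circuit_class by metis
    then show ?thesis by blast
  qed
  have "(\<Sum>v\<in>?V. path_sum ?J v (?V - {v}) v) = (\<Sum>vs\<in>permutations_of_set ?V. ?w vs)"
    using m by (intro sum_path_sum_eq) auto
  also have "\<dots> = (\<Sum>vs\<in>L. ?w vs)"
    unfolding L by (rule sum.mono_neutral_right) auto
  also have "\<dots> = (\<Sum>s\<in>circuit_class ` L. \<Sum>vs\<in>{vs \<in> L. circuit_class vs = s}. ?w vs)"
    by (rule sum.image_gen[OF finL])
  also have "\<dots> = (\<Sum>s\<in>circuit_class ` L. (if m = 1 then 2 else 4 * int m) * circuit_sign D t s)"
  proof (rule sum.cong)
    fix s assume s: "s \<in> circuit_class ` L"
    then obtain vs where vs: "vs \<in> L" "s = circuit_class vs" by auto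
    define us where "us = (SOME vs. vs \<in> s)"
    have "us \<in> s" unfolding us_def using vs self_in_circuit_class by (metis someI)
    then have us: "us \<in> L" "?w us = ?w vs" using class_L same vs by auto
    have "circuit_sign D t s = ?w vs"
      using oriented_circuit_sign_eq_cyclic_weight[OF D t, of us] us
      by (simp add: circuit_sign_def us_def[symmetric] L_def)
    moreover have "(\<Sum>ws\<in>s. ?w ws) = of_nat (card s) * ?w vs"
      using same(1) vs by simp
    moreover have "int (card s) = (if m = 1 then 2 else 4 * int m)"
      using vs m card_circuit_class[of vs "2 * m"] card_circuit_class_2[of vs] by (auto simp: L_def)
    ultimately show "(\<Sum>vs\<in>{vs \<in> L. circuit_class vs = s}. ?w vs)
        = (if m = 1 then 2 else 4 * int m) * circuit_sign D t s"
      unfolding fiber[OF s] by simp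
  qed simp
  also have "\<dots> = (if m = 1 then 2 else 4 * int m) * (\<Sum>s\<in>circuits D (2 * m). circuit_sign D t s)"
    by (simp add: sum_distrib_left circuits_def L_def)
  finally show ?thesis .
qed

section \<open>The leading coefficient\<close>

definition scale_tensor :: "'u::ring_1 \<Rightarrow> ('u \<times> 'u) list \<Rightarrow> ('u \<times> 'u) list" where
  "scale_tensor c t = map (apfst ((*) c)) t"

lemma sandwich_scale_tensor:
  assumes c: "\<And>x. c * x = x * c"
  shows "sandwich i (scale_tensor c t) X = c * sandwich i t X"
proof -
  have "x * (c * y) = c * (x * y)" for x y using c by (metis mult.assoc)
  then show ?thesis
    unfolding scale_tensor_def
    by (induction t) (auto simp: sandwich_Cons leg_def distrib_left mult.assoc)
qed

lemma tensor_value_scale_tensor: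
  assumes "finite V" "distinct Y" "set Y = V \<times> UNIV"
  shows "tensor_value V (\<lambda>a. scale_tensor (op_const (k a)) (t a)) Y
    = op_const (\<Prod>a\<in>V. k a) * tensor_value V t Y"
proof -
  have "tensor_value V t Y * op_const (\<Prod>a\<in>B. k a)
      = tensor_value V (\<lambda>a. if a \<in> B then scale_tensor (op_const (k a)) (t a) else t a) Y"
    if "finite B" "B \<subseteq> V" for B
    using that
  proof (induction B)
    case (insert b B)
    let ?\<sigma> = "\<lambda>a. if a \<in> B then scale_tensor (op_const (k a)) (t a) else t a"
    have "tensor_value V (?\<sigma>(b := scale_tensor (op_const (k b)) (t b))) Y
        = op_const (k b) * tensor_value V (?\<sigma>(b := t b)) Y + tensor_value V (?\<sigma>(b := [])) Y"
      using insert.prems assms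
      by (intro tensor_value_linear) (auto simp: sandwich_scale_tensor op_const_commute)
    moreover have "?\<sigma>(b := t b) = ?\<sigma>" using insert by auto
    moreover have "?\<sigma>(b := scale_tensor (op_const (k b)) (t b))
        = (\<lambda>a. if a \<in> insert b B then scale_tensor (op_const (k a)) (t a) else t a)" by auto
    ultimately have "tensor_value V (\<lambda>a. if a \<in> insert b B then scale_tensor (op_const (k a)) (t a)
        else t a) Y
        = op_const (k b) * (tensor_value V t Y * op_const (\<Prod>a\<in>B. k a))"
      using insert by (simp add: tensor_value_Nil)
    also have "\<dots> = tensor_value V t Y * op_const (\<Prod>a\<in>insert b B. k a)"
      using insert by (simp add: op_const_mult mult.assoc op_const_commute[of "k b"])
        (metis mult.assoc op_const_commute)
    finally show ?case by simp
  qed simp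
  from this[of V] assms(1) have "tensor_value V t Y * op_const (\<Prod>a\<in>V. k a)
      = tensor_value V (\<lambda>a. if a \<in> V then scale_tensor (op_const (k a)) (t a) else t a) Y" by simp
  also have "\<dots> = tensor_value V (\<lambda>a. scale_tensor (op_const (k a)) (t a)) Y"
    using assms(3) by (intro tensor_value_cong) auto
  finally show ?thesis by (simp add: op_const_commute)
qed

text \<open>Reads the scalar off a scalar operator. Being linear, it may be applied termwise to a
  sum whose terms need not be scalar operators.\<close>

definition vacuum :: "'a::field_char_0 poly_operator \<Rightarrow> 'a" where
  "vacuum P = coeff (operator_apply P 1) 0"

lemma vacuum_add: "vacuum (P + Q) = vacuum P + vacuum Q"
  and vacuum_const_mult: "vacuum (op_const c * P) = c * vacuum P"
  and vacuum_1 [simp]: "vacuum 1 = 1"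
  and vacuum_0 [simp]: "vacuum 0 = 0"
  by (simp_all add: vacuum_def)

lemma op_const_sum: "op_const (\<Sum>i\<in>I. c i) = (\<Sum>i\<in>I. op_const (c i))"
  by (induction I rule: infinite_finite_induct) (simp_all add: op_const_add)

lemma op_const_power: "op_const (c ^ n) = op_const c ^ n"
  by (induction n) (simp_all add: op_const_mult)

lemma vacuum_const: "vacuum (op_const c) = c"
  using vacuum_const_mult[of c 1] by simp

lemma vacuum_sum: "vacuum (\<Sum>i\<in>I. P i) = (\<Sum>i\<in>I. vacuum (P i))"
  by (induction I rule: infinite_finite_induct) (simp_all add: vacuum_add)

lemma op_const_diff: "op_const (a - b) = op_const a - op_const b"
  using op_const_add[of "a - b" b] by simp

lemma op_const_of_int: "op_const (of_int k) = of_int k"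
  by (cases k) (simp_all add: op_const_of_nat op_const_uminus op_const_diff)

lemma vacuum_of_int_mult: "vacuum (of_int k * P) = of_int k * vacuum P"
  by (metis op_const_of_int vacuum_const_mult)

interpretation osc: weyl_pair op_x op_deriv
  by standard (rule op_deriv_x)

definition verma_tensor :: "'a::field_char_0 \<Rightarrow> ('a poly_operator \<times> 'a poly_operator) list" where
  "verma_tensor l = map (map_prod (U_verma l) (U_verma l)) casimir_tensor"

text \<open>The part of degree \<open>0\<close> in \<open>l\<close>, up to the factor
  \<open>1/2\<close>. A word with this tensor on some chord cannot reach the top degree.\<close>

definition verma_remainder :: "('a::field_char_0 poly_operator \<times> 'a poly_operator) list" where
  "verma_remainder = [(- (op_x * op_deriv * op_deriv), op_x), (- op_x, op_x * op_deriv * op_deriv),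
     (op_x * op_deriv + op_x * op_deriv, op_x * op_deriv)]"

text \<open>The Casimir scalar \<open>l^2/4 + l/2\<close> cancels the \<open>l^2/4\<close> coming
  from \<open>H \<otimes> H / 4\<close>, and its second term supplies the summand
  \<open>- 1 \<otimes> 1\<close> of the oscillator.\<close>

lemma verma_tensor_expansion:
  "tensor_equiv (verma_tensor l @ [(op_const (- poly casimir_poly l), 1)])
    (scale_tensor (op_const (l / 2)) osc.oscillator @ scale_tensor (op_const (1 / 2))
        verma_remainder)"
  unfolding tensor_equiv_def
proof (intro allI)
  fix i and X :: "'a poly_operator"
  define q :: "'a poly_operator" where "q = op_const (1 / 4)"
  define L where "L = op_const l"
  have comm: "P * q = q * P" "P * L = L * P" "P * (q * Q) = q * (P * Q)" "P * (L * Q)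
      = L * (P * Q)" for P Q
    unfolding q_def L_def by (metis op_const_commute mult.assoc)+
  note rules = comm(1)[of op_x] comm(1)[of op_deriv] comm(1)[of X] comm(1)[of L]
    comm(2)[of op_x] comm(2)[of op_deriv] comm(2)[of X]
    comm(3)[of op_x] comm(3)[of op_deriv] comm(3)[of X] comm(3)[of L]
    comm(4)[of op_x] comm(4)[of op_deriv] comm(4)[of X]
  have half: "op_const (1 / 2) = q + q"
    unfolding q_def by (simp flip: op_const_add)
  have "l / 2 = 1 / 4 * l + 1 / 4 * l" by simp
  then have l2: "op_const (l / 2) = q * L + q * L"
    by (simp only: op_const_add op_const_mult q_def L_def)
  have "- poly casimir_poly l = - (1 / 4 * (l * l) + 1 / 4 * l + 1 / 4 * l)"
    by (simp add: casimir_poly_def field_simps)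
  then have c: "op_const (- poly casimir_poly l) = - (q * (L * L) + q * L + q * L)"
    by (simp only: op_const_uminus op_const_add op_const_mult q_def L_def)
  have T: "verma_tensor l = [(q * verma_H l, verma_H l), ((q + q) * verma_E l, op_x), ((q
      + q) * op_x, verma_E l)]"
    by (simp add: verma_tensor_def casimir_tensor_def verma.U_lift_mult verma.U_lift_add
        verma.U_lift_const verma.U_lift_incl q_def)
  show "sandwich i (verma_tensor l @ [(op_const (- poly casimir_poly l), 1)]) X
    = sandwich i (scale_tensor (op_const (l / 2)) osc.oscillator
        @ scale_tensor (op_const (1 / 2)) verma_remainder) X"
    unfolding T half l2 c
    by (cases i)
       (simp_all add: scale_tensor_def osc.oscillator_def verma_remainder_def sandwich_Cons leg_def
          verma_E_def verma_H_def L_def[symmetric] algebra_simps rules)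
qed

lemma U_verma_chord_value: "U_verma l (chord_value casimir_tensor D) = chord_value (verma_tensor l)
    D"
  unfolding verma_tensor_def by (rule verma.U_lift_chord_value)

lemma chord_diagram_restrict: "chord_diagram D \<Longrightarrow> chord_diagram (restrict_chords D U)"
  unfolding chord_diagram_def
proof
  fix a assume D: "\<forall>a\<in>set D. count_list D a = 2" and "a \<in> set (restrict_chords D U)"
  then have a: "a \<in> U" "a \<in> set D" by (auto simp: restrict_chords_def)
  have "filter (\<lambda>x. a = x \<and> x \<in> U) D = filter ((=) a) D"
    using a by (intro filter_cong) auto
  then have "count_list (restrict_chords D U) a = count_list D a"
    by (simp add: restrict_chords_def count_list_eq_length_filter conj_commute)
  then show "count_list (restrict_chords D U) a = 2" using D a by simp
qed

lemma endpoints_restrict: "endpoints (restrict_chords D U) = filter (\<lambda>p. fst p \<in> U) (endpoints D)"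
  unfolding restrict_chords_def by (rule endpoints_filter)

lemma set_restrict_chords: "set (restrict_chords D U) = set D \<inter> U"
  by (auto simp: restrict_chords_def)

section \<open>Degrees and leading coefficients\<close>

lemma coeff_mult_bounded:
  assumes "degree p \<le> a" "degree q \<le> b"
  shows "coeff (p * q) (a + b) = coeff p a * coeff q b"
proof -
  have "coeff (p * q) (a + b) = (\<Sum>i\<in>{..a + b}. coeff p i * coeff q (a + b - i))"
    by (rule coeff_mult)
  also have "\<dots> = (\<Sum>i\<in>{a}. coeff p i * coeff q (a + b - i))"
  proof (rule sum.mono_neutral_right)
    show "\<forall>i\<in>{..a + b} - {a}. coeff p i * coeff q (a + b - i) = 0"
    proof
      fix i assume "i \<in> {..a + b} - {a}"
      then have "degree p < i \<or> degree q < a + b - i" using assms by auto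
      then show "coeff p i * coeff q (a + b - i) = 0" by (auto simp: coeff_eq_0)
    qed
  qed auto
  finally show ?thesis by simp
qed

definition graded :: "'c set \<Rightarrow> ('c set \<Rightarrow> 'a::comm_ring_1 poly) \<Rightarrow> bool" where
  "graded V f \<longleftrightarrow> (\<forall>U\<subseteq>V. degree (f U) \<le> card U)"

text \<open>The coefficient at the largest degree allowed by \<open>graded\<close>, possibly
  \<open>0\<close>. Taken at this fixed place it is multiplicative for
  \<open>subset_conv\<close>.\<close>

definition leading_part :: "('c set \<Rightarrow> 'a::comm_ring_1 poly) \<Rightarrow> 'c set \<Rightarrow> 'a" where
  "leading_part f U = coeff (f U) (card U)"

lemma graded_subset_conv:
  assumes "finite V" "graded V f" "graded V g"
  shows "graded V (subset_conv f g)"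
  unfolding graded_def subset_conv_def
proof (intro allI impI degree_sum_le)
  fix U W assume U: "U \<subseteq> V" and W: "W \<in> Pow U"
  have "finite U" using U assms(1) finite_subset by blast
  have "card W + card (U - W) = card U"
    using W \<open>finite U\<close> by (metis PowD card_Diff_subset card_mono finite_subset le_add_diff_inverse)
  moreover have "W \<subseteq> V" "U - W \<subseteq> V" using U W by auto
  then have "degree (f W) \<le> card W" "degree (g (U - W)) \<le> card (U - W)"
    using assms(2,3) by (simp_all add: graded_def)
  ultimately show "degree (f W * g (U - W)) \<le> card U"
    using degree_mult_le[of "f W" "g (U - W)"] by linarith
qed (use assms(1) finite_subset in blast)

lemma leading_part_subset_conv:
  assumes "finite V" "graded V f" "graded V g" "U \<subseteq> V"
  shows "leading_part (subset_conv f g) U = subset_conv (leading_part f) (leading_part g) U"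
  unfolding leading_part_def subset_conv_def coeff_sum
proof (rule sum.cong)
  fix W assume W: "W \<in> Pow U"
  have "finite U" using assms finite_subset by blast
  then have "card U = card W + card (U - W)"
    using W by (metis PowD card_Diff_subset card_mono finite_subset le_add_diff_inverse)
  moreover have "W \<subseteq> V" "U - W \<subseteq> V" using assms(4) W by auto
  ultimately show "coeff (f W * g (U - W)) (card U) = coeff (f W) (card W) * coeff (g (U
      - W)) (card (U - W))"
    using assms(2,3) by (simp add: coeff_mult_bounded graded_def)
qed simp

lemma graded_log_derivative:
  assumes "finite V" "graded V f"
  shows "graded V (log_derivative v f)"
  unfolding log_derivative_def
proof (rule graded_subset_conv[OF assms(1)])
  show "graded V (pointed v f)" using assms(2) by (auto simp: graded_def pointed_def)
  have g: "graded V (f(({}) := 0))" using assms(2) by (auto simp: graded_def)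
  have "graded V (subset_conv_power (f(({}) := 0)) k)" for k
  proof (induction k)
    case 0
    then show ?case by (auto simp: graded_def subset_delta_def)
  next
    case (Suc k)
    then show ?case using graded_subset_conv[OF assms(1) g] by (simp del: fun_upd_apply)
  qed
  then have "degree ((- 1) ^ k * subset_conv_power (f(({}) := 0)) k U) \<le> card U" if "U \<subseteq> V" for k U
    using that by (cases "even k") (auto simp: graded_def)
  then show "graded V (subset_conv_inverse f)"
    unfolding graded_def subset_conv_inverse_def by (intro allI impI degree_sum_le) auto
qed

text \<open>Taking leading parts turns the recursion for the logarithmic derivative of
  \<open>f\<close> into the one for the leading part of \<open>f\<close>, and that has only one
  solution.\<close>

lemma leading_part_log_derivative:
  assumes "finite V" "graded V f" "f {} = 1" "U \<subseteq> V"
    and c: "\<And>U. U \<subseteq> V \<Longrightarrow> subset_conv c (leading_part f) U = pointed v (leading_part f) U"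
  shows "leading_part (log_derivative v f) U = c U"
proof -
  have one: "leading_part f {} = 1" using assms(3) by (simp add: leading_part_def)
  have "leading_part (log_derivative v f) U = log_derivative v (leading_part f) U"
  proof (rule log_derivative_unique[where V = V])
    fix W assume W: "W \<subseteq> V"
    then have "subset_conv (leading_part (log_derivative v f)) (leading_part f) W
        = leading_part (subset_conv (log_derivative v f) f) W"
      using leading_part_subset_conv[OF assms(1) graded_log_derivative[OF assms(1,2)] assms(2)]
          by simp
    also have "\<dots> = leading_part (pointed v f) W"
      using subset_conv_log_derivative[of W f v] finite_subset[OF W assms(1)] assms(3)
      by (simp add: leading_part_def)
    also have "\<dots> = pointed v (leading_part f) W"
      by (simp add: leading_part_def pointed_def)
    finally show "subset_conv (leading_part (log_derivative v f)) (leading_part f) W = \<dots>" .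
  qed (use assms(1,4) one in auto)
  also have "\<dots> = c U"
    using log_derivative_unique[of V "leading_part f" c v U] assms(1,4) one c by simp
  finally show ?thesis .
qed

text \<open>\<open>c ^ card W\<close> is the exponential of the function with value \<open>c\<close>
  on single chords, and the logarithm turns the product into a sum.\<close>

lemma log_derivative_subset_conv_power:
  fixes c :: "'r::comm_ring_1"
  assumes "finite V" "f {} = 1" "W \<subseteq> V"
  shows "log_derivative v (subset_conv (\<lambda>W. c ^ card W) f) W
    = log_derivative v f W + (if W = {v} then c else 0)"
proof (rule log_derivative_unique[where V = V, symmetric])
  let ?E = "\<lambda>W :: 'a set. c ^ card W" and ?e = "\<lambda>W. if W = {v} then c else 0"
  show "subset_conv ?E f {} = 1" using assms(2) by (simp add: subset_conv_def)
  fix U assume "U \<subseteq> V"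
  then have fin: "finite U" using assms(1) finite_subset by blast
  have fin': "finite W" if "W \<subseteq> U" for W using that fin finite_subset by blast
  have pE: "subset_conv ?e ?E W = pointed v ?E W" if "finite W" for W
  proof -
    have "subset_conv ?e ?E W = (\<Sum>X\<in>Pow W. if X = {v} then c * c ^ card (W - {v}) else 0)"
      unfolding subset_conv_def by (rule sum.cong) auto
    also have "\<dots> = (if v \<in> W then c * c ^ card (W - {v}) else 0)"
      using that by (subst sum.delta) auto
    also have "\<dots> = pointed v ?E W"
    proof (cases "v \<in> W")
      case True
      then have "c * c ^ card (W - {v}) = c ^ card W"
        by (simp only: card.remove[OF that True] power_Suc)
      then show ?thesis using True by (simp add: pointed_def)
    qed (simp add: pointed_def)
    finally show ?thesis .
  qed
  have "subset_conv (\<lambda>W. log_derivative v f W + ?e W) (subset_conv ?E f) U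
      = subset_conv (log_derivative v f) (subset_conv ?E f) U + subset_conv ?e (subset_conv ?E f) U"
    by (rule subset_conv_add_left)
  also have "subset_conv ?e (subset_conv ?E f) U = subset_conv (subset_conv ?e ?E) f U"
    using fin by (simp add: subset_conv_assoc)
  also have "\<dots> = subset_conv (pointed v ?E) f U"
    using pE fin' by (intro subset_conv_cong) auto
  also have "subset_conv (log_derivative v f) (subset_conv ?E f) U
      = subset_conv (subset_conv (log_derivative v f) ?E) f U"
    using fin by (simp add: subset_conv_assoc)
  also have "\<dots> = subset_conv (subset_conv ?E (log_derivative v f)) f U"
    by (intro subset_conv_cong subset_conv_commute refl)
  also have "\<dots> = subset_conv ?E (subset_conv (log_derivative v f) f) U"
    using fin by (simp add: subset_conv_assoc)
  also have "\<dots> = subset_conv ?E (pointed v f) U"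
    using subset_conv_log_derivative[of _ f v] assms(2) fin' by (intro subset_conv_cong) auto
  finally show "subset_conv (\<lambda>W. log_derivative v f W + ?e W) (subset_conv ?E f) U
      = pointed v (subset_conv ?E f) U"
    by (simp add: pointed_subset_conv add.commute)
qed (use assms in auto)

text \<open>Connected sums become products in the enveloping algebra, where all factors are
  polynomials in the Casimir element. The whole computation thus moves to polynomials.\<close>

lemma weight_primitive_projection_rep:
  fixes e e' :: "'i \<Rightarrow> 'a::field_char_0 sl2"
  assumes dual: "sl2_dual_bases (sl2_form 2) I e e'" and D: "chord_diagram D"
    and P: "\<And>U. chord_value casimir_tensor (restrict_chords D U) = casimir_eval (P U :: 'a poly)"
  shows "weight_sl2 I e e' (primitive_projection_rep D)
    = casimir_eval (\<Sum>k = 1..card (set D). \<Sum>Vs\<in>ordered_partitions k (set D).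
        smult ((-1) ^ (k - 1) / of_nat k) (prod_list (map P Vs)))"
proof -
  have "chord_weight I (U_incl \<circ> e) (U_incl \<circ> e') (concat (map (restrict_chords D) Vs))
      = casimir_eval (prod_list (map P Vs))" if Vs: "Vs \<in> ordered_partitions k (set D)" for k Vs
  proof -
    have dist: "disjoint (set Vs)" "distinct Vs"
      using Vs by (auto simp: ordered_partitions_def partition_on_def)
    have "chord_diagram (concat (map (restrict_chords D) Vs))"
      using dist
    proof (induction Vs)
      case (Cons V Vs)
      have disj: "set (restrict_chords D V) \<inter> set (concat (map (restrict_chords D) Vs)) = {}"
      proof -
        have "V \<inter> W = {}" if "W \<in> set Vs" for W
          using Cons.prems that by (auto simp: disjoint_def)
        then show ?thesis by (fastforce simp: restrict_chords_def)
      qed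
      have "chord_diagram (concat (map (restrict_chords D) Vs))"
        using Cons by (simp add: disjoint_def)
      then show ?case
        using chord_diagram_restrict[OF D, of V] disj
        by (auto simp: chord_diagram_def count_list_0_iff)
    qed (simp add: chord_diagram_def)
    then have "chord_weight I (U_incl \<circ> e) (U_incl \<circ> e') (concat (map (restrict_chords D) Vs))
        = chord_value casimir_tensor (concat (map (restrict_chords D) Vs))"
      by (rule chord_weight_eq_chord_value[OF dual])
    then show ?thesis
      using dist by (simp add: chord_value_concat_restrict P casimir_eval_prod_list comp_def)
  qed
  then show ?thesis
    by (simp add: primitive_projection_rep_def weight_sl2_sum weight_sl2_single casimir_eval_sum
        casimir_eval_smult)
qed

lemma coeff_pcompose_bounded:
  fixes p q :: "'a::idom poly"
  assumes "degree p \<le> m" "0 < degree q"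
  shows "coeff (pcompose p q) (m * degree q) = coeff p m * lead_coeff q ^ m"
proof (cases "degree p = m")
  case True
  then show ?thesis using lead_coeff_comp[of q p] assms(2) by (simp add: degree_pcompose)
next
  case False
  then have "degree p < m" using assms(1) by simp
  moreover have "degree (pcompose p q) < m * degree q"
    using \<open>degree p < m\<close> assms(2) by (simp add: degree_pcompose)
  ultimately show ?thesis by (simp add: coeff_eq_0)
qed

lemma pcompose_prod_list: "pcompose (prod_list ps) q = prod_list (map (\<lambda>p. pcompose p q) ps)"
  by (induction ps) (simp_all add: pcompose_mult pcompose_1)

lemma poly_ext:
  fixes p q :: "'a::field_char_0 poly"
  assumes "\<And>l. poly p l = poly q l"
  shows "p = q"
  using assms by (simp add: fun_eq_iff flip: poly_eq_poly_eq_iff)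

section \<open>The projection as a polynomial in the Casimir element\<close>

locale chord_diagram_casimir =
  fixes D :: "'c list" and P :: "'c set \<Rightarrow> 'a::field_char_0 poly"
  assumes diagram: "chord_diagram D"
    and eval: "chord_value casimir_tensor (restrict_chords D U) = casimir_eval (P U)"
begin

sublocale oscillator_word "set D" "endpoints D" "op_x :: 'a poly_operator" op_deriv
  by (intro oscillator_word.intro ordered_endpoints diagram osc.weyl_pair_axioms)

definition verma_value :: "'c set \<Rightarrow> 'a poly" where
  "verma_value U = pcompose (P U) casimir_poly"

text \<open>Inclusion and exclusion over the chords that receive the negative Casimir scalar: the
  values obtained when this scalar is subtracted from the tensor of every chord.\<close>

definition deframed_value :: "'c set \<Rightarrow> 'a poly" where
  "deframed_value = subset_conv (\<lambda>W. (- casimir_poly) ^ card W) verma_value"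

definition vacuum_value :: "'c set \<Rightarrow> 'a" where
  "vacuum_value U = vacuum (closed_value U)"

lemma op_const_verma_value:
  assumes "U \<subseteq> set D"
  shows "op_const (poly (verma_value U) l)
    = tensor_value U (\<lambda>_. verma_tensor l) (filter (\<lambda>p. fst p \<in> U) (endpoints D))"
proof -
  have "op_const (poly (verma_value U) l) = U_verma l (casimir_eval (P U))"
    by (simp add: verma_value_def U_verma_casimir_eval)
  also have "\<dots> = chord_value (verma_tensor l) (restrict_chords D U)"
    by (simp add: U_verma_chord_value flip: eval)
  also have "set (restrict_chords D U) = U" using assms by (auto simp: set_restrict_chords)
  then have "chord_value (verma_tensor l) (restrict_chords D U)
      = tensor_value U (\<lambda>_. verma_tensor l) (filter (\<lambda>p. fst p \<in> U) (endpoints D))"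
    by (simp add: chord_value_def endpoints_restrict)
  finally show ?thesis .
qed

lemma verma_value_empty: "verma_value {} = 1"
proof (rule poly_ext)
  fix l :: 'a
  have "op_const (poly (verma_value {}) l) = (1 :: 'a poly_operator)"
    unfolding op_const_verma_value[OF empty_subsetI] by (simp add: tensor_value_def)
  then show "poly (verma_value {}) l = poly 1 l"
    using vacuum_const[of "poly (verma_value {}) l"] by simp
qed

lemma restricted_word:
  assumes "W \<subseteq> set D"
  shows "finite W" "distinct (filter (\<lambda>p. fst p \<in> W) (endpoints D))"
    "set (filter (\<lambda>p. fst p \<in> W) (endpoints D)) = W \<times> UNIV"
  using assms distinct_word set_word finite_subset[OF assms] by auto

text \<open>By multilinearity the subtraction takes place inside the tensors, where the square of
  \<open>l\<close> cancels. A second expansion sorts the result by the set \<open>U\<close> of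
  chords that carry the part of degree \<open>1\<close>.\<close>

lemma poly_deframed_value:
  assumes W: "W \<subseteq> set D"
  shows "poly (deframed_value W) l = (\<Sum>U\<in>Pow W. (1 / 2) ^ card W * l ^ card U *
    vacuum (tensor_value W (\<lambda>a. if a \<in> U then osc.oscillator else verma_remainder)
      (filter (\<lambda>p. fst p \<in> W) (endpoints D))))"
proof -
  let ?Y = "filter (\<lambda>p. fst p \<in> W) (endpoints D)" and ?c = "- poly casimir_poly l"
  note word = restricted_word[OF W]
  have "deframed_value W = (\<Sum>U\<in>Pow W. (- casimir_poly) ^ card (W - U) * verma_value U)"
    unfolding deframed_value_def subset_conv_commute[of _ verma_value W]
    by (simp add: subset_conv_def mult.commute)
  then have "op_const (poly (deframed_value W) l)
      = (\<Sum>U\<in>Pow W. op_const ?c ^ card (W - U) * op_const (poly (verma_value U) l))"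
    by (simp add: poly_sum op_const_sum op_const_mult op_const_power)
  also have "\<dots> = (\<Sum>U\<in>Pow W. tensor_value W (\<lambda>a. if a \<in> U then verma_tensor l else [(op_const ?c,
      1)]) ?Y)"
  proof (rule sum.cong)
    fix U assume U: "U \<in> Pow W"
    have "filter (\<lambda>p. fst p \<in> U) ?Y = filter (\<lambda>p. fst p \<in> U) (endpoints D)"
      using U by (auto intro!: filter_cong)
    then have "tensor_value W (\<lambda>a. if a \<in> U then verma_tensor l else [(op_const ?c, 1)]) ?Y
      = op_const ?c ^ card (W - U) * tensor_value U (\<lambda>a. if a \<in> U then verma_tensor l else
          [(op_const ?c, 1)])
          (filter (\<lambda>p. fst p \<in> U) (endpoints D))"
      using U tensor_value_scalar_chords[OF word, of U _ "op_const ?c"]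
          by (simp add: op_const_commute)
    also have "tensor_value U (\<lambda>a. if a \<in> U then verma_tensor l else [(op_const ?c, 1)])
          (filter (\<lambda>p. fst p \<in> U) (endpoints D)) = op_const (poly (verma_value U) l)"
      using U W unfolding op_const_verma_value[OF subset_trans[OF PowD[OF U] W]]
      by (intro tensor_value_cong) auto
    finally show "op_const ?c ^ card (W - U) * op_const (poly (verma_value U) l)
      = tensor_value W (\<lambda>a. if a \<in> U then verma_tensor l else [(op_const ?c, 1)]) ?Y" ..
  qed simp
  also have "\<dots> = tensor_value W (\<lambda>_. verma_tensor l @ [(op_const ?c, 1)]) ?Y"
    by (rule tensor_value_expand[OF word, symmetric])
  also have "\<dots> = tensor_value W (\<lambda>_. scale_tensor (op_const (l / 2)) osc.oscillator
      @ scale_tensor (op_const (1 / 2)) verma_remainder) ?Y"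
    by (rule tensor_value_equiv[OF word]) (rule verma_tensor_expansion)
  also have "\<dots> = (\<Sum>U\<in>Pow W. tensor_value W (\<lambda>a. if a \<in> U then scale_tensor (op_const (l / 2))
      osc.oscillator
      else scale_tensor (op_const (1 / 2)) verma_remainder) ?Y)"
    by (rule tensor_value_expand[OF word])
  also have "\<dots> = (\<Sum>U\<in>Pow W. op_const ((1 / 2) ^ card W * l ^ card U) *
    tensor_value W (\<lambda>a. if a \<in> U then osc.oscillator else verma_remainder) ?Y)"
  proof (rule sum.cong)
    fix U assume U: "U \<in> Pow W"
    have "tensor_value W (\<lambda>a. if a \<in> U then scale_tensor (op_const (l / 2)) osc.oscillator
        else scale_tensor (op_const (1 / 2)) verma_remainder) ?Y
      = tensor_value W (\<lambda>a. scale_tensor (op_const (if a \<in> U then l / 2 else 1 / 2))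
          (if a \<in> U then osc.oscillator else verma_remainder)) ?Y"
      by (intro tensor_value_cong) (use word(3) in force)+
    also have "\<dots> = op_const (\<Prod>a\<in>W. if a \<in> U then l / 2 else 1 / 2) *
        tensor_value W (\<lambda>a. if a \<in> U then osc.oscillator else verma_remainder) ?Y"
      by (rule tensor_value_scale_tensor[OF word])
    also have "(\<Prod>a\<in>W. if a \<in> U then l / 2 else 1 / 2) = (\<Prod>a\<in>W. 1 / 2 * (if a \<in> U then l else 1))"
      by (intro prod.cong) auto
    also have "\<dots> = (1 / 2) ^ card W * l ^ card U"
    proof -
      have "(\<Prod>a\<in>W. if a \<in> U then l else 1) = (\<Prod>a\<in>W \<inter> U. l)"
        using word(1) by (rule prod.inter_restrict[symmetric])
      moreover have "W \<inter> U = U" using U by auto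
      ultimately show ?thesis by (simp only: prod.distrib prod_constant)
    qed
    finally show "tensor_value W (\<lambda>a. if a \<in> U then scale_tensor (op_const (l / 2)) osc.oscillator
        else scale_tensor (op_const (1 / 2)) verma_remainder) ?Y
      = op_const ((1 / 2) ^ card W * l ^ card U) *
        tensor_value W (\<lambda>a. if a \<in> U then osc.oscillator else verma_remainder) ?Y" .
  qed simp
  finally have "vacuum (op_const (poly (deframed_value W) l)) = vacuum \<dots>" by simp
  then show ?thesis
    by (simp only: vacuum_const vacuum_sum vacuum_const_mult)
qed

lemma graded_deframed_value: "graded (set D) deframed_value"
  and leading_part_deframed_value:
    "W \<subseteq> set D \<Longrightarrow> leading_part deframed_value W = (1 / 2) ^ card W * vacuum_value W"
proof -
  define g :: "'c set \<Rightarrow> 'c set \<Rightarrow> 'a" where "g W U = (1 / 2) ^ card W *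
    vacuum (tensor_value W (\<lambda>a. if a \<in> U then osc.oscillator else verma_remainder)
      (filter (\<lambda>p. fst p \<in> W) (endpoints D)))" for W U
  have eq: "deframed_value W = (\<Sum>U\<in>Pow W. monom (g W U) (card U))" if W: "W \<subseteq> set D" for W
    by (rule poly_ext) (simp add: poly_deframed_value[OF W] poly_sum poly_monom g_def mult.assoc
        mult.left_commute mult.commute)
  have card: "card U \<le> card W" if "U \<in> Pow W" "W \<subseteq> set D" for U W
    using that restricted_word(1) by (auto intro: card_mono)
  show "graded (set D) deframed_value"
    unfolding graded_def
  proof (intro allI impI)
    fix W assume W: "W \<subseteq> set D"
    show "degree (deframed_value W) \<le> card W"
      unfolding eq[OF W] using restricted_word(1)[OF W] card W
      by (intro degree_sum_le) (auto intro: order_trans[OF degree_monom_le])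
  qed
  show "leading_part deframed_value W = (1 / 2) ^ card W * vacuum_value W" if W: "W \<subseteq> set D"
  proof -
    note word = restricted_word[OF W]
    \<comment> \<open>Degree \<open>card W\<close> is reached only if all chords of \<open>W\<close>
      carry the part of degree \<open>1\<close>, that is, for \<open>U = W\<close>.\<close>
    have "leading_part deframed_value W = (\<Sum>U\<in>Pow W. if U = W then g W U else 0)"
      unfolding leading_part_def eq[OF W] coeff_sum coeff_monom
      using word(1) by (intro sum.cong) (auto dest: card_subset_eq)
    also have "\<dots> = g W W" using word(1) by (simp add: sum.delta)
    also have "\<dots> = (1 / 2) ^ card W * vacuum_value W"
    proof -
      let ?osc = "osc.oscillator :: ('a poly_operator \<times> 'a poly_operator) list"
      have "tensor_value (set D) (\<lambda>a. if a \<in> W then ?osc else osc.unit_tensor) (endpoints D)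
        = tensor_value W (\<lambda>a. if a \<in> W then ?osc else osc.unit_tensor)
            (filter (\<lambda>p. fst p \<in> W) (endpoints D))"
        by (subst tensor_value_scalar_chords[OF finite_chords distinct_word set_word W, of _ 1])
           (auto simp: osc.unit_tensor_def)
      also have "\<dots> = tensor_value W (\<lambda>a. if a \<in> W then ?osc else verma_remainder)
            (filter (\<lambda>p. fst p \<in> W) (endpoints D))"
        using word(3) by (intro tensor_value_cong) force+
      finally show ?thesis by (simp add: g_def vacuum_value_def closed_value_def)
    qed
    finally show ?thesis .
  qed
qed

definition cycle_sum :: "'c \<Rightarrow> 'c set \<Rightarrow> 'a" where
  "cycle_sum v W = (if v \<in> W then of_int (path_sum J v (W - {v}) v) else 0)"

text \<open>\<open>closed_value_insert\<close> in the form of the recursion, so that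
  \<open>cycle_sum v\<close> is the logarithmic derivative of \<open>vacuum_value\<close>.\<close>

lemma cycle_sum_conv:
  assumes U: "U \<subseteq> set D"
  shows "subset_conv (cycle_sum v) vacuum_value U = pointed v vacuum_value U"
proof (cases "v \<in> U")
  case True
  let ?U = "U - {v}"
  have "vacuum_value (insert v ?U)
      = (\<Sum>W\<in>Pow ?U. of_int (path_sum J v W v) * vacuum_value (?U - W))"
    unfolding vacuum_value_def using True U
    by (subst closed_value_insert) (auto simp: vacuum_sum vacuum_of_int_mult)
  also have "\<dots> = (\<Sum>W\<in>{W \<in> Pow U. v \<in> W}. cycle_sum v W * vacuum_value (U - W))"
    by (rule sum.reindex_bij_witness[of _ "\<lambda>W. W - {v}" "insert v"])
       (use True in \<open>auto simp: cycle_sum_def insert_Diff_if Diff_insert0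
          intro!: arg_cong[where f = vacuum_value] arg_cong2[where f = times]
            arg_cong[where f = "\<lambda>W. path_sum J v W v"]\<close>)
  also have "\<dots> = subset_conv (cycle_sum v) vacuum_value U"
    unfolding subset_conv_def using U finite_subset finite_chords
    by (intro sum.mono_neutral_left) (auto simp: cycle_sum_def)
  finally show ?thesis using True by (simp add: pointed_def insert_absorb)
qed (auto simp: subset_conv_def pointed_def cycle_sum_def intro!: sum.neutral)

lemma deframed_value_empty: "deframed_value {} = 1"
  by (simp add: deframed_value_def subset_conv_def verma_value_empty)

lemma scaled_cycle_sum_conv:
  assumes U: "U \<subseteq> set D"
  shows "subset_conv (\<lambda>W. (1 / 2) ^ card W * cycle_sum v W) (leading_part deframed_value) U
    = pointed v (leading_part deframed_value) U"
proof -
  have fin: "finite U" using U finite_subset finite_chords by blast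
  have "subset_conv (\<lambda>W. (1 / 2) ^ card W * cycle_sum v W) (leading_part deframed_value) U
      = (\<Sum>W\<in>Pow U. (1 / 2) ^ card U * (cycle_sum v W * vacuum_value (U - W)))"
    unfolding subset_conv_def
  proof (rule sum.cong)
    fix W assume W: "W \<in> Pow U"
    then have "U - W \<subseteq> set D" using U by auto
    moreover have "card U = card W + card (U - W)"
      using W fin by (metis PowD card_Diff_subset card_mono finite_subset le_add_diff_inverse)
    ultimately show "(1 / 2) ^ card W * cycle_sum v W * leading_part deframed_value (U - W)
        = (1 / 2) ^ card U * (cycle_sum v W * vacuum_value (U - W))"
      by (simp add: leading_part_deframed_value power_add)
  qed simp
  also have "\<dots> = (1 / 2) ^ card U * subset_conv (cycle_sum v) vacuum_value U"
    by (simp add: subset_conv_def sum_distrib_left)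
  also have "\<dots> = pointed v (leading_part deframed_value) U"
    unfolding cycle_sum_conv[OF U] using leading_part_deframed_value[OF U]
        by (simp add: pointed_def)
  finally show ?thesis .
qed

definition primitive_poly :: "'a poly" where
  "primitive_poly = (\<Sum>k = 1..card (set D). \<Sum>Vs\<in>ordered_partitions k (set D).
     smult ((-1) ^ (k - 1) / of_nat k) (prod_list (map P Vs)))"

lemma pcompose_primitive_poly:
  assumes "v \<in> set D"
  shows "pcompose primitive_poly casimir_poly = log_derivative v verma_value (set D)"
proof -
  have "verma_value = (\<lambda>U. pcompose (P U) casimir_poly)"
    by (simp add: fun_eq_iff verma_value_def)
  then show ?thesis
    unfolding log_derivative_eq_ordered_partitions[OF finite_chords assms, symmetric]
        primitive_poly_def
    by (simp add: pcompose_sum pcompose_smult pcompose_prod_list comp_def)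
qed

lemma primitive_poly_leading:
  assumes v: "v \<in> set D" and card: "card (set D) = 2 * m" "m \<ge> 1"
  shows "degree primitive_poly \<le> m" "coeff primitive_poly m = of_int (path_sum J v (set D - {v}) v)"
proof -
  have deg: "degree (casimir_poly :: 'a poly) = 2" "coeff (casimir_poly :: 'a poly) 2 = 1 / 4"
    by (simp_all add: casimir_poly_def numeral_2_eq_2)
  \<comment> \<open>With at least two chords, subtracting the scalar leaves the logarithm at the
    full set unchanged.\<close>
  have "set D \<noteq> {v}" using card by auto
  then have eq: "pcompose primitive_poly casimir_poly = log_derivative v deframed_value (set D)"
    using log_derivative_subset_conv_power[of "set D" verma_value "set D" v "- casimir_poly"]
    by (simp add: pcompose_primitive_poly[OF v] deframed_value_def verma_value_empty)
  have "degree (pcompose primitive_poly (casimir_poly :: 'a poly)) \<le> 2 * m"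
    unfolding eq using graded_log_derivative[OF finite_chords graded_deframed_value, of v] card
    by (auto simp: graded_def)
  then show m: "degree primitive_poly \<le> m" by (simp add: degree_pcompose deg)
  have "coeff (pcompose primitive_poly casimir_poly) (m * 2)
      = leading_part (log_derivative v deframed_value) (set D)"
    by (simp add: eq leading_part_def card mult.commute)
  also have "\<dots> = (1 / 2) ^ card (set D) * cycle_sum v (set D)"
    by (rule leading_part_log_derivative[OF finite_chords graded_deframed_value deframed_value_empty
          subset_refl scaled_cycle_sum_conv])
  also have "coeff (pcompose primitive_poly casimir_poly) (m * 2) = coeff primitive_poly m
      * (1 / 4) ^ m"
    using coeff_pcompose_bounded[OF m, of casimir_poly] by (simp add: deg)
  \<comment> \<open>\<open>(1/2) ^ (2 m)\<close> from the chords cancels against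
    \<open>(1/4) ^ m\<close> from the leading coefficient of the Casimir scalar.\<close>
  finally show "coeff primitive_poly m = of_int (path_sum J v (set D - {v}) v)"
    using v card by (simp add: cycle_sum_def power_mult power_divide power2_eq_square)
qed

lemma coeff_primitive_poly:
  assumes t: "chord_orientation D t" and card: "card (set D) = 2 * m" and m: "m \<ge> 1"
  shows "coeff primitive_poly m = of_rat (2 * circuit_sum m D t)"
proof -
  define S where "S = (\<Sum>s\<in>circuits D (2 * m). circuit_sign D t s)"
  \<comment> \<open>The coefficient is the same for every \<open>v\<close>. Summing over all
    \<open>v\<close> turns circuits from a marked chord into all permutations of the chords.\<close>
  have "of_nat (2 * m) * coeff primitive_poly m = (\<Sum>v\<in>set D. coeff primitive_poly m)"
    by (simp add: card)
  also have "\<dots> = (\<Sum>v\<in>set D. of_int (path_sum J v (set D - {v}) v))"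
    using primitive_poly_leading(2) card m by (intro sum.cong) auto
  also have "\<dots> = of_int ((if m = 1 then 2 else 4 * int m) * S)"
    by (simp only: of_int_sum[symmetric] sum_path_sum_eq_circuits[OF diagram t m card] S_def)
  finally have "of_nat (2 * m) * coeff primitive_poly m = of_int ((if m = 1 then 2 else 4 * int m)
      * S)" .
  \<comment> \<open>For \<open>m = 1\<close> the factor \<open>1/2\<close> in
    \<open>circuit_sum\<close> matches the smaller class of a circuit of length two.\<close>
  moreover have "of_rat (2 * circuit_sum m D t) = (of_int ((if m = 1 then 1 else 2) * S) :: 'a)"
    unfolding circuit_sum_def S_def[symmetric] by (simp add: of_rat_mult of_rat_divide)
  ultimately show ?thesis using m by (auto split: if_splits)
qed

end

theorem mainTheorem1:
  fixes D :: "'c list" and t :: "'c \<Rightarrow> nat" and m :: nat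
    and I :: "'i set" and e e' :: "'i \<Rightarrow> 'a::field_char_0 sl2"
  assumes "m \<ge> 1"
    and "chord_diagram D"
    and "card (set D) = 2 * m"
    and "chord_orientation D t"
    and "sl2_dual_bases (sl2_form 2) I e e'"
  shows "\<exists>q :: nat \<Rightarrow> 'a. \<forall>x \<in> primitive_projection D.
    weight_sl2 I e e' x =
      U_scale (of_rat (2 * circuit_sum m D t)) (casimir_sl2 I e e' ^ m)
      + (\<Sum>i<m. U_scale (q i) (casimir_sl2 I e e' ^ i))"
proof -
  have "\<forall>U. \<exists>p :: 'a poly. chord_value casimir_tensor (restrict_chords D U) = casimir_eval p"
    using chord_value_casimir_eval chord_diagram_restrict assms(2) by blast
  then obtain P :: "'c set \<Rightarrow> 'a poly"
    where P: "\<And>U. chord_value casimir_tensor (restrict_chords D U) = casimir_eval (P U)"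
    by metis
  interpret chord_diagram_casimir D P
    using assms(2) P by unfold_locales
  \<comment> \<open>A chord at which to differentiate; it exists because
    \<open>m \<ge> 1\<close>.\<close>
  obtain v where "v \<in> set D" using assms(1,3) by fastforce
  then have deg: "degree primitive_poly \<le> m" using primitive_poly_leading assms by blast
  show ?thesis
  proof (intro exI[of _ "coeff primitive_poly"] ballI)
    fix x :: "'c list \<Rightarrow>\<^sub>0 'a" assume "x \<in> primitive_projection D"
    then have "weight_sl2 I e e' (x - primitive_projection_rep D) = 0"
      using weight_sl2_chord_relations[OF assms(5)] by (simp add: primitive_projection_def)
    then have "weight_sl2 I e e' x = casimir_eval primitive_poly"
      using weight_primitive_projection_rep[OF assms(5,2) P]
      by (simp add: weight_sl2_diff primitive_poly_def)
    also have "\<dots> = (\<Sum>i\<le>m. U_scale (coeff primitive_poly i) (casimir ^ i))"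
      by (simp add: casimir_eval_superset[OF deg] U_scale_eq)
    also have "\<dots> = U_scale (of_rat (2 * circuit_sum m D t)) (casimir ^ m)
        + (\<Sum>i<m. U_scale (coeff primitive_poly i) (casimir ^ i))"
      using coeff_primitive_poly[OF assms(4,3,1)]
      by (simp add: lessThan_Suc_atMost[symmetric] add.commute)
    finally show "weight_sl2 I e e' x =
      U_scale (of_rat (2 * circuit_sum m D t)) (casimir_sl2 I e e' ^ m)
      + (\<Sum>i<m. U_scale (coeff primitive_poly i) (casimir_sl2 I e e' ^ i))"
      by (simp add: casimir_sl2_eq[OF assms(5)])
  qed
qed

end
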